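(* $\mathsf{IPT}^2_2$ and $\mathsf{IPHT}^2_2$ with apartness are equivalent over $\mathsf{RCA}_0$. Furthermore, $\mathsf{IPT}^2_2$ is strongly computably reducible to $\mathsf{IPHT}^2_2$ with apartness.
   Context: $\mathbb{N}$ denotes the positive integers, $\mathbb{N}_0=\mathbb{N}\cup\{0\}$. $\mathsf{RCA}_0$ is the standard base system of reverse mathematics. For $m\in\mathbb{N}$, $\lambda(m)$ and $\mu(m)$ are the least and greatest exponents in the binary expansion of $m$; $X\subseteq\mathbb{N}$ is apart if for all $x<x'$ in $X$, $\mu(x)<\lambda(x')$. $\mathsf{IPT}^2_2$: for every $c:[\mathbb{N}_0]^2\to 2$ there are infinite $H_1,H_2\subseteq\mathbb{N}$ such that $c(\{x_1,x_2\})$ is the same for all $x_1\in H_1$, $x_2\in H_2$ with $x_1<x_2$. $\mathsf{IPHT}^2_2$ with apartness: for every $f:\mathbb{N}\to 2$ there are infinite $H_1,H_2\subseteq\mathbb{N}$ with $H_1\cup H_2$ apart and a colour $k<2$ such that $f(x_1+x_2)=k$ for all $x_1\in H_1$, $x_2\in H_2$ with $x_1<x_2$. $\mathsf{Q}$ is strongly computably reducible to $\mathsf{P}$ if for every instance $I$ of $\mathsf{Q}$ there is an instance $J$ of $\mathsf{P}$ computable from $I$ such that every solution of $J$ computes a solution of $I$. *)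

theory Defs
  imports Main "HOL-Library.Nat_Bijection"
begin

section \<open>The language of second-order arithmetic\<close>

text \<open>
  Two-sorted first-order logic with named variables and, in addition, parameters
  (\<open>P\<close>, \<open>SP\<close>), which are never bound.  As only variable-free terms are ever
  substituted by the quantifier rules below, substitution needs no renaming.
\<close>

datatype tm =
    V string
  | P nat
  | Zero  (\<open>\<^bold>0\<close>)
  | One  (\<open>\<^bold>1\<close>)
  | Add tm tm  (infixl \<open>\<^bold>+\<close> 65)
  | Mul tm tm  (infixl \<open>\<^bold>*\<close> 70)

datatype st = SV string | SP nat

datatype fm =
    Fls  (\<open>\<^bold>\<bottom>\<close>)
  | Eq tm tm  (infix \<open>\<^bold>=\<close> 50)
  | Less tm tm  (infix \<open>\<^bold><\<close> 50)
  | Mem tm st  (infix \<open>\<^bold>\<in>\<close> 50)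
  | Imp fm fm  (infixr \<open>\<^bold>\<longrightarrow>\<close> 25)
  | AllN string fm  (\<open>(3\<^bold>\<forall>_./ _)\<close> [0, 10] 10)
  | AllS string fm  (\<open>(3\<^bold>\<forall>\<^sub>s_./ _)\<close> [0, 10] 10)

abbreviation Neg :: "fm \<Rightarrow> fm"  (\<open>\<^bold>\<not> _\<close> [40] 40)
  where "\<^bold>\<not> \<phi> \<equiv> (\<phi> \<^bold>\<longrightarrow> \<^bold>\<bottom>)"

abbreviation And :: "fm \<Rightarrow> fm \<Rightarrow> fm"  (infixr \<open>\<^bold>\<and>\<close> 35)
  where "\<phi> \<^bold>\<and> \<psi> \<equiv> \<^bold>\<not> (\<phi> \<^bold>\<longrightarrow> \<^bold>\<not> \<psi>)"

abbreviation Or :: "fm \<Rightarrow> fm \<Rightarrow> fm"  (infixr \<open>\<^bold>\<or>\<close> 30)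
  where "\<phi> \<^bold>\<or> \<psi> \<equiv> (\<^bold>\<not> \<phi> \<^bold>\<longrightarrow> \<psi>)"

abbreviation Iff :: "fm \<Rightarrow> fm \<Rightarrow> fm"  (infixr \<open>\<^bold>\<longleftrightarrow>\<close> 25)
  where "\<phi> \<^bold>\<longleftrightarrow> \<psi> \<equiv> ((\<phi> \<^bold>\<longrightarrow> \<psi>) \<^bold>\<and> (\<psi> \<^bold>\<longrightarrow> \<phi>))"

abbreviation ExN :: "string \<Rightarrow> fm \<Rightarrow> fm"  (\<open>(3\<^bold>\<exists>_./ _)\<close> [0, 10] 10)
  where "\<^bold>\<exists>x. \<phi> \<equiv> \<^bold>\<not> (\<^bold>\<forall>x. \<^bold>\<not> \<phi>)"

abbreviation ExS :: "string \<Rightarrow> fm \<Rightarrow> fm"  (\<open>(3\<^bold>\<exists>\<^sub>s_./ _)\<close> [0, 10] 10)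
  where "\<^bold>\<exists>\<^sub>sX. \<phi> \<equiv> \<^bold>\<not> (\<^bold>\<forall>\<^sub>sX. \<^bold>\<not> \<phi>)"

primrec vars_tm :: "tm \<Rightarrow> string set" where
  "vars_tm (V x) = {x}"
| "vars_tm (P a) = {}"
| "vars_tm \<^bold>0 = {}"
| "vars_tm \<^bold>1 = {}"
| "vars_tm (s \<^bold>+ t) = vars_tm s \<union> vars_tm t"
| "vars_tm (s \<^bold>* t) = vars_tm s \<union> vars_tm t"

primrec pars_tm :: "tm \<Rightarrow> nat set" where
  "pars_tm (V x) = {}"
| "pars_tm (P a) = {a}"
| "pars_tm \<^bold>0 = {}"
| "pars_tm \<^bold>1 = {}"
| "pars_tm (s \<^bold>+ t) = pars_tm s \<union> pars_tm t"
| "pars_tm (s \<^bold>* t) = pars_tm s \<union> pars_tm t"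

primrec vars_st :: "st \<Rightarrow> string set" where
  "vars_st (SV X) = {X}"
| "vars_st (SP a) = {}"

primrec pars_st :: "st \<Rightarrow> nat set" where
  "pars_st (SV X) = {}"
| "pars_st (SP a) = {a}"

primrec free_num :: "fm \<Rightarrow> string set" where
  "free_num \<^bold>\<bottom> = {}"
| "free_num (s \<^bold>= t) = vars_tm s \<union> vars_tm t"
| "free_num (s \<^bold>< t) = vars_tm s \<union> vars_tm t"
| "free_num (t \<^bold>\<in> S) = vars_tm t"
| "free_num (\<phi> \<^bold>\<longrightarrow> \<psi>) = free_num \<phi> \<union> free_num \<psi>"
| "free_num (\<^bold>\<forall>x. \<phi>) = free_num \<phi> - {x}"
| "free_num (\<^bold>\<forall>\<^sub>sX. \<phi>) = free_num \<phi>"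

primrec free_set :: "fm \<Rightarrow> string set" where
  "free_set \<^bold>\<bottom> = {}"
| "free_set (s \<^bold>= t) = {}"
| "free_set (s \<^bold>< t) = {}"
| "free_set (t \<^bold>\<in> S) = vars_st S"
| "free_set (\<phi> \<^bold>\<longrightarrow> \<psi>) = free_set \<phi> \<union> free_set \<psi>"
| "free_set (\<^bold>\<forall>x. \<phi>) = free_set \<phi>"
| "free_set (\<^bold>\<forall>\<^sub>sX. \<phi>) = free_set \<phi> - {X}"

primrec pars_num :: "fm \<Rightarrow> nat set" where
  "pars_num \<^bold>\<bottom> = {}"
| "pars_num (s \<^bold>= t) = pars_tm s \<union> pars_tm t"
| "pars_num (s \<^bold>< t) = pars_tm s \<union> pars_tm t"
| "pars_num (t \<^bold>\<in> S) = pars_tm t"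
| "pars_num (\<phi> \<^bold>\<longrightarrow> \<psi>) = pars_num \<phi> \<union> pars_num \<psi>"
| "pars_num (\<^bold>\<forall>x. \<phi>) = pars_num \<phi>"
| "pars_num (\<^bold>\<forall>\<^sub>sX. \<phi>) = pars_num \<phi>"

primrec pars_set :: "fm \<Rightarrow> nat set" where
  "pars_set \<^bold>\<bottom> = {}"
| "pars_set (s \<^bold>= t) = {}"
| "pars_set (s \<^bold>< t) = {}"
| "pars_set (t \<^bold>\<in> S) = pars_st S"
| "pars_set (\<phi> \<^bold>\<longrightarrow> \<psi>) = pars_set \<phi> \<union> pars_set \<psi>"
| "pars_set (\<^bold>\<forall>x. \<phi>) = pars_set \<phi>"
| "pars_set (\<^bold>\<forall>\<^sub>sX. \<phi>) = pars_set \<phi>"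

definition sentence :: "fm \<Rightarrow> bool" where
  "sentence \<phi> \<longleftrightarrow> free_num \<phi> = {} \<and> free_set \<phi> = {} \<and> pars_num \<phi> = {} \<and> pars_set \<phi> = {}"

primrec subst_tm :: "string \<Rightarrow> tm \<Rightarrow> tm \<Rightarrow> tm" where
  "subst_tm x u (V y) = (if x = y then u else V y)"
| "subst_tm x u (P a) = P a"
| "subst_tm x u \<^bold>0 = \<^bold>0"
| "subst_tm x u \<^bold>1 = \<^bold>1"
| "subst_tm x u (s \<^bold>+ t) = subst_tm x u s \<^bold>+ subst_tm x u t"
| "subst_tm x u (s \<^bold>* t) = subst_tm x u s \<^bold>* subst_tm x u t"

primrec subst_st :: "string \<Rightarrow> st \<Rightarrow> st \<Rightarrow> st" where
  "subst_st X U (SV Y) = (if X = Y then U else SV Y)"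
| "subst_st X U (SP a) = SP a"

primrec subst_num :: "string \<Rightarrow> tm \<Rightarrow> fm \<Rightarrow> fm" where
  "subst_num x u \<^bold>\<bottom> = \<^bold>\<bottom>"
| "subst_num x u (s \<^bold>= t) = (subst_tm x u s \<^bold>= subst_tm x u t)"
| "subst_num x u (s \<^bold>< t) = (subst_tm x u s \<^bold>< subst_tm x u t)"
| "subst_num x u (t \<^bold>\<in> S) = (subst_tm x u t \<^bold>\<in> S)"
| "subst_num x u (\<phi> \<^bold>\<longrightarrow> \<psi>) = (subst_num x u \<phi> \<^bold>\<longrightarrow> subst_num x u \<psi>)"
| "subst_num x u (\<^bold>\<forall>y. \<phi>) = (\<^bold>\<forall>y. if x = y then \<phi> else subst_num x u \<phi>)"
| "subst_num x u (\<^bold>\<forall>\<^sub>sY. \<phi>) = (\<^bold>\<forall>\<^sub>sY. subst_num x u \<phi>)"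

primrec subst_set :: "string \<Rightarrow> st \<Rightarrow> fm \<Rightarrow> fm" where
  "subst_set X U \<^bold>\<bottom> = \<^bold>\<bottom>"
| "subst_set X U (s \<^bold>= t) = (s \<^bold>= t)"
| "subst_set X U (s \<^bold>< t) = (s \<^bold>< t)"
| "subst_set X U (t \<^bold>\<in> S) = (t \<^bold>\<in> subst_st X U S)"
| "subst_set X U (\<phi> \<^bold>\<longrightarrow> \<psi>) = (subst_set X U \<phi> \<^bold>\<longrightarrow> subst_set X U \<psi>)"
| "subst_set X U (\<^bold>\<forall>y. \<phi>) = (\<^bold>\<forall>y. subst_set X U \<phi>)"
| "subst_set X U (\<^bold>\<forall>\<^sub>sY. \<phi>) = (\<^bold>\<forall>\<^sub>sY. if X = Y then \<phi> else subst_set X U \<phi>)"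


section \<open>Classical derivability\<close>

inductive derivable :: "fm set \<Rightarrow> fm \<Rightarrow> bool"  (infix \<open>\<turnstile>\<close> 20) where
  Assm: "\<phi> \<in> \<Gamma> \<Longrightarrow> \<Gamma> \<turnstile> \<phi>"
| ImpI: "insert \<phi> \<Gamma> \<turnstile> \<psi> \<Longrightarrow> \<Gamma> \<turnstile> (\<phi> \<^bold>\<longrightarrow> \<psi>)"
| ImpE: "\<Gamma> \<turnstile> (\<phi> \<^bold>\<longrightarrow> \<psi>) \<Longrightarrow> \<Gamma> \<turnstile> \<phi> \<Longrightarrow> \<Gamma> \<turnstile> \<psi>"
| Classical: "insert (\<^bold>\<not> \<phi>) \<Gamma> \<turnstile> \<^bold>\<bottom> \<Longrightarrow> \<Gamma> \<turnstile> \<phi>"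
| AllNI: "\<Gamma> \<turnstile> subst_num x (P a) \<phi> \<Longrightarrow> a \<notin> (\<Union>\<psi> \<in> insert \<phi> \<Gamma>. pars_num \<psi>) \<Longrightarrow> \<Gamma> \<turnstile> (\<^bold>\<forall>x. \<phi>)"
| AllNE: "\<Gamma> \<turnstile> (\<^bold>\<forall>x. \<phi>) \<Longrightarrow> vars_tm t = {} \<Longrightarrow> \<Gamma> \<turnstile> subst_num x t \<phi>"
| AllSI: "\<Gamma> \<turnstile> subst_set X (SP a) \<phi> \<Longrightarrow> a \<notin> (\<Union>\<psi> \<in> insert \<phi> \<Gamma>. pars_set \<psi>) \<Longrightarrow> \<Gamma> \<turnstile> (\<^bold>\<forall>\<^sub>sX. \<phi>)"
| AllSE: "\<Gamma> \<turnstile> (\<^bold>\<forall>\<^sub>sX. \<phi>) \<Longrightarrow> \<Gamma> \<turnstile> subst_set X (SP a) \<phi>"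
| EqRefl: "\<Gamma> \<turnstile> (t \<^bold>= t)"
| EqSubst: "\<Gamma> \<turnstile> (s \<^bold>= t) \<Longrightarrow> \<Gamma> \<turnstile> subst_num x s \<phi> \<Longrightarrow> vars_tm s = {} \<Longrightarrow> vars_tm t = {} \<Longrightarrow>
    \<Gamma> \<turnstile> subst_num x t \<phi>"


section \<open>The system \<open>RCA\<^sub>0\<close>\<close>

inductive Sigma00 :: "fm \<Rightarrow> bool" where
  "Sigma00 \<^bold>\<bottom>"
| "Sigma00 (s \<^bold>= t)"
| "Sigma00 (s \<^bold>< t)"
| "Sigma00 (t \<^bold>\<in> S)"
| "Sigma00 \<phi> \<Longrightarrow> Sigma00 \<psi> \<Longrightarrow> Sigma00 (\<phi> \<^bold>\<longrightarrow> \<psi>)"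
| "Sigma00 \<phi> \<Longrightarrow> x \<notin> vars_tm t \<Longrightarrow> Sigma00 (\<^bold>\<forall>x. V x \<^bold>< t \<^bold>\<longrightarrow> \<phi>)"
| "Sigma00 \<phi> \<Longrightarrow> x \<notin> vars_tm t \<Longrightarrow> Sigma00 (\<^bold>\<exists>x. V x \<^bold>< t \<^bold>\<and> \<phi>)"

definition Sigma01 :: "fm \<Rightarrow> bool" where
  "Sigma01 \<phi> \<longleftrightarrow> (\<exists>x \<theta>. Sigma00 \<theta> \<and> \<phi> = (\<^bold>\<exists>x. \<theta>))"

definition Pi01 :: "fm \<Rightarrow> bool" where
  "Pi01 \<phi> \<longleftrightarrow> (\<exists>x \<theta>. Sigma00 \<theta> \<and> \<phi> = (\<^bold>\<forall>x. \<theta>))"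

definition universal_closures :: "fm \<Rightarrow> fm set" where
  "universal_closures \<phi> = {\<psi>. sentence \<psi> \<and> (\<exists>xs Xs. \<psi> = foldr AllN xs (foldr AllS Xs \<phi>))}"

definition basic_axioms :: "fm set" where
  "basic_axioms = (let m = V ''m''; n = V ''n'' in
    {\<^bold>\<forall>''n''. \<^bold>\<not> (n \<^bold>+ \<^bold>1 \<^bold>= \<^bold>0),
     \<^bold>\<forall>''m''. \<^bold>\<forall>''n''. m \<^bold>+ \<^bold>1 \<^bold>= n \<^bold>+ \<^bold>1 \<^bold>\<longrightarrow> m \<^bold>= n,
     \<^bold>\<forall>''m''. m \<^bold>+ \<^bold>0 \<^bold>= m,
     \<^bold>\<forall>''m''. \<^bold>\<forall>''n''. m \<^bold>+ (n \<^bold>+ \<^bold>1) \<^bold>= (m \<^bold>+ n) \<^bold>+ \<^bold>1,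
     \<^bold>\<forall>''m''. m \<^bold>* \<^bold>0 \<^bold>= \<^bold>0,
     \<^bold>\<forall>''m''. \<^bold>\<forall>''n''. m \<^bold>* (n \<^bold>+ \<^bold>1) \<^bold>= m \<^bold>* n \<^bold>+ m,
     \<^bold>\<forall>''m''. \<^bold>\<not> (m \<^bold>< \<^bold>0),
     \<^bold>\<forall>''m''. \<^bold>\<forall>''n''. m \<^bold>< n \<^bold>+ \<^bold>1 \<^bold>\<longleftrightarrow> m \<^bold>< n \<^bold>\<or> m \<^bold>= n})"

text \<open>Substituting \<open>V x \<^bold>+ \<^bold>1\<close> for \<open>x\<close> itself cannot lead to capture.\<close>

definition induction_instance :: "string \<Rightarrow> fm \<Rightarrow> fm" where
  "induction_instance x \<phi> =
    (subst_num x \<^bold>0 \<phi> \<^bold>\<and> (\<^bold>\<forall>x. \<phi> \<^bold>\<longrightarrow> subst_num x (V x \<^bold>+ \<^bold>1) \<phi>) \<^bold>\<longrightarrow> (\<^bold>\<forall>x. \<phi>))"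

definition comprehension_instance :: "string \<Rightarrow> string \<Rightarrow> fm \<Rightarrow> fm \<Rightarrow> fm" where
  "comprehension_instance x X \<phi> \<psi> =
    ((\<^bold>\<forall>x. \<phi> \<^bold>\<longleftrightarrow> \<psi>) \<^bold>\<longrightarrow> (\<^bold>\<exists>\<^sub>sX. \<^bold>\<forall>x. V x \<^bold>\<in> SV X \<^bold>\<longleftrightarrow> \<phi>))"

definition RCA0 :: "fm set" where
  "RCA0 = basic_axioms
    \<union> (\<Union>{universal_closures (induction_instance x \<phi>) |x \<phi>. Sigma01 \<phi>})
    \<union> (\<Union>{universal_closures (comprehension_instance x X \<phi> \<psi>) |x X \<phi> \<psi>.
          Sigma01 \<phi> \<and> Pi01 \<psi> \<and> X \<notin> free_set \<phi>})"


section \<open>The two principles as sentences of second-order arithmetic\<close>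

text \<open>
  The number variables of the object language range over \<open>\<nat>\<^sub>0\<close>.  Functions are sets of
  pairs, a pair \<open>(i, j)\<close> being coded by \<open>(i + j)\<^sup>2 + i\<close>, and the unordered pair
  \<open>{x, y}\<close> with \<open>x < y\<close> is coded by \<open>(x, y)\<close>.

  The names bound inside the following formulas must differ from those of the
  variables in their arguments: each definition binds only names that do not occur in
  the arguments to which it is applied below.
\<close>

abbreviation Two :: tm  (\<open>\<^bold>2\<close>) where "\<^bold>2 \<equiv> \<^bold>1 \<^bold>+ \<^bold>1"

definition pair :: "tm \<Rightarrow> tm \<Rightarrow> tm" where
  "pair s t = (s \<^bold>+ t) \<^bold>* (s \<^bold>+ t) \<^bold>+ s"

definition is_function :: "st \<Rightarrow> fm" where
  "is_function G = (let z = V ''z''; n = V ''n''; y = V ''y''; y' = V ''y2'' in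
    (\<^bold>\<forall>''z''. z \<^bold>\<in> G \<^bold>\<longrightarrow> (\<^bold>\<exists>''n''. \<^bold>\<exists>''y''. z \<^bold>= pair n y)) \<^bold>\<and>
    (\<^bold>\<forall>''n''. \<^bold>\<exists>''y''. pair n y \<^bold>\<in> G \<^bold>\<and> (\<^bold>\<forall>''y2''. pair n y' \<^bold>\<in> G \<^bold>\<longrightarrow> y' \<^bold>= y)))"

text \<open>\<open>f : \<nat> \<rightarrow> 2\<close>, where \<open>\<nat>\<close> is the set of positive integers.\<close>

definition is_colouring :: "st \<Rightarrow> fm" where
  "is_colouring F = (let z = V ''z''; n = V ''n''; k = V ''k''; j = V ''j'' in
    (\<^bold>\<forall>''z''. z \<^bold>\<in> F \<^bold>\<longrightarrow> (\<^bold>\<exists>''n''. \<^bold>\<exists>''k''. \<^bold>0 \<^bold>< n \<^bold>\<and> k \<^bold>< \<^bold>2 \<^bold>\<and> z \<^bold>= pair n k)) \<^bold>\<and>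
    (\<^bold>\<forall>''n''. \<^bold>0 \<^bold>< n \<^bold>\<longrightarrow>
      (\<^bold>\<exists>''k''. k \<^bold>< \<^bold>2 \<^bold>\<and> pair n k \<^bold>\<in> F \<^bold>\<and> (\<^bold>\<forall>''j''. pair n j \<^bold>\<in> F \<^bold>\<longrightarrow> j \<^bold>= k))))"

text \<open>\<open>c : [\<nat>\<^sub>0]\<^sup>2 \<rightarrow> 2\<close>\<close>

definition is_pair_colouring :: "st \<Rightarrow> fm" where
  "is_pair_colouring C =
    (let z = V ''z''; x = V ''x''; y = V ''y''; k = V ''k''; j = V ''j'' in
    (\<^bold>\<forall>''z''. z \<^bold>\<in> C \<^bold>\<longrightarrow>
      (\<^bold>\<exists>''x''. \<^bold>\<exists>''y''. \<^bold>\<exists>''k''. x \<^bold>< y \<^bold>\<and> k \<^bold>< \<^bold>2 \<^bold>\<and> z \<^bold>= pair (pair x y) k)) \<^bold>\<and>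
    (\<^bold>\<forall>''x''. \<^bold>\<forall>''y''. x \<^bold>< y \<^bold>\<longrightarrow>
      (\<^bold>\<exists>''k''. k \<^bold>< \<^bold>2 \<^bold>\<and> pair (pair x y) k \<^bold>\<in> C \<^bold>\<and>
        (\<^bold>\<forall>''j''. pair (pair x y) j \<^bold>\<in> C \<^bold>\<longrightarrow> j \<^bold>= k))))"

definition is_infinite :: "st \<Rightarrow> fm" where
  "is_infinite H = (\<^bold>\<forall>''n''. \<^bold>\<exists>''x''. V ''n'' \<^bold>< V ''x'' \<^bold>\<and> V ''x'' \<^bold>\<in> H)"

definition is_positive :: "st \<Rightarrow> fm" where
  "is_positive H = (\<^bold>\<forall>''x''. V ''x'' \<^bold>\<in> H \<^bold>\<longrightarrow> \<^bold>0 \<^bold>< V ''x'')"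

text \<open>\<open>2\<^sup>e = p\<close>, for the function defined by \<open>2\<^sup>0 = 1\<close> and \<open>2\<^sup>n\<^sup>+\<^sup>1 = 2 \<cdot> 2\<^sup>n\<close>.\<close>

definition exp2_eq :: "tm \<Rightarrow> tm \<Rightarrow> fm" where
  "exp2_eq e p = (let G = SV ''G''; n = V ''n''; y = V ''y'' in
    (\<^bold>\<exists>\<^sub>s''G''. is_function G \<^bold>\<and> pair \<^bold>0 \<^bold>1 \<^bold>\<in> G \<^bold>\<and>
      (\<^bold>\<forall>''n''. \<^bold>\<forall>''y''. pair n y \<^bold>\<in> G \<^bold>\<longrightarrow> pair (n \<^bold>+ \<^bold>1) (\<^bold>2 \<^bold>* y) \<^bold>\<in> G) \<^bold>\<and>
      pair e p \<^bold>\<in> G))"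

text \<open>
  \<open>2\<^sup>e\<close> is a summand of the binary expansion of \<open>m\<close>:
  \<open>m = q \<cdot> 2\<^sup>e\<^sup>+\<^sup>1 + 2\<^sup>e + r\<close> with \<open>r < 2\<^sup>e\<close>.
\<close>

definition is_exponent :: "tm \<Rightarrow> tm \<Rightarrow> fm" where
  "is_exponent e m = (let p = V ''p''; q = V ''q''; r = V ''r'' in
    (\<^bold>\<exists>''p''. exp2_eq e p \<^bold>\<and>
      (\<^bold>\<exists>''q''. \<^bold>\<exists>''r''. r \<^bold>< p \<^bold>\<and> m \<^bold>= q \<^bold>* (\<^bold>2 \<^bold>* p) \<^bold>+ p \<^bold>+ r)))"

definition lambda_eq :: "tm \<Rightarrow> tm \<Rightarrow> fm" where
  "lambda_eq m e = (let d = V ''d'' in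
    is_exponent e m \<^bold>\<and> (\<^bold>\<forall>''d''. is_exponent d m \<^bold>\<longrightarrow> e \<^bold>< d \<^bold>\<or> e \<^bold>= d))"

definition mu_eq :: "tm \<Rightarrow> tm \<Rightarrow> fm" where
  "mu_eq m e = (let d = V ''d'' in
    is_exponent e m \<^bold>\<and> (\<^bold>\<forall>''d''. is_exponent d m \<^bold>\<longrightarrow> d \<^bold>< e \<^bold>\<or> d \<^bold>= e))"

definition is_apart :: "st \<Rightarrow> fm" where
  "is_apart U = (let x = V ''x''; x' = V ''x2''; a = V ''a''; b = V ''b'' in
    (\<^bold>\<forall>''x''. \<^bold>\<forall>''x2''. x \<^bold>\<in> U \<^bold>\<and> x' \<^bold>\<in> U \<^bold>\<and> x \<^bold>< x' \<^bold>\<longrightarrow>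
      (\<^bold>\<exists>''a''. \<^bold>\<exists>''b''. mu_eq x a \<^bold>\<and> lambda_eq x' b \<^bold>\<and> a \<^bold>< b)))"

definition is_union :: "st \<Rightarrow> st \<Rightarrow> st \<Rightarrow> fm" where
  "is_union U A B = (\<^bold>\<forall>''x''. V ''x'' \<^bold>\<in> U \<^bold>\<longleftrightarrow> V ''x'' \<^bold>\<in> A \<^bold>\<or> V ''x'' \<^bold>\<in> B)"

definition IPT :: fm where
  "IPT = (let C = SV ''C''; H\<^sub>1 = SV ''H1''; H\<^sub>2 = SV ''H2'';
              k = V ''k''; x\<^sub>1 = V ''x1''; x\<^sub>2 = V ''x2'' in
    (\<^bold>\<forall>\<^sub>s''C''. is_pair_colouring C \<^bold>\<longrightarrow>
      (\<^bold>\<exists>\<^sub>s''H1''. \<^bold>\<exists>\<^sub>s''H2''.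
        is_positive H\<^sub>1 \<^bold>\<and> is_infinite H\<^sub>1 \<^bold>\<and> is_positive H\<^sub>2 \<^bold>\<and> is_infinite H\<^sub>2 \<^bold>\<and>
        (\<^bold>\<exists>''k''. k \<^bold>< \<^bold>2 \<^bold>\<and>
          (\<^bold>\<forall>''x1''. \<^bold>\<forall>''x2''. x\<^sub>1 \<^bold>\<in> H\<^sub>1 \<^bold>\<and> x\<^sub>2 \<^bold>\<in> H\<^sub>2 \<^bold>\<and> x\<^sub>1 \<^bold>< x\<^sub>2 \<^bold>\<longrightarrow>
            pair (pair x\<^sub>1 x\<^sub>2) k \<^bold>\<in> C)))))"

definition IPHT_apart :: fm where
  "IPHT_apart = (let F = SV ''F''; H\<^sub>1 = SV ''H1''; H\<^sub>2 = SV ''H2''; U = SV ''U'';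
              k = V ''k''; x\<^sub>1 = V ''x1''; x\<^sub>2 = V ''x2'' in
    (\<^bold>\<forall>\<^sub>s''F''. is_colouring F \<^bold>\<longrightarrow>
      (\<^bold>\<exists>\<^sub>s''H1''. \<^bold>\<exists>\<^sub>s''H2''.
        is_positive H\<^sub>1 \<^bold>\<and> is_infinite H\<^sub>1 \<^bold>\<and> is_positive H\<^sub>2 \<^bold>\<and> is_infinite H\<^sub>2 \<^bold>\<and>
        (\<^bold>\<exists>\<^sub>s''U''. is_union U H\<^sub>1 H\<^sub>2 \<^bold>\<and> is_apart U) \<^bold>\<and>
        (\<^bold>\<exists>''k''. k \<^bold>< \<^bold>2 \<^bold>\<and>
          (\<^bold>\<forall>''x1''. \<^bold>\<forall>''x2''. x\<^sub>1 \<^bold>\<in> H\<^sub>1 \<^bold>\<and> x\<^sub>2 \<^bold>\<in> H\<^sub>2 \<^bold>\<and> x\<^sub>1 \<^bold>< x\<^sub>2 \<^bold>\<longrightarrow>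
            pair (x\<^sub>1 \<^bold>+ x\<^sub>2) k \<^bold>\<in> F)))))"


section \<open>Relative computability and strong computable reducibility\<close>

text \<open>
  \<open>recursive_in A n f\<close>: the function \<open>f\<close>, on argument lists of length \<open>n\<close>, is general
  recursive in the oracle \<open>A\<close>.  Minimization is restricted to regular functions, so that
  all functions are total; the values of \<open>f\<close> on lists of other lengths are irrelevant.
\<close>

inductive recursive_in :: "nat set \<Rightarrow> nat \<Rightarrow> (nat list \<Rightarrow> nat) \<Rightarrow> bool" for A :: "nat set" where
  zero: "recursive_in A n (\<lambda>_. 0)"
| suc: "recursive_in A 1 (\<lambda>xs. Suc (xs ! 0))"
| proj: "i < n \<Longrightarrow> recursive_in A n (\<lambda>xs. xs ! i)"
| oracle_query: "recursive_in A 1 (\<lambda>xs. of_bool (xs ! 0 \<in> A))"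
| comp: "recursive_in A (length gs) f \<Longrightarrow> (\<And>g. g \<in> set gs \<Longrightarrow> recursive_in A n g) \<Longrightarrow>
    recursive_in A n (\<lambda>xs. f (map (\<lambda>g. g xs) gs))"
| prim_rec: "recursive_in A n f \<Longrightarrow> recursive_in A (Suc (Suc n)) g \<Longrightarrow>
    recursive_in A (Suc n) (\<lambda>xs. rec_nat (f (tl xs)) (\<lambda>k v. g (k # v # tl xs)) (hd xs))"
| minim: "recursive_in A (Suc n) f \<Longrightarrow> (\<And>xs. length xs = n \<Longrightarrow> \<exists>k. f (k # xs) = 0) \<Longrightarrow>
    recursive_in A n (\<lambda>xs. LEAST k. f (k # xs) = 0)"

definition computable_from :: "nat set \<Rightarrow> nat set \<Rightarrow> bool" where
  "computable_from B A \<longleftrightarrow> (\<exists>f. recursive_in A 1 f \<and> (\<forall>x. f [x] = of_bool (x \<in> B)))"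

datatype problem = Problem (instances: "nat set set") (solutions: "nat set \<Rightarrow> nat set set")

definition strongly_computably_reducible :: "problem \<Rightarrow> problem \<Rightarrow> bool" where
  "strongly_computably_reducible Q R \<longleftrightarrow>
    (\<forall>I \<in> instances Q. \<exists>J \<in> instances R. computable_from J I \<and>
      (\<forall>S \<in> solutions R J. \<exists>T \<in> solutions Q I. computable_from T S))"


section \<open>The two principles as problems\<close>

text \<open>
  Colourings are presented by their graphs, and a solution \<open>H\<^sub>1, H\<^sub>2\<close> by the join of the
  two sets.
\<close>

definition join :: "nat set \<Rightarrow> nat set \<Rightarrow> nat set" where
  "join A B = {2 * n |n. n \<in> A} \<union> {2 * n + 1 |n. n \<in> B}"

definition pair_colouring_graph :: "(nat set \<Rightarrow> nat) \<Rightarrow> nat set" where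
  "pair_colouring_graph c = {prod_encode (prod_encode (x, y), c {x, y}) |x y. x < y}"

definition colouring_graph :: "(nat \<Rightarrow> nat) \<Rightarrow> nat set" where
  "colouring_graph f = {prod_encode (n, f n) |n. 0 < n}"

definition lam :: "nat \<Rightarrow> nat" where "lam m = Min (set_decode m)"

definition mu :: "nat \<Rightarrow> nat" where "mu m = Max (set_decode m)"

definition apart :: "nat set \<Rightarrow> bool" where
  "apart X \<longleftrightarrow> (\<forall>x \<in> X. \<forall>x' \<in> X. x < x' \<longrightarrow> mu x < lam x')"

definition IPT_problem :: problem where
  "IPT_problem = Problem
    {pair_colouring_graph c |c. \<forall>x y. x < y \<longrightarrow> c {x, y} < 2}
    (\<lambda>I. {join H\<^sub>1 H\<^sub>2 |H\<^sub>1 H\<^sub>2. infinite H\<^sub>1 \<and> infinite H\<^sub>2 \<and> 0 \<notin> H\<^sub>1 \<and> 0 \<notin> H\<^sub>2 \<and>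
      (\<exists>c k. I = pair_colouring_graph c \<and> k < 2 \<and>
        (\<forall>x\<^sub>1 \<in> H\<^sub>1. \<forall>x\<^sub>2 \<in> H\<^sub>2. x\<^sub>1 < x\<^sub>2 \<longrightarrow> c {x\<^sub>1, x\<^sub>2} = k))})"

definition IPHT_apart_problem :: problem where
  "IPHT_apart_problem = Problem
    {colouring_graph f |f. \<forall>n > 0. f n < 2}
    (\<lambda>I. {join H\<^sub>1 H\<^sub>2 |H\<^sub>1 H\<^sub>2. infinite H\<^sub>1 \<and> infinite H\<^sub>2 \<and> 0 \<notin> H\<^sub>1 \<and> 0 \<notin> H\<^sub>2 \<and>
      apart (H\<^sub>1 \<union> H\<^sub>2) \<and>
      (\<exists>f k. I = colouring_graph f \<and> k < 2 \<and>
        (\<forall>x\<^sub>1 \<in> H\<^sub>1. \<forall>x\<^sub>2 \<in> H\<^sub>2. x\<^sub>1 < x\<^sub>2 \<longrightarrow> f (x\<^sub>1 + x\<^sub>2) = k))})"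

end

theory Submission
  imports Defs "HOL-Library.Countable" "HOL-Library.Infinite_Set"
begin

text \<open>
  Given \<open>f : \<nat> \<rightarrow> 2\<close>, colour the pair \<open>{x, y}\<close> by \<open>f (2\<^sup>x + 2\<^sup>y)\<close>; the powers of two with
  exponents in a solution are apart and form a solution for \<open>f\<close>.  Conversely, given
  \<open>c : [\<nat>\<^sub>0]\<^sup>2 \<rightarrow> 2\<close>, colour \<open>m\<close> by \<open>c {\<lambda>(m), \<mu>(m)}\<close>.  If \<open>x\<^sub>1 < x\<^sub>2\<close> are apart, then
  \<open>\<lambda>(x\<^sub>1 + x\<^sub>2) = \<lambda>(x\<^sub>1)\<close> and \<open>\<mu>(x\<^sub>1 + x\<^sub>2) = \<mu>(x\<^sub>2)\<close>, so the values of \<open>\<lambda>\<close> on \<open>H\<^sub>1\<close> and those of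
  \<open>\<mu>\<close> on \<open>H\<^sub>2\<close> form a solution for \<open>c\<close>.  For this \<open>H\<^sub>1\<close> and \<open>H\<^sub>2\<close> have to be disjoint, since
  nothing is known about \<open>c {\<lambda>(x), \<mu>(x)}\<close> for \<open>x \<in> H\<^sub>1 \<inter> H\<^sub>2\<close>; so they are first thinned out,
  taking alternate elements if they are almost equal.

  Derivability in \<open>RCA\<^sub>0\<close> is obtained from Henkin's completeness theorem: it suffices to carry
  out the argument in a model whose numbers and sets are named by terms and parameters.
  There, powers of two and the thinning are provided by a course-of-values recursion for
  sets, which uses Goedel's coding of the finite set of all \<open>x\<close> such that \<open>1 + (x + 1) d\<close>
  divides \<open>c\<close>.
\<close>

section \<open>Henkin's completeness theorem\<close>


text \<open>The model may be nonstandard, and its sets are only known to be closed under Delta01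
  comprehension. Inductions on its numbers must therefore be over Sigma01 statements, and a set can
  be used only once it and its complement are both shown to be Sigma01. Two places need an extra
  idea for this. The values of lambda on a set are in general only Sigma01; apartness makes lambda
  and mu strictly increasing, so one element with a large value bounds the search for all smaller
  values. The powers of x and y are not bounded by the code of the pair, but they are unique, so the
  colouring of pairs is still Delta01. The reduction between problems meets the first difficulty
  again, with decidability in place of Delta01. Whether the two solution sets are almost equal is
  not decided inside the construction: the case distinction is made from outside, which suffices
  both for the existence of sets in the model and for a reducibility that asks for no uniform
  computation.\<close>

lemma imps_intro: "\<Gamma> \<union> set L \<turnstile> \<psi> \<Longrightarrow> \<Gamma> \<turnstile> foldr Imp L \<psi>"
proof (induction L arbitrary: \<Gamma>)
  case (Cons \<phi> L)
  have "insert \<phi> \<Gamma> \<turnstile> foldr Imp L \<psi>"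
    using Cons.prems by (intro Cons.IH) (simp add: insert_commute Un_commute)
  then show ?case by (auto intro: ImpI)
qed simp

lemma imps_elim: "\<Gamma> \<turnstile> foldr Imp L \<psi> \<Longrightarrow> (\<And>\<phi>. \<phi> \<in> set L \<Longrightarrow> \<Gamma> \<turnstile> \<phi>) \<Longrightarrow> \<Gamma> \<turnstile> \<psi>"
  by (induction L) (auto intro: ImpE)

text \<open>
  Keeping the context \<open>T\<close> fixed and moving all further hypotheses into an implication
  makes weakening by arbitrary formulas available without renaming eigenparameters.
\<close>

definition entails :: "fm set \<Rightarrow> fm set \<Rightarrow> fm \<Rightarrow> bool" where
  "entails T \<Delta> \<psi> \<longleftrightarrow> (\<exists>L. set L \<subseteq> \<Delta> \<and> (T \<turnstile> foldr Imp L \<psi>))"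

definition consistent :: "fm set \<Rightarrow> fm set \<Rightarrow> bool" where
  "consistent T \<Delta> \<longleftrightarrow> \<not> entails T \<Delta> \<^bold>\<bottom>"

definition closed :: "fm \<Rightarrow> bool" where
  "closed \<phi> \<longleftrightarrow> free_num \<phi> = {} \<and> free_set \<phi> = {}"

lemma entails_mono: "entails T \<Delta> \<psi> \<Longrightarrow> \<Delta> \<subseteq> \<Delta>' \<Longrightarrow> entails T \<Delta>' \<psi>"
  by (auto simp: entails_def)

lemma entails_derivable: "T \<turnstile> \<psi> \<Longrightarrow> entails T \<Delta> \<psi>"
  unfolding entails_def by (intro exI[of _ "[]"]) simp

lemma entails_assm: "\<psi> \<in> \<Delta> \<Longrightarrow> entails T \<Delta> \<psi>"
  unfolding entails_def by (intro exI[of _ "[\<psi>]"]) (auto intro: ImpI Assm)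

text \<open>A rule may be derived with the implication chain of its premise as an additional
  hypothesis; \<open>ImpI\<close> and \<open>ImpE\<close> cut this hypothesis afterwards, so no
  existing derivation has to be weakened.\<close>

lemma entails_transfer:
  assumes "entails T \<Delta> \<psi>"
    and "\<And>L. set L \<subseteq> \<Delta> \<Longrightarrow>
      \<exists>L'. set L' \<subseteq> \<Delta>' \<and> (insert (foldr Imp L \<psi>) T \<union> set L' \<turnstile> \<psi>')"
  shows "entails T \<Delta>' \<psi>'"
proof -
  obtain L where "set L \<subseteq> \<Delta>" and L: "T \<turnstile> foldr Imp L \<psi>"
    using assms(1) by (auto simp: entails_def)
  then obtain L' where "set L' \<subseteq> \<Delta>'" and L': "insert (foldr Imp L \<psi>) T \<union> set L' \<turnstile> \<psi>'"
    using assms(2) by blast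
  moreover have "T \<turnstile> foldr Imp L' \<psi>'"
    using ImpE[OF ImpI[OF imps_intro[OF L']] L] .
  ultimately show ?thesis by (auto simp: entails_def)
qed

lemma entails_ImpI:
  assumes "entails T (insert \<phi> \<Delta>) \<psi>"
  shows "entails T \<Delta> (\<phi> \<^bold>\<longrightarrow> \<psi>)"
  using assms
proof (rule entails_transfer)
  fix L assume L: "set L \<subseteq> insert \<phi> \<Delta>"
  let ?L' = "filter (\<lambda>\<chi>. \<chi> \<noteq> \<phi>) L"
  have "insert (foldr Imp L \<psi>) T \<union> set ?L' \<turnstile> (\<phi> \<^bold>\<longrightarrow> \<psi>)"
    by (rule ImpI, rule imps_elim[of _ L]) (auto intro: Assm)
  then show "\<exists>L'. set L' \<subseteq> \<Delta> \<and> (insert (foldr Imp L \<psi>) T \<union> set L' \<turnstile> (\<phi> \<^bold>\<longrightarrow> \<psi>))"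
    using L by (intro exI[of _ ?L']) auto
qed

lemma entails_Classical:
  assumes "entails T (insert (\<^bold>\<not> \<phi>) \<Delta>) \<^bold>\<bottom>"
  shows "entails T \<Delta> \<phi>"
  using assms
proof (rule entails_transfer)
  fix L assume L: "set L \<subseteq> insert (\<^bold>\<not> \<phi>) \<Delta>"
  let ?L' = "filter (\<lambda>\<chi>. \<chi> \<noteq> (\<^bold>\<not> \<phi>)) L"
  have "insert (foldr Imp L \<^bold>\<bottom>) T \<union> set ?L' \<turnstile> \<phi>"
    by (rule Classical, rule imps_elim[of _ L]) (auto intro: Assm)
  then show "\<exists>L'. set L' \<subseteq> \<Delta> \<and> (insert (foldr Imp L \<^bold>\<bottom>) T \<union> set L' \<turnstile> \<phi>)"
    using L by (intro exI[of _ ?L']) auto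
qed

lemma entails_ImpE:
  assumes "entails T \<Delta> (\<phi> \<^bold>\<longrightarrow> \<psi>)" and "entails T \<Delta> \<phi>"
  shows "entails T \<Delta> \<psi>"
proof -
  obtain L1 L2 where L: "set L1 \<subseteq> \<Delta>" "set L2 \<subseteq> \<Delta>"
    and 1: "T \<turnstile> foldr Imp L1 (\<phi> \<^bold>\<longrightarrow> \<psi>)" and 2: "T \<turnstile> foldr Imp L2 \<phi>"
    using assms by (auto simp: entails_def)
  let ?G = "insert (foldr Imp L2 \<phi>) (insert (foldr Imp L1 (\<phi> \<^bold>\<longrightarrow> \<psi>)) T) \<union> set (L1 @ L2)"
  have "?G \<turnstile> (\<phi> \<^bold>\<longrightarrow> \<psi>)" "?G \<turnstile> \<phi>"
    by (rule imps_elim[of _ L1] imps_elim[of _ L2]; auto intro: Assm)+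
  then have "T \<turnstile> (foldr Imp L1 (\<phi> \<^bold>\<longrightarrow> \<psi>) \<^bold>\<longrightarrow> foldr Imp L2 \<phi> \<^bold>\<longrightarrow> foldr Imp (L1 @ L2) \<psi>)"
    by (intro ImpI imps_intro) (rule ImpE)
  then have "T \<turnstile> foldr Imp (L1 @ L2) \<psi>" using 1 2 ImpE by blast
  then show ?thesis using L by (auto simp: entails_def intro!: exI[of _ "L1 @ L2"])
qed

lemma entails_AllNE: "entails T \<Delta> (\<^bold>\<forall>x. \<phi>) \<Longrightarrow> vars_tm t = {} \<Longrightarrow> entails T \<Delta> (subst_num x t \<phi>)"
  by (erule entails_ImpE[rotated], rule entails_derivable) (auto intro: ImpI AllNE Assm)

lemma entails_AllSE: "entails T \<Delta> (\<^bold>\<forall>\<^sub>sX. \<phi>) \<Longrightarrow> entails T \<Delta> (subst_set X (SP a) \<phi>)"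
  by (erule entails_ImpE[rotated], rule entails_derivable) (auto intro: ImpI AllSE Assm)

lemma entails_EqSubst:
  assumes "entails T \<Delta> (s \<^bold>= t)" "entails T \<Delta> (subst_num x s \<phi>)" "vars_tm s = {}" "vars_tm t = {}"
  shows "entails T \<Delta> (subst_num x t \<phi>)"
proof -
  have "T \<turnstile> ((s \<^bold>= t) \<^bold>\<longrightarrow> subst_num x s \<phi> \<^bold>\<longrightarrow> subst_num x t \<phi>)"
    using assms(3,4) by (intro ImpI EqSubst[of _ s t]) (auto intro: Assm)
  then show ?thesis using assms(1,2) entails_ImpE entails_derivable by blast
qed

section \<open>Substitution, parameters and the generalization rules for
  \<open>entails\<close>\<close>

lemma subst_tm_fresh: "x \<notin> vars_tm t \<Longrightarrow> subst_tm x u t = t"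
  by (induction t) auto

lemma subst_num_fresh: "x \<notin> free_num \<phi> \<Longrightarrow> subst_num x u \<phi> = \<phi>"
  by (induction \<phi>) (auto simp: subst_tm_fresh)

lemma subst_set_fresh: "X \<notin> free_set \<phi> \<Longrightarrow> subst_set X U \<phi> = \<phi>"
proof (induction \<phi>)
  case (Mem t S) then show ?case by (cases S) auto
qed auto

lemma finite_pars_tm: "finite (pars_tm t)"
  by (induction t) auto

lemma finite_pars_num: "finite (pars_num \<phi>)"
  by (induction \<phi>) (auto simp: finite_pars_tm)

lemma finite_pars_set: "finite (pars_set \<phi>)"
proof (induction \<phi>)
  case (Mem t S) then show ?case by (cases S) auto
qed auto

lemma subst_num_imps:
  "subst_num x u (foldr Imp L \<psi>) = foldr Imp (map (subst_num x u) L) (subst_num x u \<psi>)"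
  by (induction L) auto

lemma subst_set_imps:
  "subst_set x u (foldr Imp L \<psi>) = foldr Imp (map (subst_set x u) L) (subst_set x u \<psi>)"
  by (induction L) auto

lemma pars_num_imps: "pars_num (foldr Imp L \<psi>) = (\<Union>\<phi>\<in>set L. pars_num \<phi>) \<union> pars_num \<psi>"
  by (induction L) auto

lemma pars_set_imps: "pars_set (foldr Imp L \<psi>) = (\<Union>\<phi>\<in>set L. pars_set \<phi>) \<union> pars_set \<psi>"
  by (induction L) auto

text \<open>The hypotheses in the chain are closed, so substitution leaves them alone and the
  quantifier can be put in front of the whole chain. It is moved inwards by taking one instance with
  the hypotheses in the context and generalizing again.\<close>

lemma entails_AllNI:
  assumes T: "\<forall>\<phi>\<in>T. sentence \<phi>" and \<Delta>: "\<forall>\<phi>\<in>\<Delta>. closed \<phi>"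
    and ent: "entails T \<Delta> (subst_num x (P a) \<phi>)" and a: "a \<notin> (\<Union>\<psi>\<in>insert \<phi> \<Delta>. pars_num \<psi>)"
  shows "entails T \<Delta> (\<^bold>\<forall>x. \<phi>)"
proof -
  obtain L where L: "set L \<subseteq> \<Delta>" "T \<turnstile> foldr Imp L (subst_num x (P a) \<phi>)"
    using ent by (auto simp: entails_def)
  have map_id: "map (subst_num x u) L = L" for u
    using L(1) \<Delta> by (intro map_idI subst_num_fresh) (auto simp: closed_def)
  have "T \<turnstile> subst_num x (P a) (foldr Imp L \<phi>)"
    using L(2) by (simp add: subst_num_imps map_id)
  then have gen: "T \<turnstile> (\<^bold>\<forall>x. foldr Imp L \<phi>)"
    using a L(1) T by (intro AllNI) (auto simp: pars_num_imps sentence_def)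
  have "finite (\<Union>\<psi>\<in>insert \<phi> (set L). pars_num \<psi>)"
    by (simp add: finite_pars_num)
  then obtain b where b: "b \<notin> (\<Union>\<psi>\<in>insert \<phi> (set L). pars_num \<psi>)"
    using ex_new_if_finite infinite_UNIV_nat by blast
  let ?G = "insert (\<^bold>\<forall>x. foldr Imp L \<phi>) T \<union> set L"
  have "?G \<turnstile> subst_num x (P b) (foldr Imp L \<phi>)"
    by (rule AllNE) (auto intro: Assm)
  then have "?G \<turnstile> subst_num x (P b) \<phi>"
    by (subst (asm) subst_num_imps, subst (asm) map_id, elim imps_elim) (auto intro: Assm)
  then have "?G \<turnstile> (\<^bold>\<forall>x. \<phi>)"
    using b T by (rule_tac AllNI) (auto simp: pars_num_imps sentence_def)
  then have "T \<turnstile> foldr Imp L (\<^bold>\<forall>x. \<phi>)"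
    using ImpE[OF ImpI[OF imps_intro] gen] by blast
  then show ?thesis using L(1) by (auto simp: entails_def)
qed

lemma entails_AllSI:
  assumes T: "\<forall>\<phi>\<in>T. sentence \<phi>" and \<Delta>: "\<forall>\<phi>\<in>\<Delta>. closed \<phi>"
    and ent: "entails T \<Delta> (subst_set x (SP a) \<phi>)" and a: "a \<notin> (\<Union>\<psi>\<in>insert \<phi> \<Delta>. pars_set \<psi>)"
  shows "entails T \<Delta> (\<^bold>\<forall>\<^sub>sx. \<phi>)"
proof -
  obtain L where L: "set L \<subseteq> \<Delta>" "T \<turnstile> foldr Imp L (subst_set x (SP a) \<phi>)"
    using ent by (auto simp: entails_def)
  have map_id: "map (subst_set x u) L = L" for u
    using L(1) \<Delta> by (intro map_idI subst_set_fresh) (auto simp: closed_def)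
  have "T \<turnstile> subst_set x (SP a) (foldr Imp L \<phi>)"
    using L(2) by (simp add: subst_set_imps map_id)
  then have gen: "T \<turnstile> (\<^bold>\<forall>\<^sub>sx. foldr Imp L \<phi>)"
    using a L(1) T by (intro AllSI) (auto simp: pars_set_imps sentence_def)
  have "finite (\<Union>\<psi>\<in>insert \<phi> (set L). pars_set \<psi>)"
    by (simp add: finite_pars_set)
  then obtain b where b: "b \<notin> (\<Union>\<psi>\<in>insert \<phi> (set L). pars_set \<psi>)"
    using ex_new_if_finite infinite_UNIV_nat by blast
  let ?G = "insert (\<^bold>\<forall>\<^sub>sx. foldr Imp L \<phi>) T \<union> set L"
  have "?G \<turnstile> subst_set x (SP b) (foldr Imp L \<phi>)"
    by (rule AllSE) (auto intro: Assm)
  then have "?G \<turnstile> subst_set x (SP b) \<phi>"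
    by (subst (asm) subst_set_imps, subst (asm) map_id, elim imps_elim) (auto intro: Assm)
  then have "?G \<turnstile> (\<^bold>\<forall>\<^sub>sx. \<phi>)"
    using b T by (rule_tac AllSI) (auto simp: pars_set_imps sentence_def)
  then have "T \<turnstile> foldr Imp L (\<^bold>\<forall>\<^sub>sx. \<phi>)"
    using ImpE[OF ImpI[OF imps_intro] gen] by blast
  then show ?thesis using L(1) by (auto simp: entails_def)
qed

subsection \<open>Henkin sets\<close>

instance tm :: countable by countable_datatype
instance st :: countable by countable_datatype
instance fm :: countable by countable_datatype

text \<open>Closure under deduction follows, for closed formulas, from consistency and completeness
  (\<open>henkin_entails\<close>).\<close>

definition henkin :: "fm set \<Rightarrow> fm set \<Rightarrow> bool" where
  "henkin T M \<longleftrightarrow> consistent T M \<and> (\<forall>\<phi>. closed \<phi> \<longrightarrow> \<phi> \<in> M \<or> (\<^bold>\<not> \<phi>) \<in> M) \<and>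
    (\<forall>x \<phi>. closed (\<^bold>\<forall>x. \<phi>) \<longrightarrow> (\<^bold>\<not> (\<^bold>\<forall>x. \<phi>)) \<in> M \<longrightarrow> (\<exists>a. (\<^bold>\<not> subst_num x (P a) \<phi>) \<in> M)) \<and>
    (\<forall>X \<phi>. closed (\<^bold>\<forall>\<^sub>sX. \<phi>) \<longrightarrow> (\<^bold>\<not> (\<^bold>\<forall>\<^sub>sX. \<phi>)) \<in> M \<longrightarrow> (\<exists>a. (\<^bold>\<not> subst_set X (SP a) \<phi>) \<in> M))"

definition fresh_num :: "fm set \<Rightarrow> nat" where
  "fresh_num \<Delta> = (SOME a. a \<notin> (\<Union>\<psi>\<in>\<Delta>. pars_num \<psi>))"

definition fresh_set :: "fm set \<Rightarrow> nat" where
  "fresh_set \<Delta> = (SOME a. a \<notin> (\<Union>\<psi>\<in>\<Delta>. pars_set \<psi>))"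

fun witness :: "fm set \<Rightarrow> fm \<Rightarrow> fm set" where
  "witness \<Delta> (\<^bold>\<forall>x. \<phi>) = {\<^bold>\<not> subst_num x (P (fresh_num (insert \<phi> \<Delta>))) \<phi>}"
| "witness \<Delta> (\<^bold>\<forall>\<^sub>sX. \<phi>) = {\<^bold>\<not> subst_set X (SP (fresh_set (insert \<phi> \<Delta>))) \<phi>}"
| "witness \<Delta> _ = {}"

text \<open>A refuted universal formula receives its counterexample at once, while the set is still
  finite and a fresh parameter exists.\<close>

definition henkin_step :: "fm set \<Rightarrow> fm set \<Rightarrow> fm \<Rightarrow> fm set" where
  "henkin_step T \<Delta> \<phi> =
    (if \<not> closed \<phi> then \<Delta> else if consistent T (insert \<phi> \<Delta>) then insert \<phi> \<Delta>
     else insert (\<^bold>\<not> \<phi>) \<Delta> \<union> witness \<Delta> \<phi>)"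

lemma fresh_num: "finite \<Delta> \<Longrightarrow> fresh_num \<Delta> \<notin> (\<Union>\<psi>\<in>\<Delta>. pars_num \<psi>)"
  unfolding fresh_num_def
  by (rule someI_ex, rule ex_new_if_finite) (auto simp: infinite_UNIV_nat finite_pars_num)

lemma fresh_set: "finite \<Delta> \<Longrightarrow> fresh_set \<Delta> \<notin> (\<Union>\<psi>\<in>\<Delta>. pars_set \<psi>)"
  unfolding fresh_set_def
  by (rule someI_ex, rule ex_new_if_finite) (auto simp: infinite_UNIV_nat finite_pars_set)

lemma vars_subst_tm: "vars_tm u = {} \<Longrightarrow> vars_tm (subst_tm x u t) = vars_tm t - {x}"
  by (induction t) auto

lemma free_num_subst_num: "vars_tm u = {} \<Longrightarrow> free_num (subst_num x u \<phi>) = free_num \<phi> - {x}"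
  by (induction \<phi>) (auto simp: vars_subst_tm)

lemma free_set_subst_num [simp]: "free_set (subst_num x u \<phi>) = free_set \<phi>"
  by (induction \<phi>) auto

lemma free_num_subst_set [simp]: "free_num (subst_set X U \<phi>) = free_num \<phi>"
  by (induction \<phi>) auto

lemma free_set_subst_set: "vars_st U = {} \<Longrightarrow> free_set (subst_set X U \<phi>) = free_set \<phi> - {X}"
proof (induction \<phi>)
  case (Mem t S) then show ?case by (cases S) auto
qed auto

lemma closed_witness: "closed \<phi> \<Longrightarrow> \<psi> \<in> witness \<Delta> \<phi> \<Longrightarrow> closed \<psi>"
  by (cases \<phi>) (auto simp: closed_def free_num_subst_num free_set_subst_set)

lemma consistent_insert_Neg:
  "consistent T (insert (\<^bold>\<not> \<phi>) \<Delta>)" if "\<not> entails T \<Delta> \<phi>"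
  using that entails_Classical by (auto simp: consistent_def)

text \<open>If \<open>\<phi>\<close> cannot be added, its negation is already entailed and so is
  consistent. If the counterexample destroyed consistency, the instance at the fresh parameter would
  be entailed, and generalizing it would give \<open>\<phi>\<close> itself.\<close>

lemma henkin_step_consistent:
  assumes T: "\<forall>\<phi>\<in>T. sentence \<phi>" and \<Delta>: "\<forall>\<phi>\<in>\<Delta>. closed \<phi>" "finite \<Delta>" "consistent T \<Delta>"
  shows "consistent T (henkin_step T \<Delta> \<phi>)"
proof (cases "closed \<phi> \<and> \<not> consistent T (insert \<phi> \<Delta>)")
  case True
  then have neg: "entails T \<Delta> (\<^bold>\<not> \<phi>)"
    by (auto simp: consistent_def intro: entails_ImpI)
  have no\<phi>: "\<not> entails T \<Delta> \<phi>"
    using \<Delta>(3) neg entails_ImpE unfolding consistent_def by blast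
  let ?\<Delta> = "insert (\<^bold>\<not> \<phi>) \<Delta>"
  have cl: "\<forall>\<psi>\<in>?\<Delta>. closed \<psi>" using \<Delta>(1) True by (auto simp: closed_def)
  have con: "consistent T ?\<Delta>" using no\<phi> by (rule consistent_insert_Neg)
  then have no\<phi>': "\<not> entails T ?\<Delta> \<phi>"
    using entails_ImpE entails_mono[OF neg] unfolding consistent_def by blast
  have "consistent T (?\<Delta> \<union> witness \<Delta> \<phi>)"
  proof (cases \<phi>)
    case (AllN x \<psi>)
    have "fresh_num (insert \<psi> \<Delta>) \<notin> (\<Union>\<chi>\<in>insert \<psi> ?\<Delta>. pars_num \<chi>)"
      using fresh_num[of "insert \<psi> \<Delta>"] \<Delta>(2) AllN by auto
    then have "\<not> entails T ?\<Delta> (subst_num x (P (fresh_num (insert \<psi> \<Delta>))) \<psi>)"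
      using entails_AllNI[OF T cl] no\<phi>' AllN by blast
    then have "consistent T (insert (\<^bold>\<not> subst_num x (P (fresh_num (insert \<psi> \<Delta>))) \<psi>) ?\<Delta>)"
      by (rule consistent_insert_Neg)
    then show ?thesis using AllN by (simp add: insert_commute)
  next
    case (AllS X \<psi>)
    have "fresh_set (insert \<psi> \<Delta>) \<notin> (\<Union>\<chi>\<in>insert \<psi> ?\<Delta>. pars_set \<chi>)"
      using fresh_set[of "insert \<psi> \<Delta>"] \<Delta>(2) AllS by auto
    then have "\<not> entails T ?\<Delta> (subst_set X (SP (fresh_set (insert \<psi> \<Delta>))) \<psi>)"
      using entails_AllSI[OF T cl] no\<phi>' AllS by blast
    then have "consistent T (insert (\<^bold>\<not> subst_set X (SP (fresh_set (insert \<psi> \<Delta>))) \<psi>) ?\<Delta>)"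
      by (rule consistent_insert_Neg)
    then show ?thesis using AllS by (simp add: insert_commute)
  qed (use con in auto)
  then show ?thesis using True by (simp add: henkin_step_def)
qed (use \<Delta> in \<open>auto simp: henkin_step_def\<close>)

lemma finite_witness: "finite (witness \<Delta> \<phi>)"
  by (cases \<phi>) auto

theorem ex_henkin:
  assumes T: "\<forall>\<phi>\<in>T. sentence \<phi>" and \<Delta>: "\<forall>\<phi>\<in>\<Delta>. closed \<phi>" "finite \<Delta>" "consistent T \<Delta>"
  shows "\<exists>M. henkin T M \<and> \<Delta> \<subseteq> M"
proof -
  define D where "D = rec_nat \<Delta> (\<lambda>n D. henkin_step T D (from_nat n))"
  have D0: "D 0 = \<Delta>" and DS: "D (Suc n) = henkin_step T (D n) (from_nat n)" for n
    by (simp_all add: D_def)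
  have inv: "(\<forall>\<phi>\<in>D n. closed \<phi>) \<and> finite (D n) \<and> consistent T (D n)" for n
  proof (induction n)
    case (Suc n)
    then have "consistent T (D (Suc n))" using henkin_step_consistent[OF T] DS by auto
    moreover have "finite (D (Suc n))"
      using Suc by (auto simp: DS henkin_step_def finite_witness)
    moreover have "\<forall>\<phi>\<in>D (Suc n). closed \<phi>"
    proof (cases "closed (from_nat n)")
      case True
      then have "closed (\<^bold>\<not> from_nat n)" by (simp add: closed_def)
      then show ?thesis using True Suc closed_witness by (auto simp: DS henkin_step_def)
    qed (use Suc in \<open>auto simp: DS henkin_step_def\<close>)
    ultimately show ?case by blast
  qed (use \<Delta> D0 in auto)
  have mono: "m \<le> n \<Longrightarrow> D m \<subseteq> D n" for m n
    by (rule lift_Suc_mono_le[of D]) (auto simp: DS henkin_step_def)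
  define M where "M = (\<Union>n. D n)"
  \<comment> \<open>An entailment uses finitely many hypotheses, so an inconsistency of the union
    would show up at some stage.\<close>
  have fin: "\<exists>n. F \<subseteq> D n" if "finite F" "F \<subseteq> M" for F
    using that
  proof (induction F)
    case (insert \<phi> F)
    then obtain m n where "F \<subseteq> D m" "\<phi> \<in> D n" by (auto simp: M_def)
    then have "insert \<phi> F \<subseteq> D (max m n)"
      using mono[of m "max m n"] mono[of n "max m n"] by auto
    then show ?case by blast
  qed auto
  have con: "consistent T M"
    using fin inv unfolding consistent_def entails_def by (metis List.finite_set)
  \<comment> \<open>A closed formula is decided at the stage given by its number in the
    enumeration.\<close>
  have stage: "\<phi> \<in> D (Suc (to_nat \<phi>)) \<or> insert (\<^bold>\<not> \<phi>) (witness (D (to_nat \<phi>)) \<phi>) \<subseteq> D (Suc (to_nat \<phi>))"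
    if "closed \<phi>" for \<phi>
    using that by (auto simp: DS henkin_step_def)
  have both: "\<not> (\<phi> \<in> M \<and> (\<^bold>\<not> \<phi>) \<in> M)" for \<phi>
    using con entails_ImpE entails_assm unfolding consistent_def by blast
  have wit: "insert (\<^bold>\<not> \<phi>) (witness (D (to_nat \<phi>)) \<phi>) \<subseteq> M" if "closed \<phi>" "(\<^bold>\<not> \<phi>) \<in> M" for \<phi>
    using stage[OF that(1)] both that(2) unfolding M_def by blast
  have "henkin T M"
    unfolding henkin_def
  proof (intro conjI allI impI)
    fix \<phi> assume "closed \<phi>"
    then show "\<phi> \<in> M \<or> (\<^bold>\<not> \<phi>) \<in> M" using stage M_def by blast
  next
    fix x \<phi> assume "closed (\<^bold>\<forall>x. \<phi>)" "(\<^bold>\<not> (\<^bold>\<forall>x. \<phi>)) \<in> M"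
    from wit[OF this] show "\<exists>a. (\<^bold>\<not> subst_num x (P a) \<phi>) \<in> M" by auto
  next
    fix X \<phi> assume "closed (\<^bold>\<forall>\<^sub>sX. \<phi>)" "(\<^bold>\<not> (\<^bold>\<forall>\<^sub>sX. \<phi>)) \<in> M"
    from wit[OF this] show "\<exists>a. (\<^bold>\<not> subst_set X (SP a) \<phi>) \<in> M" by auto
  qed (fact con)
  then show ?thesis using D0 M_def by blast
qed

context
  fixes T M :: "fm set"
  assumes hM: "henkin T M"
begin

lemma henkin_entails: "entails T M \<phi> \<Longrightarrow> closed \<phi> \<Longrightarrow> \<phi> \<in> M"
  using hM entails_ImpE entails_assm unfolding henkin_def consistent_def by blast

lemma henkin_Fls: "\<^bold>\<bottom> \<notin> M"
  using hM entails_assm unfolding henkin_def consistent_def by blast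

lemma henkin_Imp:
  assumes "closed \<phi>" "closed \<psi>"
  shows "(\<phi> \<^bold>\<longrightarrow> \<psi>) \<in> M \<longleftrightarrow> (\<phi> \<in> M \<longrightarrow> \<psi> \<in> M)"
proof
  assume "(\<phi> \<^bold>\<longrightarrow> \<psi>) \<in> M"
  then show "\<phi> \<in> M \<longrightarrow> \<psi> \<in> M"
    using henkin_entails entails_ImpE entails_assm assms(2) by blast
next
  assume imp: "\<phi> \<in> M \<longrightarrow> \<psi> \<in> M"
  have "closed (\<phi> \<^bold>\<longrightarrow> \<psi>)" using assms by (simp add: closed_def)
  moreover have "entails T M (\<phi> \<^bold>\<longrightarrow> \<psi>)"
  proof (cases "\<psi> \<in> M")
    case True
    then show ?thesis by (intro entails_ImpI entails_assm) simp
  next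
    case False
    then have "(\<^bold>\<not> \<phi>) \<in> M" using imp hM assms(1) by (auto simp: henkin_def)
    then have "entails T (insert (\<^bold>\<not> \<psi>) (insert \<phi> M)) \<^bold>\<bottom>"
      by (rule_tac entails_ImpE[OF entails_assm entails_assm]) auto
    then show ?thesis by (rule entails_ImpI[OF entails_Classical])
  qed
  ultimately show "(\<phi> \<^bold>\<longrightarrow> \<psi>) \<in> M" by (intro henkin_entails)
qed

text \<open>All closed terms occur because they will be the elements of the model. For the converse
  parameters alone suffice, since counterexamples are parameters.\<close>

lemma henkin_AllN:
  assumes "closed (\<^bold>\<forall>x. \<phi>)"
  shows "(\<^bold>\<forall>x. \<phi>) \<in> M \<longleftrightarrow> (\<forall>t. vars_tm t = {} \<longrightarrow> subst_num x t \<phi> \<in> M)"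
proof
  have cl: "closed (subst_num x t \<phi>)" if "vars_tm t = {}" for t
    using assms that by (auto simp: closed_def free_num_subst_num)
  show "\<forall>t. vars_tm t = {} \<longrightarrow> subst_num x t \<phi> \<in> M" if "(\<^bold>\<forall>x. \<phi>) \<in> M"
    using henkin_entails[OF entails_AllNE[OF entails_assm[OF that]] cl] by blast
  show "(\<^bold>\<forall>x. \<phi>) \<in> M" if all: "\<forall>t. vars_tm t = {} \<longrightarrow> subst_num x t \<phi> \<in> M"
  proof (rule ccontr)
    assume "\<not> ?thesis"
    then obtain a where "(\<^bold>\<not> subst_num x (P a) \<phi>) \<in> M"
      using hM assms unfolding henkin_def by blast
    moreover have "subst_num x (P a) \<phi> \<in> M" using all by simp
    ultimately show False
      using henkin_Imp[of "subst_num x (P a) \<phi>" "\<^bold>\<bottom>"] cl[of "P a"] henkin_Fls by (simp add: closed_def)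
  qed
qed

lemma henkin_AllS:
  assumes "closed (\<^bold>\<forall>\<^sub>sX. \<phi>)"
  shows "(\<^bold>\<forall>\<^sub>sX. \<phi>) \<in> M \<longleftrightarrow> (\<forall>a. subst_set X (SP a) \<phi> \<in> M)"
proof
  have cl: "closed (subst_set X (SP a) \<phi>)" for a
    using assms by (auto simp: closed_def free_set_subst_set)
  show "\<forall>a. subst_set X (SP a) \<phi> \<in> M" if "(\<^bold>\<forall>\<^sub>sX. \<phi>) \<in> M"
    using henkin_entails[OF entails_AllSE[OF entails_assm[OF that]] cl] by blast
  show "(\<^bold>\<forall>\<^sub>sX. \<phi>) \<in> M" if all: "\<forall>a. subst_set X (SP a) \<phi> \<in> M"
  proof (rule ccontr)
    assume "\<not> ?thesis"
    then obtain a where "(\<^bold>\<not> subst_set X (SP a) \<phi>) \<in> M"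
      using hM assms unfolding henkin_def by blast
    then show False
      using henkin_Imp[of "subst_set X (SP a) \<phi>" "\<^bold>\<bottom>"] cl[of a] all henkin_Fls by (simp add: closed_def)
  qed
qed

lemma henkin_derivable: "T \<turnstile> \<phi> \<Longrightarrow> closed \<phi> \<Longrightarrow> \<phi> \<in> M"
  using henkin_entails entails_derivable by blast

lemma henkin_Eq_refl: "vars_tm t = {} \<Longrightarrow> (t \<^bold>= t) \<in> M"
  by (rule henkin_derivable) (auto intro: EqRefl simp: closed_def)

lemma henkin_Eq_subst:
  assumes "(s \<^bold>= t) \<in> M" "subst_num x s \<phi> \<in> M" "vars_tm s = {}" "vars_tm t = {}" "closed (\<^bold>\<forall>x. \<phi>)"
  shows "subst_num x t \<phi> \<in> M"
proof -
  have "closed (subst_num x t \<phi>)"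
    using assms(4,5) by (auto simp: closed_def free_num_subst_num)
  then show ?thesis
    using assms entails_EqSubst[OF entails_assm entails_assm] henkin_entails by blast
qed

end

subsection \<open>Semantics\<close>

primrec eval_tm :: "(nat \<Rightarrow> 'a) \<Rightarrow> (string \<Rightarrow> 'a) \<Rightarrow> tm \<Rightarrow> 'a :: {zero,one,plus,times}" where
  "eval_tm p e (V x) = e x"
| "eval_tm p e (P a) = p a"
| "eval_tm p e \<^bold>0 = 0"
| "eval_tm p e \<^bold>1 = 1"
| "eval_tm p e (s \<^bold>+ t) = eval_tm p e s + eval_tm p e t"
| "eval_tm p e (s \<^bold>* t) = eval_tm p e s * eval_tm p e t"

primrec eval_st :: "(nat \<Rightarrow> 'a set) \<Rightarrow> (string \<Rightarrow> 'a set) \<Rightarrow> st \<Rightarrow> 'a set" where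
  "eval_st q E (SV X) = E X"
| "eval_st q E (SP a) = q a"

text \<open>Henkin semantics: the set quantifiers range over the family \<open>S\<close>. The number
  quantifiers range over a whole type, which is why the numbers of the model are later made into a
  type.\<close>

primrec sat :: "'a :: {zero,one,plus,times,ord} set set \<Rightarrow> (nat \<Rightarrow> 'a) \<Rightarrow> (nat \<Rightarrow> 'a set) \<Rightarrow> fm \<Rightarrow>
    (string \<Rightarrow> 'a) \<Rightarrow> (string \<Rightarrow> 'a set) \<Rightarrow> bool" where
  "sat S p q \<^bold>\<bottom> e E = False"
| "sat S p q (s \<^bold>= t) e E = (eval_tm p e s = eval_tm p e t)"
| "sat S p q (s \<^bold>< t) e E = (eval_tm p e s < eval_tm p e t)"
| "sat S p q (t \<^bold>\<in> X) e E = (eval_tm p e t \<in> eval_st q E X)"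
| "sat S p q (\<phi> \<^bold>\<longrightarrow> \<psi>) e E = (sat S p q \<phi> e E \<longrightarrow> sat S p q \<psi> e E)"
| "sat S p q (\<^bold>\<forall>x. \<phi>) e E = (\<forall>a. sat S p q \<phi> (e(x := a)) E)"
| "sat S p q (\<^bold>\<forall>\<^sub>sX. \<phi>) e E = (\<forall>A\<in>S. sat S p q \<phi> e (E(X := A)))"

lemma eval_tm_cong:
  "(\<And>x. x \<in> vars_tm t \<Longrightarrow> e x = e' x) \<Longrightarrow> (\<And>a. a \<in> pars_tm t \<Longrightarrow> p a = p' a) \<Longrightarrow>
    eval_tm p e t = eval_tm p' e' t"
proof (induction t)
  case (Add s t)
  have "eval_tm p e s = eval_tm p' e' s" "eval_tm p e t = eval_tm p' e' t"
    using Add.prems by (auto intro: Add.IH)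
  then show ?case by simp
next
  case (Mul s t)
  have "eval_tm p e s = eval_tm p' e' s" "eval_tm p e t = eval_tm p' e' t"
    using Mul.prems by (auto intro: Mul.IH)
  then show ?case by simp
qed auto

lemma sat_cong:
  assumes "\<And>x. x \<in> free_num \<phi> \<Longrightarrow> e x = e' x" "\<And>X. X \<in> free_set \<phi> \<Longrightarrow> E X = E' X"
    and "\<And>a. a \<in> pars_num \<phi> \<Longrightarrow> p a = p' a" "\<And>a. a \<in> pars_set \<phi> \<Longrightarrow> q a = q' a"
  shows "sat S p q \<phi> e E = sat S p' q' \<phi> e' E'"
  using assms
proof (induction \<phi> arbitrary: e e' E E')
  case (Eq s t)
  have "eval_tm p e s = eval_tm p' e' s" "eval_tm p e t = eval_tm p' e' t"
    using Eq by (auto intro: eval_tm_cong)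
  then show ?case by simp
next
  case (Less s t)
  have "eval_tm p e s = eval_tm p' e' s" "eval_tm p e t = eval_tm p' e' t"
    using Less by (auto intro: eval_tm_cong)
  then show ?case by simp
next
  case (Mem t X)
  have "eval_tm p e t = eval_tm p' e' t" using Mem by (auto intro: eval_tm_cong)
  moreover have "eval_st q E X = eval_st q' E' X" using Mem by (cases X) auto
  ultimately show ?case by simp
next
  case (Imp \<phi> \<psi>)
  have "sat S p q \<phi> e E = sat S p' q' \<phi> e' E'"
    by (rule Imp.IH(1)) (use Imp.prems in auto)
  moreover have "sat S p q \<psi> e E = sat S p' q' \<psi> e' E'"
    by (rule Imp.IH(2)) (use Imp.prems in auto)
  ultimately show ?case by simp
next
  case (AllN x \<phi>)
  have "sat S p q \<phi> (e(x := a)) E = sat S p' q' \<phi> (e'(x := a)) E'" for a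
    by (rule AllN.IH) (use AllN.prems in auto)
  then show ?case by simp
next
  case (AllS X \<phi>)
  have "sat S p q \<phi> e (E(X := A)) = sat S p' q' \<phi> e' (E'(X := A))" for A
    by (rule AllS.IH) (use AllS.prems in auto)
  then show ?case by simp
qed auto

lemma eval_tm_subst: "eval_tm p e (subst_tm x u t) = eval_tm p (e(x := eval_tm p e u)) t"
  by (induction t) auto

text \<open>A term with no variable but \<open>x\<close> cannot be captured, because nothing is
  substituted below a quantifier over \<open>x\<close>. The case of a successor of \<open>x\<close>
  is the one in the induction axioms.\<close>

lemma sat_subst_num:
  "vars_tm u \<subseteq> {x} \<Longrightarrow> sat S p q (subst_num x u \<phi>) e E = sat S p q \<phi> (e(x := eval_tm p e u)) E"
proof (induction \<phi> arbitrary: e E)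
  case (AllN y \<phi>)
  show ?case
  proof (cases "x = y")
    case False
    then have "eval_tm p (e(y := a)) u = eval_tm p e u" for a
      using AllN.prems by (intro eval_tm_cong) auto
    then have "sat S p q (subst_num x u \<phi>) (e(y := a)) E = sat S p q \<phi> (e(x := eval_tm p e u, y := a)) E" for a
      using AllN.IH[OF AllN.prems, of "e(y := a)" E] by (simp only: fun_upd_twist[OF False])
    then show ?thesis using False by (simp only: subst_num.simps sat.simps if_False)
  qed (simp only: subst_num.simps sat.simps if_True fun_upd_upd simp_thms)
qed (auto simp: eval_tm_subst)

lemma sat_subst_set: "sat S p q (subst_set X (SP a) \<phi>) e E = sat S p q \<phi> e (E(X := q a))"
proof (induction \<phi> arbitrary: e E)
  case (Mem t Y) then show ?case by (cases Y) auto
next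
  case (AllS Y \<phi>)
  show ?case
  proof (cases "X = Y")
    case False
    then have "sat S p q (subst_set X (SP a) \<phi>) e (E(Y := A)) = sat S p q \<phi> e (E(X := q a, Y := A))" for A
      using AllS.IH[of e "E(Y := A)"] by (simp only: fun_upd_twist[OF False])
    then show ?thesis using False by (simp only: subst_set.simps sat.simps if_False)
  qed (simp only: subst_set.simps sat.simps if_True fun_upd_upd simp_thms)
qed auto

lemma sat_foldr_AllN: "(\<And>e. sat S p q \<phi> e E) \<Longrightarrow> sat S p q (foldr AllN xs \<phi>) e E"
  by (induction xs arbitrary: e) auto

lemma sat_foldr_AllS: "(\<And>E. sat S p q \<phi> e E) \<Longrightarrow> sat S p q (foldr AllS Xs \<phi>) e E"
  by (induction Xs arbitrary: E) auto

lemma foldr_AllN_sat: "sat S p q (foldr AllN xs \<phi>) e E \<Longrightarrow> sat S p q \<phi> e E"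
  by (induction xs) (auto dest: spec[of _ "e _"], metis fun_upd_triv)

lemma foldr_AllS_sat: "range E \<subseteq> S \<Longrightarrow> sat S p q (foldr AllS Xs \<phi>) e E \<Longrightarrow> sat S p q \<phi> e E"
  by (induction Xs) (auto, metis fun_upd_triv rangeI subsetD)

subsection \<open>Soundness\<close>

text \<open>In the generalization rules the eigenparameter is reinterpreted by the arbitrary value;
  the hypotheses do not contain it, so their truth is unaffected. Applied to the standard numbers
  with all sets, this yields the consistency of \<open>RCA0\<close>.\<close>

theorem soundness:
  assumes "\<Gamma> \<turnstile> \<phi>" and "\<forall>\<gamma>\<in>\<Gamma>. sat S p q \<gamma> e E" and "range q \<subseteq> S"
  shows "sat S p q \<phi> e E"
  using assms
proof (induction arbitrary: p q e E rule: derivable.induct)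
  case (AllNI \<Gamma> x a \<phi>)
  have "sat S p q \<phi> (e(x := v)) E" for v
  proof -
    have "\<forall>\<gamma>\<in>\<Gamma>. sat S (p(a := v)) q \<gamma> e E"
    proof
      fix \<gamma> assume "\<gamma> \<in> \<Gamma>"
      then show "sat S (p(a := v)) q \<gamma> e E"
        using AllNI by (subst sat_cong[of _ e e E E _ p q q]) auto
    qed
    then have "sat S (p(a := v)) q (subst_num x (P a) \<phi>) e E"
      using AllNI.IH AllNI.prems by blast
    then have "sat S (p(a := v)) q \<phi> (e(x := v)) E" by (simp add: sat_subst_num)
    then show ?thesis using AllNI.hyps by (subst sat_cong[of _ _ "e(x := v)" E E p "p(a := v)" q q]) auto
  qed
  then show ?case by simp
next
  case (AllSI \<Gamma> X a \<phi>)
  have "sat S p q \<phi> e (E(X := v))" if v: "v \<in> S" for v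
  proof -
    have "\<forall>\<gamma>\<in>\<Gamma>. sat S p (q(a := v)) \<gamma> e E"
    proof
      fix \<gamma> assume "\<gamma> \<in> \<Gamma>"
      then show "sat S p (q(a := v)) \<gamma> e E"
        using AllSI by (subst sat_cong[of _ e e E E p p _ q]) auto
    qed
    moreover have "range (q(a := v)) \<subseteq> S" using AllSI.prems v by auto
    ultimately have "sat S p (q(a := v)) (subst_set X (SP a) \<phi>) e E"
      using AllSI.IH by blast
    then have "sat S p (q(a := v)) \<phi> e (E(X := v))" by (simp add: sat_subst_set)
    then show ?thesis using AllSI.hyps by (subst sat_cong[of _ e e "E(X := v)" "E(X := v)" p p q "q(a := v)"]) auto
  qed
  then show ?case by simp
next
  case (AllSE \<Gamma> X \<phi> a)
  then have "\<forall>A\<in>S. sat S p q \<phi> e (E(X := A))" by (simp only: sat.simps)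
  moreover have "q a \<in> S" using AllSE.prems by auto
  ultimately show ?case by (auto simp: sat_subst_set)
qed (auto simp: sat_subst_num)

section \<open>Consistency of \<open>RCA0\<close> by the standard model\<close>

lemma RCA0_sentence: "\<forall>\<phi>\<in>RCA0. sentence \<phi>"
  by (auto simp: RCA0_def universal_closures_def basic_axioms_def sentence_def Let_def)

lemma sat_induction_instance:
  "sat S p q (induction_instance x \<phi>) e E \<longleftrightarrow> (sat S p q \<phi> (e(x := 0)) E \<longrightarrow>
    (\<forall>a. sat S p q \<phi> (e(x := a)) E \<longrightarrow> sat S p q \<phi> (e(x := a + 1)) E) \<longrightarrow> (\<forall>a. sat S p q \<phi> (e(x := a)) E))"
proof -
  have "vars_tm (V x \<^bold>+ \<^bold>1) \<subseteq> {x}" "vars_tm \<^bold>0 \<subseteq> {x}" by simp_all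
  then show ?thesis
    unfolding induction_instance_def
    by (simp only: sat.simps sat_subst_num eval_tm.simps fun_upd_same fun_upd_upd simp_thms) blast
qed

lemma sat_RCA0_nat: "\<phi> \<in> RCA0 \<Longrightarrow> sat UNIV p q \<phi> e (E :: string \<Rightarrow> nat set)"
  unfolding RCA0_def
proof (elim UnE UnionE CollectE exE conjE; hypsubst?)
  show "sat UNIV p q \<phi> e E" if "\<phi> \<in> basic_axioms"
    using that unfolding basic_axioms_def Let_def
    by (elim insertE emptyE) (simp_all add: less_Suc_eq, blast)
next
  fix x \<theta> assume "\<phi> \<in> universal_closures (induction_instance x \<theta>)"
  moreover have "sat UNIV p q (induction_instance x \<theta>) e E" for e and E :: "string \<Rightarrow> nat set"
  proof -
    have "sat UNIV p q \<theta> (e(x := n)) E" if "sat UNIV p q \<theta> (e(x := 0)) E"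
      "\<forall>n. sat UNIV p q \<theta> (e(x := n)) E \<longrightarrow> sat UNIV p q \<theta> (e(x := n + 1)) E" for n :: nat
      using that nat_induct[of "\<lambda>n. sat UNIV p q \<theta> (e(x := n)) E" n] by simp
    then show ?thesis unfolding sat_induction_instance by blast
  qed
  ultimately show "sat UNIV p q \<phi> e E"
    by (auto simp: universal_closures_def intro!: sat_foldr_AllN sat_foldr_AllS)
next
  fix x X \<theta> \<chi>
  assume "\<phi> \<in> universal_closures (comprehension_instance x X \<theta> \<chi>)" and X: "X \<notin> free_set \<theta>"
  moreover have "sat UNIV p q (comprehension_instance x X \<theta> \<chi>) e E" for e and E :: "string \<Rightarrow> nat set"
  proof -
    have "sat UNIV p q \<theta> e' (E(X := A)) = sat UNIV p q \<theta> e' E" for e' A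
      using X by (intro sat_cong) auto
    then show ?thesis
      by (auto simp: comprehension_instance_def intro!: exI[of _ "{n. sat UNIV p q \<theta> (e(x := n)) E}"])
  qed
  ultimately show "sat UNIV p q \<phi> e E"
    by (auto simp: universal_closures_def intro!: sat_foldr_AllN sat_foldr_AllS)
qed

lemma RCA0_not_derives_Fls: "\<not> (RCA0 \<turnstile> \<^bold>\<bottom>)"
  using soundness[of RCA0 "\<^bold>\<bottom>" UNIV "\<lambda>_. 0 :: nat"] sat_RCA0_nat by auto

lemma entails_empty: "entails T {} \<phi> \<longleftrightarrow> (T \<turnstile> \<phi>)"
  by (auto simp: entails_def)

section \<open>A countable model of \<open>RCA\<^sub>0\<close>\<close>

definition equivalence_fm :: fm where
  "equivalence_fm = (IPT \<^bold>\<longleftrightarrow> IPHT_apart)"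

lemma sentence_equivalence_fm: "sentence equivalence_fm"
  by (simp add: sentence_def equivalence_fm_def IPT_def IPHT_apart_def is_union_def is_apart_def
      mu_eq_def lambda_eq_def is_exponent_def exp2_eq_def is_positive_def is_infinite_def
      is_pair_colouring_def is_colouring_def is_function_def pair_def Let_def insert_Diff_if)

text \<open>
  The model is a global constant, so that its number part can be made an instance of
  type classes.  It refutes the equivalence unless the equivalence is derivable; that
  it exists in any case is due to the consistency of \<open>RCA\<^sub>0\<close>.
\<close>

definition MM :: "fm set" where
  "MM = (SOME M. henkin RCA0 M \<and> (\<not> (RCA0 \<turnstile> equivalence_fm) \<longrightarrow> (\<^bold>\<not> equivalence_fm) \<in> M))"

lemma MM: "henkin RCA0 MM \<and> (\<not> (RCA0 \<turnstile> equivalence_fm) \<longrightarrow> (\<^bold>\<not> equivalence_fm) \<in> MM)"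
  unfolding MM_def
proof (rule someI_ex)
  show "\<exists>M. henkin RCA0 M \<and> (\<not> (RCA0 \<turnstile> equivalence_fm) \<longrightarrow> (\<^bold>\<not> equivalence_fm) \<in> M)"
  proof (cases "RCA0 \<turnstile> equivalence_fm")
    case True
    have "consistent RCA0 {}"
      by (simp add: consistent_def entails_empty RCA0_not_derives_Fls)
    then show ?thesis using ex_henkin[OF RCA0_sentence, of "{}"] True by auto
  next
    case False
    then have "consistent RCA0 {\<^bold>\<not> equivalence_fm}"
      by (intro consistent_insert_Neg) (simp add: entails_empty)
    moreover have "closed (\<^bold>\<not> equivalence_fm)"
      using sentence_equivalence_fm by (simp add: closed_def sentence_def)
    ultimately show ?thesis
      using ex_henkin[OF RCA0_sentence, of "{\<^bold>\<not> equivalence_fm}"] by auto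
  qed
qed

section \<open>Closed terms modulo equality in \<open>MM\<close>, and the truth lemma\<close>

lemmas henkin_MM = MM[THEN conjunct1]

text \<open>Only closed terms are related to themselves, so the partial quotient below consists of
  classes of closed terms.\<close>

definition eq_tm :: "tm \<Rightarrow> tm \<Rightarrow> bool" where
  "eq_tm s t \<longleftrightarrow> vars_tm s = {} \<and> vars_tm t = {} \<and> (s \<^bold>= t) \<in> MM"

lemma eq_tm_refl: "vars_tm t = {} \<Longrightarrow> eq_tm t t"
  using henkin_Eq_refl[OF henkin_MM] by (simp add: eq_tm_def)

lemma eq_tm_subst:
  assumes "eq_tm s t" "subst_num x s \<phi> \<in> MM" "free_num \<phi> \<subseteq> {x}" "free_set \<phi> = {}"
  shows "subst_num x t \<phi> \<in> MM"
  using henkin_Eq_subst[OF henkin_MM, of s t x \<phi>] assms by (auto simp: eq_tm_def closed_def)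

lemma eq_tm_sym: "eq_tm s t \<Longrightarrow> eq_tm t s"
  using eq_tm_subst[of s t "''x''" "V ''x'' \<^bold>= s"] eq_tm_refl[of s]
  by (auto simp: eq_tm_def subst_tm_fresh)

lemma eq_tm_trans: "eq_tm r s \<Longrightarrow> eq_tm s t \<Longrightarrow> eq_tm r t"
  using eq_tm_subst[of s t "''x''" "r \<^bold>= V ''x''"] by (auto simp: eq_tm_def subst_tm_fresh)

lemma eq_tm_Add: "eq_tm s s' \<Longrightarrow> eq_tm t t' \<Longrightarrow> eq_tm (s \<^bold>+ t) (s' \<^bold>+ t')"
  using eq_tm_subst[of s s' "''x''" "s \<^bold>+ t \<^bold>= V ''x'' \<^bold>+ t"]
    eq_tm_subst[of t t' "''x''" "s \<^bold>+ t \<^bold>= s' \<^bold>+ V ''x''"] eq_tm_refl[of "s \<^bold>+ t"]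
  by (auto simp: eq_tm_def subst_tm_fresh)

lemma eq_tm_Mul: "eq_tm s s' \<Longrightarrow> eq_tm t t' \<Longrightarrow> eq_tm (s \<^bold>* t) (s' \<^bold>* t')"
  using eq_tm_subst[of s s' "''x''" "s \<^bold>* t \<^bold>= V ''x'' \<^bold>* t"]
    eq_tm_subst[of t t' "''x''" "s \<^bold>* t \<^bold>= s' \<^bold>* V ''x''"] eq_tm_refl[of "s \<^bold>* t"]
  by (auto simp: eq_tm_def subst_tm_fresh)

lemma eq_tm_Less: "eq_tm s s' \<Longrightarrow> eq_tm t t' \<Longrightarrow> (s \<^bold>< t) \<in> MM \<Longrightarrow> (s' \<^bold>< t') \<in> MM"
  using eq_tm_subst[of s s' "''x''" "V ''x'' \<^bold>< t"] eq_tm_subst[of t t' "''x''" "s' \<^bold>< V ''x''"]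
  by (auto simp: eq_tm_def subst_tm_fresh)

lemma eq_tm_Mem: "eq_tm s s' \<Longrightarrow> (s \<^bold>\<in> SP a) \<in> MM \<Longrightarrow> (s' \<^bold>\<in> SP a) \<in> MM"
  using eq_tm_subst[of s s' "''x''" "V ''x'' \<^bold>\<in> SP a"] by (auto simp: eq_tm_def subst_tm_fresh)

quotient_type mnum = tm / partial: eq_tm
proof (rule part_equivpI)
  show "\<exists>t. eq_tm t t" using eq_tm_refl[of \<open>\<^bold>0\<close>] by auto
  show "symp eq_tm" by (auto intro: sympI eq_tm_sym)
  show "transp eq_tm" by (auto intro: transpI eq_tm_trans)
qed

instantiation mnum :: "{zero,one,plus,times,minus,ord}"
begin

lift_definition zero_mnum :: mnum is "\<^bold>0" by (simp add: eq_tm_refl)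
lift_definition one_mnum :: mnum is "\<^bold>1" by (simp add: eq_tm_refl)
lift_definition plus_mnum :: "mnum \<Rightarrow> mnum \<Rightarrow> mnum" is Add by (rule eq_tm_Add)
lift_definition times_mnum :: "mnum \<Rightarrow> mnum \<Rightarrow> mnum" is Mul by (rule eq_tm_Mul)
lift_definition less_mnum :: "mnum \<Rightarrow> mnum \<Rightarrow> bool" is "\<lambda>s t. (s \<^bold>< t) \<in> MM"
  using eq_tm_Less eq_tm_sym by blast

definition less_eq_mnum :: "mnum \<Rightarrow> mnum \<Rightarrow> bool" where
  "less_eq_mnum x y \<longleftrightarrow> x < y \<or> x = y"

text \<open>Truncated subtraction, an operation of the class \<open>linordered_semidom\<close>. The
  chosen number is unique by cancellation, as shown in \<open>diff_M\<close>.\<close>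

definition minus_mnum :: "mnum \<Rightarrow> mnum \<Rightarrow> mnum" where
  "minus_mnum x y = (if \<exists>z. x = y + z then SOME z. x = y + z else 0)"

instance ..

end

lift_definition mem_par :: "nat \<Rightarrow> mnum \<Rightarrow> bool" is "\<lambda>a t. (t \<^bold>\<in> SP a) \<in> MM"
  using eq_tm_Mem eq_tm_sym by blast

definition mpar :: "nat \<Rightarrow> mnum" where "mpar a = abs_mnum (P a)"

definition mset :: "nat \<Rightarrow> mnum set" where "mset a = {x. mem_par a x}"

definition SS :: "mnum set set" where "SS = range mset"

lemma abs_mnum_surj: "\<exists>t. vars_tm t = {} \<and> x = abs_mnum t"
  using Quotient3_abs_rep[OF Quotient3_mnum, of x] Quotient3_rep_reflp[OF Quotient3_mnum, of x]
  by (metis eq_tm_def)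

lemma abs_mnum_eq: "vars_tm s = {} \<Longrightarrow> vars_tm t = {} \<Longrightarrow> abs_mnum s = abs_mnum t \<longleftrightarrow> (s \<^bold>= t) \<in> MM"
  using Quotient3_rel[OF Quotient3_mnum, of s t] eq_tm_refl by (auto simp: eq_tm_def)

text \<open>Lets every number of the model own a variable name in \<open>ttrans\<close>.\<close>

instance mnum :: countable
proof (rule countable_classI[of "\<lambda>x. to_nat (rep_mnum x)"])
  fix x y assume "to_nat (rep_mnum x) = to_nat (rep_mnum y)"
  then show "x = y" using Quotient3_abs_rep[OF Quotient3_mnum] by (metis injD inj_to_nat)
qed

lemma eval_tm_MM: "vars_tm t = {} \<Longrightarrow> eval_tm mpar e t = abs_mnum t"
  by (induction t)
    (auto simp: mpar_def zero_mnum.abs_eq one_mnum.abs_eq plus_mnum.abs_eq times_mnum.abs_eq eq_tm_refl)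

text \<open>A measure invariant under substitution, for the induction in \<open>truth\<close>: an
  instance of a quantified formula is not one of its subformulas.\<close>

primrec fm_size :: "fm \<Rightarrow> nat" where
  "fm_size \<^bold>\<bottom> = 0"
| "fm_size (s \<^bold>= t) = 0"
| "fm_size (s \<^bold>< t) = 0"
| "fm_size (t \<^bold>\<in> X) = 0"
| "fm_size (\<phi> \<^bold>\<longrightarrow> \<psi>) = Suc (fm_size \<phi> + fm_size \<psi>)"
| "fm_size (\<^bold>\<forall>x. \<phi>) = Suc (fm_size \<phi>)"
| "fm_size (\<^bold>\<forall>\<^sub>sX. \<phi>) = Suc (fm_size \<phi>)"

lemma fm_size_subst [simp]: "fm_size (subst_num x u \<phi>) = fm_size \<phi>" "fm_size (subst_set X U \<phi>) = fm_size \<phi>"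
  by (induction \<phi>) auto

abbreviation satM :: "fm \<Rightarrow> (string \<Rightarrow> mnum) \<Rightarrow> (string \<Rightarrow> mnum set) \<Rightarrow> bool" where
  "satM \<equiv> sat SS mpar mset"

text \<open>Every number of the model is the class of a closed term and every set in
  \<open>SS\<close> is named by a parameter, so quantifying over the model amounts to substituting
  all names.\<close>

theorem truth: "closed \<phi> \<Longrightarrow> \<phi> \<in> MM \<longleftrightarrow> satM \<phi> e E"
proof (induction "fm_size \<phi>" arbitrary: \<phi> e E rule: less_induct)
  case less
  note IH = less.hyps and cl = less.prems
  show ?case
  proof (cases \<phi>)
    case Fls
    then show ?thesis using henkin_Fls[OF henkin_MM] by simp
  next
    case (Eq s t)
    then show ?thesis using cl by (simp add: closed_def eval_tm_MM abs_mnum_eq)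
  next
    case (Less s t)
    then show ?thesis using cl by (simp add: closed_def eval_tm_MM less_mnum.abs_eq eq_tm_refl)
  next
    case (Mem t X)
    then obtain a where "X = SP a" using cl by (cases X) (auto simp: closed_def)
    then show ?thesis using cl Mem by (simp add: closed_def eval_tm_MM mset_def mem_par.abs_eq eq_tm_refl)
  next
    case (Imp \<psi> \<chi>)
    then have "closed \<psi>" "closed \<chi>" using cl by (auto simp: closed_def)
    then show ?thesis using henkin_Imp[OF henkin_MM] IH[of \<psi> e E] IH[of \<chi> e E] Imp by simp
  next
    case (AllN x \<psi>)
    have "subst_num x t \<psi> \<in> MM \<longleftrightarrow> satM \<psi> (e(x := abs_mnum t)) E" if "vars_tm t = {}" for t
    proof -
      have "closed (subst_num x t \<psi>)"
        using cl AllN that by (auto simp: closed_def free_num_subst_num)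
      then have "subst_num x t \<psi> \<in> MM \<longleftrightarrow> satM (subst_num x t \<psi>) e E"
        using IH[of "subst_num x t \<psi>" e E] AllN by simp
      then show ?thesis using that by (simp only: sat_subst_num[of t x] eval_tm_MM empty_subsetI)
    qed
    then have "\<phi> \<in> MM \<longleftrightarrow> (\<forall>t. vars_tm t = {} \<longrightarrow> satM \<psi> (e(x := abs_mnum t)) E)"
      using henkin_AllN[OF henkin_MM] cl AllN by auto
    also have "\<dots> \<longleftrightarrow> (\<forall>v. satM \<psi> (e(x := v)) E)" by (metis abs_mnum_surj)
    finally show ?thesis using AllN by (simp only: sat.simps)
  next
    case (AllS X \<psi>)
    have "subst_set X (SP a) \<psi> \<in> MM \<longleftrightarrow> satM \<psi> e (E(X := mset a))" for a
    proof -
      have "closed (subst_set X (SP a) \<psi>)"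
        using cl AllS by (auto simp: closed_def free_set_subst_set)
      then have "subst_set X (SP a) \<psi> \<in> MM \<longleftrightarrow> satM (subst_set X (SP a) \<psi>) e E"
        using IH[of "subst_set X (SP a) \<psi>" e E] AllS by simp
      then show ?thesis by (simp only: sat_subst_set)
    qed
    then have "\<phi> \<in> MM \<longleftrightarrow> (\<forall>a. satM \<psi> e (E(X := mset a)))"
      using henkin_AllS[OF henkin_MM] cl AllS by auto
    then show ?thesis using AllS by (simp add: SS_def)
  qed
qed

lemma derivable_if_sat:
  assumes "satM equivalence_fm e E"
  shows "RCA0 \<turnstile> equivalence_fm"
proof (rule ccontr)
  assume "\<not> ?thesis"
  then have "(\<^bold>\<not> equivalence_fm) \<in> MM" using MM by blast
  moreover have "closed (\<^bold>\<not> equivalence_fm)"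
    using sentence_equivalence_fm by (simp add: closed_def sentence_def)
  ultimately show False using truth[of "\<^bold>\<not> equivalence_fm" e E] assms by simp
qed

lemma satM_RCA0: "\<phi> \<in> RCA0 \<Longrightarrow> satM \<phi> e E"
  using henkin_derivable[OF henkin_MM Assm, of \<phi>] truth[of \<phi> e E] RCA0_sentence
  by (auto simp: closed_def sentence_def)

section \<open>The axioms of \<open>RCA0\<close> in the model\<close>

lemma finite_vars_tm: "finite (vars_tm t)"
  by (induction t) auto

lemma finite_free_num: "finite (free_num \<phi>)"
  by (induction \<phi>) (auto simp: finite_vars_tm)

lemma finite_free_set: "finite (free_set \<phi>)"
proof (induction \<phi>)
  case (Mem t S) then show ?case by (cases S) auto
qed auto

lemma free_foldr_AllN:
  "free_num (foldr AllN xs \<phi>) = free_num \<phi> - set xs" "free_set (foldr AllN xs \<phi>) = free_set \<phi>"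
  "pars_num (foldr AllN xs \<phi>) = pars_num \<phi>" "pars_set (foldr AllN xs \<phi>) = pars_set \<phi>"
  by (induction xs) auto

lemma free_foldr_AllS:
  "free_num (foldr AllS Xs \<phi>) = free_num \<phi>" "free_set (foldr AllS Xs \<phi>) = free_set \<phi> - set Xs"
  "pars_num (foldr AllS Xs \<phi>) = pars_num \<phi>" "pars_set (foldr AllS Xs \<phi>) = pars_set \<phi>"
  by (induction Xs) auto

text \<open>The axioms are sentences without parameters. Instances that speak about particular
  numbers and sets of the model arise by assigning these to the free variables of the
  matrix.\<close>

lemma satM_universal_closures:
  assumes "universal_closures \<phi> \<subseteq> RCA0" "pars_num \<phi> = {}" "pars_set \<phi> = {}" "range E \<subseteq> SS"
  shows "satM \<phi> e E"
proof -
  obtain xs Xs where "set xs = free_num \<phi>" "set Xs = free_set \<phi>"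
    using finite_list finite_free_num finite_free_set by metis
  then have "sentence (foldr AllN xs (foldr AllS Xs \<phi>))"
    using assms by (simp add: sentence_def free_foldr_AllN free_foldr_AllS)
  then have "foldr AllN xs (foldr AllS Xs \<phi>) \<in> RCA0"
    using assms(1) by (auto simp: universal_closures_def)
  then show ?thesis using satM_RCA0 foldr_AllN_sat foldr_AllS_sat assms(4) by blast
qed

lemma basic_M:
  fixes x y :: mnum
  shows Suc_neq_zero_M: "x + 1 \<noteq> 0" and Suc_inject_M: "x + 1 = y + 1 \<Longrightarrow> x = y"
    and add_zero_M: "x + 0 = x" and add_Suc_M: "x + (y + 1) = (x + y) + 1"
    and mult_zero_M: "x * 0 = 0" and mult_Suc_M: "x * (y + 1) = x * y + x"
    and not_less_zero_M: "\<not> x < 0" and less_Suc_M: "x < y + 1 \<longleftrightarrow> x < y \<or> x = y"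
proof -
  have *: "\<phi> \<in> basic_axioms \<Longrightarrow> satM \<phi> e E" for \<phi> e E
    using satM_RCA0 by (auto simp: RCA0_def)
  note ax = this[unfolded basic_axioms_def Let_def]
  show "x + 1 \<noteq> 0" using ax[OF insertI1] by auto
  show "x + 1 = y + 1 \<Longrightarrow> x = y" using ax[OF insertI2, OF insertI1] by auto
  show "x + 0 = x" using ax[OF insertI2[OF insertI2[OF insertI1]]] by auto
  show "x + (y + 1) = (x + y) + 1" using ax[OF insertI2[OF insertI2[OF insertI2[OF insertI1]]]] by auto
  show "x * 0 = 0" using ax[OF insertI2[OF insertI2[OF insertI2[OF insertI2[OF insertI1]]]]] by auto
  show "x * (y + 1) = x * y + x"
    using ax[OF insertI2[OF insertI2[OF insertI2[OF insertI2[OF insertI2[OF insertI1]]]]]] by auto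
  show "\<not> x < 0"
    using ax[OF insertI2[OF insertI2[OF insertI2[OF insertI2[OF insertI2[OF insertI2[OF insertI1]]]]]]] by auto
  show "x < y + 1 \<longleftrightarrow> x < y \<or> x = y"
    using ax[OF insertI2[OF insertI2[OF insertI2[OF insertI2[OF insertI2[OF insertI2[OF insertI2[OF insertI1]]]]]]]] by auto
qed

section \<open>Definability in the model\<close>

text \<open>
  Variables are de Bruijn indices, \<open>DAll\<close> is a bounded quantifier, and the second argument
  of \<open>DMem\<close> is the index of a set of the model.  \<open>Tm t\<close> and \<open>Dl R\<close> say that \<open>t\<close> is a term and
  that \<open>R\<close> is \<open>\<Sigma>\<^sup>0\<^sub>0\<close> with parameters; they are functions of the values of the variables.
\<close>

datatype dtm = DV nat | DC mnum | DAdd dtm dtm | DMul dtm dtm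

datatype dfm = DFls | DEq dtm dtm | DLess dtm dtm | DMem dtm nat | DImp dfm dfm | DAll dtm dfm

primrec deval :: "(nat \<Rightarrow> mnum) \<Rightarrow> dtm \<Rightarrow> mnum" where
  "deval e (DV i) = e i"
| "deval e (DC c) = c"
| "deval e (DAdd s t) = deval e s + deval e t"
| "deval e (DMul s t) = deval e s * deval e t"

primrec dsat :: "dfm \<Rightarrow> (nat \<Rightarrow> mnum) \<Rightarrow> bool" where
  "dsat DFls e = False"
| "dsat (DEq s t) e = (deval e s = deval e t)"
| "dsat (DLess s t) e = (deval e s < deval e t)"
| "dsat (DMem t a) e = (deval e t \<in> mset a)"
| "dsat (DImp \<phi> \<psi>) e = (dsat \<phi> e \<longrightarrow> dsat \<psi> e)"
| "dsat (DAll t \<phi>) e = (\<forall>a. a < deval e t \<longrightarrow> dsat \<phi> (case_nat a e))"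

definition Tm :: "((nat \<Rightarrow> mnum) \<Rightarrow> mnum) \<Rightarrow> bool" where
  "Tm t \<longleftrightarrow> (\<exists>u. \<forall>e. t e = deval e u)"

definition Dl :: "((nat \<Rightarrow> mnum) \<Rightarrow> bool) \<Rightarrow> bool" where
  "Dl R \<longleftrightarrow> (\<exists>\<phi>. \<forall>e. R e = dsat \<phi> e)"

primrec tren :: "(nat \<Rightarrow> nat) \<Rightarrow> dtm \<Rightarrow> dtm" where
  "tren r (DV i) = DV (r i)"
| "tren r (DC c) = DC c"
| "tren r (DAdd s t) = DAdd (tren r s) (tren r t)"
| "tren r (DMul s t) = DMul (tren r s) (tren r t)"

primrec dren :: "dfm \<Rightarrow> (nat \<Rightarrow> nat) \<Rightarrow> dfm" where
  "dren DFls r = DFls"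
| "dren (DEq s t) r = DEq (tren r s) (tren r t)"
| "dren (DLess s t) r = DLess (tren r s) (tren r t)"
| "dren (DMem t a) r = DMem (tren r t) a"
| "dren (DImp \<phi> \<psi>) r = DImp (dren \<phi> r) (dren \<psi> r)"
| "dren (DAll t \<phi>) r = DAll (tren r t) (dren \<phi> (case_nat 0 (\<lambda>i. Suc (r i))))"

lemma deval_tren: "deval e (tren r t) = deval (\<lambda>i. e (r i)) t"
  by (induction t) auto

lemma dsat_dren: "dsat (dren \<phi> r) e = dsat \<phi> (\<lambda>i. e (r i))"
proof (induction \<phi> arbitrary: r e)
  case (DAll t \<phi>)
  have "(\<lambda>i. case_nat a e (case_nat 0 (\<lambda>i. Suc (r i)) i)) = case_nat a (\<lambda>i. e (r i))" for a
    by (auto split: nat.split)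
  then show ?case using DAll by (simp add: deval_tren)
qed (auto simp: deval_tren)

lemma Dl_rename: "Dl R \<Longrightarrow> Dl (\<lambda>e. R (\<lambda>i. e (r i)))"
  unfolding Dl_def using dsat_dren by metis

lemma Tm_rename: "Tm t \<Longrightarrow> Tm (\<lambda>e. t (\<lambda>i. e (r i)))"
  unfolding Tm_def using deval_tren by metis

text \<open>With these rules \<open>intro definable\<close> recognizes a Sigma00 relation from the
  shape of its HOL term, so that no formula has to be written out.\<close>

named_theorems definable

lemma Tm_var [definable]: "Tm (\<lambda>e. e i)"
  unfolding Tm_def by (rule exI[of _ "DV i"]) simp

lemma Tm_const [definable]: "Tm (\<lambda>e. c)"
  unfolding Tm_def by (rule exI[of _ "DC c"]) simp

lemma Tm_add [definable]: "Tm s \<Longrightarrow> Tm t \<Longrightarrow> Tm (\<lambda>e. s e + t e)"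
  unfolding Tm_def by (metis deval.simps(3))

lemma Tm_mult [definable]: "Tm s \<Longrightarrow> Tm t \<Longrightarrow> Tm (\<lambda>e. s e * t e)"
  unfolding Tm_def by (metis deval.simps(4))

lemma Dl_const [definable]: "Dl (\<lambda>e. b)"
  unfolding Dl_def by (cases b) (rule exI[of _ "DImp DFls DFls"] exI[of _ DFls]; simp)+

lemma Dl_eq [definable]: "Tm s \<Longrightarrow> Tm t \<Longrightarrow> Dl (\<lambda>e. s e = t e)"
  unfolding Dl_def Tm_def by (metis dsat.simps(2))

lemma Dl_less [definable]: "Tm s \<Longrightarrow> Tm t \<Longrightarrow> Dl (\<lambda>e. s e < t e)"
  unfolding Dl_def Tm_def by (metis dsat.simps(3))

lemma Dl_mem [definable]: "Tm t \<Longrightarrow> A \<in> SS \<Longrightarrow> Dl (\<lambda>e. t e \<in> A)"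
  unfolding Dl_def Tm_def SS_def by (metis (no_types, lifting) dsat.simps(4) imageE)

lemma Dl_imp [definable]: "Dl Q \<Longrightarrow> Dl R \<Longrightarrow> Dl (\<lambda>e. Q e \<longrightarrow> R e)"
  unfolding Dl_def by (metis dsat.simps(5))

lemma Dl_not [definable]: "Dl Q \<Longrightarrow> Dl (\<lambda>e. \<not> Q e)"
  using Dl_imp[of Q "\<lambda>e. False"] Dl_const by simp

lemma Dl_or [definable]: "Dl Q \<Longrightarrow> Dl R \<Longrightarrow> Dl (\<lambda>e. Q e \<or> R e)"
  using Dl_imp[of "\<lambda>e. \<not> Q e" R] Dl_not[of Q] by (simp add: imp_conv_disj)

lemma Dl_and [definable]: "Dl Q \<Longrightarrow> Dl R \<Longrightarrow> Dl (\<lambda>e. Q e \<and> R e)"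
  using Dl_not[OF Dl_or[OF Dl_not Dl_not, of Q R]] by simp

lemma Dl_iff [definable]: "Dl Q \<Longrightarrow> Dl R \<Longrightarrow> Dl (\<lambda>e. Q e \<longleftrightarrow> R e)"
  using Dl_and[OF Dl_imp[of Q R] Dl_imp[of R Q]] by (simp add: iff_conv_conj_imp)

lemma Dl_all_less [definable]:
  assumes "Tm t" "Dl (\<lambda>e. R (e 0) (\<lambda>i. e (Suc i)))"
  shows "Dl (\<lambda>e. \<forall>a<t e. R a e)"
proof -
  obtain u where u: "\<And>e. t e = deval e u" using assms(1) by (auto simp: Tm_def)
  obtain \<phi> where "\<And>e. R (e 0) (\<lambda>i. e (Suc i)) = dsat \<phi> e" using assms(2) by (auto simp: Dl_def)
  from this[of "case_nat _ _"] have "R a e = dsat \<phi> (case_nat a e)" for a e by simp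
  then show ?thesis using u unfolding Dl_def by (intro exI[of _ "DAll u \<phi>"]) simp
qed

lemma Dl_ex_less [definable]:
  assumes "Tm t" "Dl (\<lambda>e. R (e 0) (\<lambda>i. e (Suc i)))"
  shows "Dl (\<lambda>e. \<exists>a<t e. R a e)"
  using Dl_not[OF Dl_all_less[OF assms(1), of "\<lambda>a e. \<not> R a e"]] Dl_not[OF assms(2)] by simp

subsection \<open>Translation into the object language\<close>

definition name :: "nat \<Rightarrow> string" where "name n = replicate n CHR ''a''"

lemma length_name [simp]: "length (name n) = n" by (simp add: name_def)

lemma name_inject [simp]: "name m = name n \<longleftrightarrow> m = n" by (metis length_name)

text \<open>
  At depth \<open>d\<close> the index \<open>i < d\<close> becomes the variable with the even number \<open>2 (d - 1 - i)\<close>;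
  constants become variables with odd numbers.
\<close>

primrec ttrans :: "nat \<Rightarrow> dtm \<Rightarrow> tm" where
  "ttrans d (DV i) = (if i < d then V (name (2 * (d - 1 - i))) else \<^bold>0)"
| "ttrans d (DC c) = V (name (2 * to_nat c + 1))"
| "ttrans d (DAdd s t) = ttrans d s \<^bold>+ ttrans d t"
| "ttrans d (DMul s t) = ttrans d s \<^bold>* ttrans d t"

primrec dtrans :: "dfm \<Rightarrow> nat \<Rightarrow> fm" where
  "dtrans DFls d = \<^bold>\<bottom>"
| "dtrans (DEq s t) d = (ttrans d s \<^bold>= ttrans d t)"
| "dtrans (DLess s t) d = (ttrans d s \<^bold>< ttrans d t)"
| "dtrans (DMem t a) d = (ttrans d t \<^bold>\<in> SV (name a))"
| "dtrans (DImp \<phi> \<psi>) d = (dtrans \<phi> d \<^bold>\<longrightarrow> dtrans \<psi> d)"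
| "dtrans (DAll t \<phi>) d = (\<^bold>\<forall>name (2 * d). V (name (2 * d)) \<^bold>< ttrans d t \<^bold>\<longrightarrow> dtrans \<phi> (Suc d))"

definition env :: "nat \<Rightarrow> (string \<Rightarrow> mnum) \<Rightarrow> nat \<Rightarrow> mnum" where
  "env d s i = (if i < d then s (name (2 * (d - 1 - i))) else 0)"

definition names_constants :: "(string \<Rightarrow> mnum) \<Rightarrow> bool" where
  "names_constants s \<longleftrightarrow> (\<forall>c. s (name (2 * to_nat c + 1)) = c)"

text \<open>Every set of the model is \<open>mset a\<close> for some \<open>a\<close>, so a set
  variable can stand for it through the length of its name.\<close>

definition set_env :: "string \<Rightarrow> mnum set" where "set_env X = mset (length X)"

lemma eval_ttrans: "names_constants s \<Longrightarrow> eval_tm mpar s (ttrans d t) = deval (env d s) t"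
  by (induction t) (auto simp: env_def names_constants_def)

lemma vars_ttrans: "x \<in> vars_tm (ttrans d t) \<Longrightarrow> x \<noteq> name (2 * d)"
  by (induction t) (auto split: if_splits, presburger)

lemma pars_ttrans [simp]: "pars_tm (ttrans d t) = {}"
  by (induction t) auto

lemma pars_dtrans [simp]: "pars_num (dtrans \<phi> d) = {}" "pars_set (dtrans \<phi> d) = {}"
  by (induction \<phi> arbitrary: d) auto

lemma free_set_dtrans: "X \<in> free_set (dtrans \<phi> d) \<Longrightarrow> \<exists>n. X = name n"
  by (induction \<phi> arbitrary: d) auto

lemma Sigma00_dtrans: "Sigma00 (dtrans \<phi> d)"
  by (induction \<phi> arbitrary: d) (auto intro!: Sigma00.intros dest: vars_ttrans)

lemma names_constants_upd: "names_constants s \<Longrightarrow> names_constants (s(name (2 * d) := a))"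
  by (auto simp: names_constants_def) presburger

lemma env_Suc: "env (Suc d) (s(name (2 * d) := a)) = case_nat a (env d s)"
  by (auto simp: env_def fun_eq_iff split: nat.split)

lemma sat_dtrans:
  assumes "names_constants s" and "\<And>n. E (name n) = mset n"
  shows "satM (dtrans \<phi> d) s E = dsat \<phi> (env d s)"
  using assms(1)
proof (induction \<phi> arbitrary: d s)
  case (DAll t \<phi>)
  have "eval_tm mpar (s(name (2 * d) := a)) (ttrans d t) = deval (env d s) t" for a
    using eval_ttrans[OF DAll.prems] vars_ttrans
    by (subst eval_tm_cong[of _ _ s _ mpar]) auto
  moreover have "satM (dtrans \<phi> (Suc d)) (s(name (2 * d) := a)) E = dsat \<phi> (case_nat a (env d s))" for a
    using DAll.IH[OF names_constants_upd[OF DAll.prems, of d a], of "Suc d"] by (simp only: env_Suc)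
  ultimately show ?case by (simp only: dtrans.simps sat.simps dsat.simps eval_tm.simps fun_upd_same)
qed (auto simp: eval_ttrans assms(2))

definition base_env :: "string \<Rightarrow> mnum" where "base_env X = from_nat (length X div 2)"

lemma names_base_env: "names_constants base_env"
  by (auto simp: names_constants_def base_env_def)

lemma range_set_env: "range set_env \<subseteq> SS"
  by (auto simp: set_env_def SS_def)

lemma set_env_name: "set_env (name n) = mset n"
  by (simp add: set_env_def)

lemma env_0: "env 0 s = (\<lambda>_. 0)"
  by (auto simp: env_def)

lemma sat_dtrans2:
  "satM (dtrans \<phi> 2) (base_env(name 0 := x, name 2 := y)) set_env = dsat \<phi> (case_nat y (case_nat x (\<lambda>_. 0)))"
  using sat_dtrans[OF names_constants_upd[OF names_constants_upd[OF names_base_env, of 0 x], of 1 y] set_env_name, of \<phi> 2]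
    env_Suc[of 0 base_env x] env_Suc[of 1 "base_env(name 0 := x)" y]
  by (simp add: env_0 numeral_2_eq_2)

section \<open>Sigma01 induction and Delta01 comprehension for definable relations\<close>

lemma pars_subst_tm: "pars_tm (subst_tm x u t) \<subseteq> pars_tm t \<union> pars_tm u"
  by (induction t) auto

lemma pars_subst_num:
  "pars_num (subst_num x u \<phi>) \<subseteq> pars_num \<phi> \<union> pars_tm u" "pars_set (subst_num x u \<phi>) = pars_set \<phi>"
proof (induction \<phi>)
  case (Eq s t) {case 1 show ?case using pars_subst_tm[of x u s] pars_subst_tm[of x u t] by auto} {case 2 show ?case by simp}
next
  case (Less s t) {case 1 show ?case using pars_subst_tm[of x u s] pars_subst_tm[of x u t] by auto} {case 2 show ?case by simp}
next
  case (Mem t S) {case 1 show ?case using pars_subst_tm[of x u t] by auto} {case 2 show ?case by simp}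
qed auto

theorem induction_Sigma1:
  assumes Q: "Dl (\<lambda>e. Q (e 0) (e 1))"
    and zero: "\<exists>y. Q y 0" and step: "\<And>x. \<exists>y. Q y x \<Longrightarrow> \<exists>y. Q y (x + 1)"
  shows "\<exists>y. Q y x"
proof -
  obtain \<phi> where \<phi>: "\<And>e. Q (e 0) (e 1) = dsat \<phi> e" using Q by (auto simp: Dl_def)
  \<comment> \<open>At depth 2 the induction variable, index 1, is called \<open>name 0\<close>, and
    the witness, index 0, is called \<open>name 2\<close>.\<close>
  let ?\<Phi> = "\<^bold>\<exists>name 2. dtrans \<phi> 2"
  have Q\<Phi>: "satM ?\<Phi> (base_env(name 0 := x)) set_env \<longleftrightarrow> (\<exists>y. Q y x)" for x
    using \<phi>[of "case_nat _ (case_nat x (\<lambda>_. 0))"]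
    by (simp only: sat.simps sat_dtrans2) simp
  have "Sigma01 ?\<Phi>" using Sigma00_dtrans by (auto simp: Sigma01_def)
  then have "universal_closures (induction_instance (name 0) ?\<Phi>) \<subseteq> RCA0"
    unfolding RCA0_def by blast
  then have "satM (induction_instance (name 0) ?\<Phi>) base_env set_env"
    using pars_subst_num[of "name 0" "\<^bold>0" "dtrans \<phi> 2"]
      pars_subst_num[of "name 0" "V (name 0) \<^bold>+ \<^bold>1" "dtrans \<phi> 2"]
    by (intro satM_universal_closures range_set_env) (auto simp: induction_instance_def)
  then show ?thesis unfolding sat_induction_instance Q\<Phi> using zero step by blast
qed

theorem comprehension_Delta1:
  assumes Q: "Dl (\<lambda>e. Q (e 0) (e 1))" and R: "Dl (\<lambda>e. R (e 0) (e 1))"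
    and QR: "\<And>x. (\<exists>y. Q y x) \<longleftrightarrow> \<not> (\<exists>y. R y x)"
  shows "{x. \<exists>y. Q y x} \<in> SS"
proof -
  obtain \<phi> where \<phi>: "\<And>e. Q (e 0) (e 1) = dsat \<phi> e" using Q by (auto simp: Dl_def)
  obtain \<psi> where \<psi>: "\<And>e. (\<not> R (e 0) (e 1)) = dsat \<psi> e" using Dl_not[OF R] by (auto simp: Dl_def)
  \<comment> \<open>All names made by \<open>name\<close> consist of the letter a only, so
    \<open>?X\<close> is free in none of these formulas.\<close>
  let ?\<Phi> = "\<^bold>\<exists>name 2. dtrans \<phi> 2" and ?\<Psi> = "\<^bold>\<forall>name 2. dtrans \<psi> 2" and ?X = "''b''"
  have Q\<Phi>: "satM ?\<Phi> (base_env(name 0 := x)) set_env \<longleftrightarrow> (\<exists>y. Q y x)" for x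
    using \<phi>[of "case_nat _ (case_nat x (\<lambda>_. 0))"] by (simp only: sat.simps sat_dtrans2) simp
  have R\<Psi>: "satM ?\<Psi> (base_env(name 0 := x)) set_env \<longleftrightarrow> (\<forall>y. \<not> R y x)" for x
    using \<psi>[of "case_nat _ (case_nat x (\<lambda>_. 0))"] by (simp only: sat.simps sat_dtrans2) simp
  have notX: "?X \<noteq> name n" for n by (cases n) (auto simp: name_def)
  then have X: "?X \<notin> free_set ?\<Phi>" using free_set_dtrans by fastforce
  have "Sigma01 ?\<Phi>" "Pi01 ?\<Psi>" using Sigma00_dtrans by (auto simp: Sigma01_def Pi01_def)
  then have "universal_closures (comprehension_instance (name 0) ?X ?\<Phi> ?\<Psi>) \<subseteq> RCA0"
    unfolding RCA0_def using X by blast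
  then have "satM (comprehension_instance (name 0) ?X ?\<Phi> ?\<Psi>) base_env set_env"
    by (intro satM_universal_closures range_set_env) (auto simp: comprehension_instance_def)
  then have "(\<forall>x. satM ?\<Phi> (base_env(name 0 := x)) set_env \<longleftrightarrow> satM ?\<Psi> (base_env(name 0 := x)) set_env) \<longrightarrow>
      (\<exists>A\<in>SS. \<forall>x. x \<in> A \<longleftrightarrow> satM ?\<Phi> (base_env(name 0 := x)) (set_env(?X := A)))"
    unfolding comprehension_instance_def sat.simps(1,4,5) sat.simps(6)[of _ _ _ "name 0"] sat.simps(7)
      eval_tm.simps eval_st.simps fun_upd_same by blast
  moreover have "satM ?\<Phi> e (set_env(?X := A)) = satM ?\<Phi> e set_env" for e A
    using X by (intro sat_cong) auto
  ultimately have "(\<forall>x. (\<exists>y. Q y x) \<longleftrightarrow> (\<forall>y. \<not> R y x)) \<longrightarrow> (\<exists>A\<in>SS. \<forall>x. x \<in> A \<longleftrightarrow> (\<exists>y. Q y x))"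
    by (simp only: Q\<Phi> R\<Psi>)
  then obtain A where "A \<in> SS" and A: "\<forall>x. x \<in> A \<longleftrightarrow> (\<exists>y. Q y x)" using QR by blast
  moreover have "{x. \<exists>y. Q y x} = A" using A by blast
  ultimately show ?thesis by simp
qed

lemma Dl_set: "Dl (\<lambda>e. Q (e 0)) \<Longrightarrow> {x. Q x} \<in> SS"
  using comprehension_Delta1[of "\<lambda>_. Q" "\<lambda>_ x. \<not> Q x"]
    Dl_rename[of "\<lambda>e. Q (e 0)" "\<lambda>_. 1"] Dl_not[OF Dl_rename[of "\<lambda>e. Q (e 0)" "\<lambda>_. 1"]]
  by simp

lemma Dl_induct:
  assumes "Dl (\<lambda>e. Q (e 0))" "Q 0" "\<And>x. Q x \<Longrightarrow> Q (x + 1)"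
  shows "Q x"
  using induction_Sigma1[of "\<lambda>_. Q"] assms Dl_rename[of "\<lambda>e. Q (e 0)" "\<lambda>_. 1"] by simp

section \<open>Arithmetic in the model\<close>

lemma zero_add_M: "0 + x = (x::mnum)"
  by (rule Dl_induct[where x = x], intro definable) (simp_all add: add_zero_M add_Suc_M)

lemma Suc_add_M: "(x + 1) + y = (x + y) + (1::mnum)"
  by (rule Dl_induct[where x = y], intro definable) (simp_all add: add_zero_M add_Suc_M)

lemma add_comm_M: "x + y = y + (x::mnum)"
  by (rule Dl_induct[where x = y], intro definable) (simp_all add: add_zero_M add_Suc_M zero_add_M Suc_add_M)

lemma add_assoc_M: "(x + y) + z = x + (y + (z::mnum))"
  by (rule Dl_induct[where x = z], intro definable) (simp_all add: add_zero_M add_Suc_M)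

lemma zero_mult_M: "0 * x = (0::mnum)"
  by (rule Dl_induct[where x = x], intro definable) (simp_all add: mult_zero_M mult_Suc_M add_zero_M)

lemma add_left_comm_M: "x + (y + z) = y + (x + (z::mnum))"
  by (metis add_assoc_M add_comm_M)

lemma Suc_mult_M: "(x + 1) * y = x * y + (y::mnum)"
  by (rule Dl_induct[where x = y], intro definable)
    (simp_all add: mult_zero_M mult_Suc_M add_zero_M add_assoc_M add_comm_M add_left_comm_M)

lemma mult_comm_M: "x * y = y * (x::mnum)"
  by (rule Dl_induct[where x = y], intro definable) (simp_all add: mult_zero_M mult_Suc_M zero_mult_M Suc_mult_M)

lemma distrib_M: "x * (y + z) = x * y + x * (z::mnum)"
  by (rule Dl_induct[where x = z], intro definable)
    (simp_all add: mult_zero_M mult_Suc_M add_zero_M add_assoc_M[symmetric])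

lemma mult_one_M: "x * 1 = (x::mnum)"
  using mult_Suc_M[of x 0] by (simp add: mult_zero_M zero_add_M)

lemma mult_assoc_M: "(x * y) * z = x * (y * (z::mnum))"
  by (rule Dl_induct[where x = z], intro definable)
    (simp_all add: mult_zero_M mult_one_M distrib_M)

lemma add_cancel_M: "x + z = y + z \<Longrightarrow> x = (y::mnum)"
proof -
  have "x + z = y + z \<longrightarrow> x = y"
    by (rule Dl_induct[where x = z], intro definable) (auto simp: add_zero_M add_Suc_M dest: Suc_inject_M)
  then show "x + z = y + z \<Longrightarrow> x = y" by blast
qed

lemma zero_or_Suc_M: "x = 0 \<or> (\<exists>w. x = w + (1::mnum))"
proof -
  have "\<exists>w. x = 0 \<or> x = w + 1"
    by (rule induction_Sigma1[where x = x], intro definable) auto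
  then show ?thesis by blast
qed

text \<open>The axioms give the order only through its two recursion clauses. Expressing it by
  addition turns transitivity and monotonicity into algebra.\<close>

lemma less_iff_M: "x < y \<longleftrightarrow> (\<exists>z. x + z + 1 = (y::mnum))"
proof
  have "\<exists>z. x < y \<longrightarrow> x + z + 1 = y"
  proof (rule induction_Sigma1[where x = y], intro definable)
    show "\<exists>z. x < 0 \<longrightarrow> x + z + 1 = 0" by (simp add: not_less_zero_M)
    fix y assume "\<exists>z. x < y \<longrightarrow> x + z + 1 = y"
    then obtain z where z: "x < y \<longrightarrow> x + z + 1 = y" by blast
    show "\<exists>z. x < y + 1 \<longrightarrow> x + z + 1 = y + 1"
    proof (cases "x < y")
      case True
      then have "x + (z + 1) + 1 = y + 1" using z by (simp add: add_Suc_M)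
      then show ?thesis by blast
    next
      case False
      then show ?thesis by (auto simp: less_Suc_M add_zero_M intro: exI[of _ 0])
    qed
  qed
  then show "x < y \<Longrightarrow> \<exists>z. x + z + 1 = y" by blast
  have "x < x + z + 1" for z
    by (rule Dl_induct[where x = z], intro definable) (auto simp: add_zero_M add_Suc_M less_Suc_M)
  then show "\<exists>z. x + z + 1 = y \<Longrightarrow> x < y" by blast
qed

lemma irrefl_M: "\<not> x < (x::mnum)"
proof
  assume "x < x"
  then obtain z where "(z + 1) + x = 0 + x" by (metis less_iff_M add_comm_M add_assoc_M zero_add_M)
  then show False using add_cancel_M Suc_neq_zero_M by blast
qed

lemma trans_M: "x < y \<Longrightarrow> y < z \<Longrightarrow> x < (z::mnum)"
  unfolding less_iff_M by (metis add_assoc_M add_comm_M)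

lemma linear_M: "x < y \<or> x = y \<or> y < (x::mnum)"
proof (rule Dl_induct[where x = y], intro definable)
  show "x < 0 \<or> x = 0 \<or> 0 < x"
    using zero_or_Suc_M[of x] by (metis less_iff_M zero_add_M)
  fix y assume "x < y \<or> x = y \<or> y < x"
  moreover have "x = y + 1 \<or> y + 1 < x" if "y < x"
  proof -
    obtain z where z: "y + z + 1 = x" using \<open>y < x\<close> less_iff_M by blast
    show ?thesis
      using zero_or_Suc_M[of z] z unfolding less_iff_M by (metis add_zero_M add_assoc_M add_comm_M)
  qed
  ultimately show "x < y + 1 \<or> x = y + 1 \<or> y + 1 < x" by (auto simp: less_Suc_M)
qed

lemma le_iff_M: "x \<le> y \<longleftrightarrow> (\<exists>z. y = x + (z::mnum))"
  unfolding less_eq_mnum_def less_iff_M by (metis add_assoc_M add_zero_M zero_or_Suc_M)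

lemma diff_M: "(y + z) - y = (z::mnum)"
proof -
  have "(SOME w. y + z = y + w) = z"
    by (rule some_equality) (auto dest: add_cancel_M simp: add_comm_M[of y])
  then show ?thesis by (auto simp: minus_mnum_def)
qed

lemma diff_less_M: "x < y \<Longrightarrow> x - y = (0::mnum)"
  unfolding minus_mnum_def using le_iff_M[of y x] irrefl_M trans_M less_eq_mnum_def by metis

lemma zero_le_M: "0 \<le> (x::mnum)"
  unfolding le_iff_M by (auto simp: zero_add_M)

lemma diff_zero_M: "0 - x = (0::mnum)"
  using zero_le_M[of x] diff_less_M[of 0 x] diff_M[of 0 0] by (auto simp: less_eq_mnum_def add_zero_M)

lemma less_add_M: "x < y \<Longrightarrow> z + x < z + (y::mnum)"
  unfolding less_iff_M by (metis add_assoc_M)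

lemma less_mult_M: "x < y \<Longrightarrow> 0 < z \<Longrightarrow> z * x < z * (y::mnum)"
proof -
  assume "x < y" "0 < z"
  then obtain u v where "y = x + (u + 1)" "z = v + 1"
    unfolding less_iff_M by (metis add_assoc_M zero_add_M)
  then have "z * y = z * x + ((z * u) + v) + 1"
    by (simp add: distrib_M mult_Suc_M Suc_mult_M add_assoc_M zero_mult_M mult_zero_M)
      (metis mult_comm_M mult_Suc_M mult_zero_M zero_add_M add_comm_M)
  then show ?thesis unfolding less_iff_M by metis
qed

text \<open>Makes \<open>algebra_simps\<close>, the rules for \<open>dvd\<close> and those for
  ordered semirings available for the numbers of the model.\<close>

instance mnum :: linordered_semidom
proof
  fix a b c :: mnum
  show "a + b + c = a + (b + c)" by (rule add_assoc_M)
  show "a + b = b + a" by (rule add_comm_M)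
  show "0 + a = a" by (rule zero_add_M)
  show "a * b * c = a * (b * c)" by (rule mult_assoc_M)
  show "a * b = b * a" by (rule mult_comm_M)
  show "1 * a = a" by (metis Suc_mult_M zero_add_M zero_mult_M)
  show "(a + b) * c = a * c + b * c" by (metis distrib_M mult_comm_M)
  show "a * (b + c) = a * b + a * c" by (rule distrib_M)
  show "0 * a = 0" by (rule zero_mult_M)
  show "a * 0 = 0" by (rule mult_zero_M)
  show "(0::mnum) \<noteq> 1" by (metis Suc_neq_zero_M zero_add_M)
  show "a + b - a = b" by (rule diff_M)
  show "a < b \<longleftrightarrow> a \<le> b \<and> \<not> b \<le> a"
    unfolding less_eq_mnum_def by (metis irrefl_M trans_M)
  show "a \<le> a" by (simp add: less_eq_mnum_def)
  show "a \<le> b \<Longrightarrow> b \<le> c \<Longrightarrow> a \<le> c" unfolding less_eq_mnum_def using trans_M by blast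
  show "a \<le> b \<Longrightarrow> b \<le> a \<Longrightarrow> a = b" unfolding less_eq_mnum_def using irrefl_M trans_M by blast
  show "a \<le> b \<or> b \<le> a" unfolding less_eq_mnum_def using linear_M by blast
  show "a \<le> b \<Longrightarrow> c + a \<le> c + b" unfolding less_eq_mnum_def using less_add_M by blast
  show "a < b \<Longrightarrow> 0 < c \<Longrightarrow> c * a < c * b" by (rule less_mult_M)
  show "(0::mnum) < 1" by (metis less_iff_M zero_add_M)
  show "b \<le> a \<Longrightarrow> a - b + b = a" unfolding le_iff_M using diff_M add_comm_M by metis
  show "a - b - c = a - (b + c)"
  proof (cases "b \<le> a")
    case True
    then obtain w where w: "a = b + w" using le_iff_M by blast
    show ?thesis
    proof (cases "c \<le> w")
      case True
      then show ?thesis using w le_iff_M diff_M add_assoc_M by metis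
    next
      case False
      then have "w < c" using linear_M less_eq_mnum_def by blast
      then show ?thesis using w less_add_M diff_M diff_less_M by metis
    qed
  next
    case False
    then have less: "a < b" using linear_M less_eq_mnum_def by blast
    then have "a < b + c" using zero_le_M[of c] less_add_M[of 0 c b] trans_M less_eq_mnum_def add_zero_M by metis
    then show ?thesis using less diff_less_M diff_zero_M by metis
  qed
  show "a * (b - c) = a * b - a * c"
  proof (cases "c \<le> b")
    case True
    then show ?thesis using le_iff_M diff_M distrib_M by metis
  next
    case False
    then have less: "b < c" using linear_M less_eq_mnum_def by blast
    show ?thesis
    proof (cases "a = 0")
      case True
      then show ?thesis using zero_mult_M diff_zero_M by metis
    next
      case False
      then have "a * b < a * c" using less less_mult_M zero_le_M less_eq_mnum_def by metis
      then show ?thesis using less diff_less_M mult_zero_M by metis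
    qed
  qed
  show "a * b \<noteq> 0" if "a \<noteq> 0" "b \<noteq> 0"
    using that less_mult_M[of 0 b a] zero_le_M less_eq_mnum_def mult_zero_M irrefl_M by metis
qed

section \<open>Bounded quantifiers, divisibility and least elements\<close>

lemma less_Suc_iff: "x < y + 1 \<longleftrightarrow> x \<le> (y::mnum)"
  using less_Suc_M[of x y] by auto

lemma Suc_le_iff: "x + 1 \<le> y \<longleftrightarrow> x < (y::mnum)"
  using less_Suc_iff[of y x] by auto

declare zero_le_M [simp]

lemma pos_iff: "0 < (x::mnum) \<longleftrightarrow> x \<noteq> 0"
  using zero_le_M[of x] by (auto simp del: zero_le_M)

lemma le_add_self [simp]: "x \<le> x + (y::mnum)" "x \<le> y + (x::mnum)"
  by (simp_all add: add_increasing add_increasing2)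

lemma le_mult_self: "0 < y \<Longrightarrow> x \<le> y * (x::mnum)"
  using mult_right_mono[of 1 y x] Suc_le_iff[of 0 y] by simp

lemma le_obtain: "x \<le> (y::mnum) \<Longrightarrow> \<exists>z. y = x + z"
  by (simp add: le_iff_M)

lemma Dl_le [definable]: "Tm s \<Longrightarrow> Tm t \<Longrightarrow> Dl (\<lambda>e. s e \<le> t e)"
  unfolding less_eq_mnum_def by (intro definable)

lemma Dl_all_le [definable]:
  assumes "Tm t" "Dl (\<lambda>e. R (e 0) (\<lambda>i. e (Suc i)))"
  shows "Dl (\<lambda>e. \<forall>a\<le>t e. R a e)"
  using Dl_all_less[OF Tm_add[OF assms(1) Tm_const[of 1]] assms(2)] by (simp add: less_Suc_iff)

lemma Dl_ex_le [definable]: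
  assumes "Tm t" "Dl (\<lambda>e. R (e 0) (\<lambda>i. e (Suc i)))"
  shows "Dl (\<lambda>e. \<exists>a\<le>t e. R a e)"
  using Dl_ex_less[OF Tm_add[OF assms(1) Tm_const[of 1]] assms(2)] by (simp add: less_Suc_iff)

text \<open>Bounding the quotient makes divisibility Sigma00. For \<open>x = 0\<close> both sides
  say that \<open>y = 0\<close>.\<close>

lemma dvd_iff_bounded: "x dvd y \<longleftrightarrow> (\<exists>k\<le>y. y = x * (k::mnum))"
proof
  assume "x dvd y"
  then obtain k where k: "y = x * k" by (auto simp: dvd_def)
  show "\<exists>k\<le>y. y = x * k"
  proof (cases "x = 0")
    case False
    then have "k \<le> y" using k le_mult_self pos_iff by simp
    then show ?thesis using k by blast
  qed (use k in auto)
qed auto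

lemma Dl_dvd [definable]: "Tm s \<Longrightarrow> Tm t \<Longrightarrow> Dl (\<lambda>e. s e dvd t e)"
  unfolding dvd_iff_bounded
  by (intro definable; (assumption | rule Tm_rename[of _ Suc], assumption))

lemma Dl_less_induct:
  assumes "Dl (\<lambda>e. Q (e 0))" and step: "\<And>x. (\<And>y. y < x \<Longrightarrow> Q y) \<Longrightarrow> Q x"
  shows "Q x"
proof -
  have "\<forall>y<x + 1. Q y"
  proof (rule Dl_induct[where x = "x + 1"])
    show "Dl (\<lambda>e. \<forall>y<e 0. Q y)" using assms(1) by (intro definable)
    show "\<forall>y<0. Q y" by (simp add: leD)
    show "\<forall>y<x + 1. Q y" if "\<forall>y<x. Q y" for x
      using that step by (auto simp: less_Suc_M)
  qed
  then show ?thesis by (simp add: less_Suc_iff)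
qed

lemma Dl_least:
  assumes "Dl (\<lambda>e. Q (e 0))" and "Q x"
  shows "\<exists>m. Q m \<and> (\<forall>y<m. \<not> Q y)"
  using Dl_less_induct[OF Dl_not[OF assms(1)]] assms(2) by blast

subsection \<open>\<open>\<Sigma>\<^sup>0\<^sub>1\<close> predicates\<close>

definition S1 :: "((nat \<Rightarrow> mnum) \<Rightarrow> bool) \<Rightarrow> bool" where
  "S1 R \<longleftrightarrow> (\<exists>Q. Dl (\<lambda>e. Q (e 0) (\<lambda>i. e (Suc i))) \<and> (\<forall>e. R e \<longleftrightarrow> (\<exists>y. Q y e)))"

lemma S1_Dl: "Dl R \<Longrightarrow> S1 R"
  unfolding S1_def using Dl_rename[of R Suc] by (intro exI[of _ "\<lambda>_ e. R e"]) simp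

lemma S1_or: "S1 Q \<Longrightarrow> S1 R \<Longrightarrow> S1 (\<lambda>e. Q e \<or> R e)"
proof -
  assume "S1 Q" "S1 R"
  then obtain Q' R' where Q': "Dl (\<lambda>e. Q' (e 0) (\<lambda>i. e (Suc i)))" "\<And>e. Q e \<longleftrightarrow> (\<exists>y. Q' y e)"
    and R': "Dl (\<lambda>e. R' (e 0) (\<lambda>i. e (Suc i)))" "\<And>e. R e \<longleftrightarrow> (\<exists>y. R' y e)"
    unfolding S1_def by blast
  show ?thesis unfolding S1_def
    by (rule exI[of _ "\<lambda>y e. Q' y e \<or> R' y e"]) (use Q' R' Dl_or in auto)
qed

text \<open>Two unbounded witnesses are merged into a common bound, for which their sum serves; the
  witnesses themselves are then quantified below it. \<open>S1_ex\<close> uses the same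
  device.\<close>

lemma S1_and: "S1 Q \<Longrightarrow> S1 R \<Longrightarrow> S1 (\<lambda>e. Q e \<and> R e)"
proof -
  assume "S1 Q" "S1 R"
  then obtain Q' R' where Q': "Dl (\<lambda>e. Q' (e 0) (\<lambda>i. e (Suc i)))" "\<And>e. Q e \<longleftrightarrow> (\<exists>y. Q' y e)"
    and R': "Dl (\<lambda>e. R' (e 0) (\<lambda>i. e (Suc i)))" "\<And>e. R e \<longleftrightarrow> (\<exists>y. R' y e)"
    unfolding S1_def by blast
  let ?W = "\<lambda>w e. \<exists>y\<le>w. \<exists>y'\<le>w. Q' y e \<and> R' y' e"
  \<comment> \<open>Inside the two bounded quantifiers index 0 is \<open>y'\<close>, index 1 is
    \<open>y\<close> and index 2 is \<open>w\<close>, so the variables of \<open>e\<close> start at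
    3.\<close>
  have "Dl (\<lambda>e. Q' (e (Suc 0)) (\<lambda>i. e (Suc (Suc (Suc i)))))" "Dl (\<lambda>e. R' (e 0) (\<lambda>i. e (Suc (Suc (Suc i)))))"
    using Dl_rename[OF Q'(1), of "case_nat 1 (\<lambda>i. i + 3)"] Dl_rename[OF R'(1), of "case_nat 0 (\<lambda>i. i + 3)"]
    by (simp_all add: numeral_3_eq_3)
  then have "Dl (\<lambda>e. ?W (e 0) (\<lambda>i. e (Suc i)))" by (intro definable)
  moreover have "Q e \<and> R e \<longleftrightarrow> (\<exists>w. ?W w e)" for e
  proof
    assume "Q e \<and> R e"
    then obtain y y' where "Q' y e" "R' y' e" using Q'(2) R'(2) by blast
    then have "?W (y + y') e" using le_add_self by blast
    then show "\<exists>w. ?W w e" by blast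
  qed (use Q'(2) R'(2) in blast)
  ultimately show ?thesis unfolding S1_def by (intro exI[of _ ?W]) blast
qed

lemma S1_ex:
  assumes "S1 (\<lambda>e. R (e 0) (\<lambda>i. e (Suc i)))"
  shows "S1 (\<lambda>e. \<exists>a. R a e)"
proof -
  obtain Q where Q: "Dl (\<lambda>e. Q (e 0) (\<lambda>i. e (Suc i)))" "\<And>e. R (e 0) (\<lambda>i. e (Suc i)) \<longleftrightarrow> (\<exists>y. Q y e)"
    using assms unfolding S1_def by blast
  have R: "R a e \<longleftrightarrow> (\<exists>y. Q y (case_nat a e))" for a e
    using Q(2)[of "case_nat a e"] by simp
  let ?W = "\<lambda>w e. \<exists>a\<le>w. \<exists>y\<le>w. Q y (case_nat a e)"
  have "(\<lambda>i. e (case_nat (Suc 0) (\<lambda>i. Suc (Suc (Suc i))) i)) = case_nat (e (Suc 0)) (\<lambda>i. e (Suc (Suc (Suc i))))"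
    for e :: "nat \<Rightarrow> mnum" by (auto split: nat.split)
  then have "Dl (\<lambda>e. Q (e 0) (case_nat (e (Suc 0)) (\<lambda>i. e (Suc (Suc (Suc i))))))"
    using Dl_rename[OF Q(1), of "case_nat 0 (case_nat (Suc 0) (\<lambda>i. Suc (Suc (Suc i))))"] by simp
  then have "Dl (\<lambda>e. ?W (e 0) (\<lambda>i. e (Suc i)))" by (intro definable)
  moreover have "(\<exists>a. R a e) \<longleftrightarrow> (\<exists>w. ?W w e)" for e
  proof
    assume "\<exists>a. R a e"
    then obtain a y where "Q y (case_nat a e)" using R by blast
    then have "?W (a + y) e" using le_add_self by blast
    then show "\<exists>w. ?W w e" by blast
  qed (use R in blast)
  ultimately show ?thesis unfolding S1_def by (intro exI[of _ ?W]) blast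
qed

lemmas S1_intros = S1_ex S1_and S1_or

lemma S1_unary:
  assumes "S1 (\<lambda>e. R (e 0))"
  shows "\<exists>Q. Dl (\<lambda>e. Q (e 0) (e 1)) \<and> (\<forall>x. R x \<longleftrightarrow> (\<exists>y. Q y x))"
proof -
  obtain Q where Q: "Dl (\<lambda>e. Q (e 0) (\<lambda>i. e (Suc i)))" "\<And>e. R (e 0) \<longleftrightarrow> (\<exists>y. Q y e)"
    using assms unfolding S1_def by blast
  have 1: "Dl (\<lambda>e. Q (e 0) (\<lambda>_. e 1))"
    using Dl_rename[OF Q(1), of "case_nat 0 (\<lambda>_. 1)"] by simp
  have 2: "R x \<longleftrightarrow> (\<exists>y. Q y (\<lambda>_. x))" for x
    using Q(2)[of "\<lambda>_. x"] by simp
  show ?thesis using 1 2 by (intro exI[of _ "\<lambda>y x. Q y (\<lambda>_. x)"]) blast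
qed

lemma S1_induct:
  assumes "S1 (\<lambda>e. R (e 0))" "R 0" "\<And>x. R x \<Longrightarrow> R (x + 1)"
  shows "R x"
proof -
  obtain Q where Q: "Dl (\<lambda>e. Q (e 0) (e 1))" "\<And>x. R x \<longleftrightarrow> (\<exists>y. Q y x)" 
    using S1_unary[OF assms(1)] by blast
  show ?thesis using induction_Sigma1[OF Q(1), of x] assms(2,3) unfolding Q(2) .
qed

lemma S1_set:
  assumes "S1 (\<lambda>e. R (e 0))" "S1 (\<lambda>e. R' (e 0))" "\<And>x. R' x \<longleftrightarrow> \<not> R x"
  shows "{x. R x} \<in> SS"
proof -
  obtain Q where Q: "Dl (\<lambda>e. Q (e 0) (e 1))" "\<And>x. R x \<longleftrightarrow> (\<exists>y. Q y x)" 
    using S1_unary[OF assms(1)] by blast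
  obtain Q' where Q': "Dl (\<lambda>e. Q' (e 0) (e 1))" "\<And>x. R' x \<longleftrightarrow> (\<exists>y. Q' y x)" 
    using S1_unary[OF assms(2)] by blast
  show ?thesis using comprehension_Delta1[OF Q(1) Q'(1)] assms(3) unfolding Q(2) Q'(2) by blast
qed

subsection \<open>Codes of finite sets\<close>

definition coded :: "mnum \<Rightarrow> mnum \<Rightarrow> mnum set" where
  "coded c d = {x. 1 + (x + 1) * d dvd c}"

lemma Dl_coded [definable]: "Tm s \<Longrightarrow> Tm c \<Longrightarrow> Tm d \<Longrightarrow> Dl (\<lambda>e. s e \<in> coded (c e) (d e))"
  unfolding coded_def mem_Collect_eq by (intro definable)

lemma ex_common_multiple: "\<exists>d>0. \<forall>i\<le>n. 0 < i \<longrightarrow> i dvd (d::mnum)"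
proof (rule S1_induct[where x = n])
  show "S1 (\<lambda>e. \<exists>d>0. \<forall>i\<le>e 0. 0 < i \<longrightarrow> i dvd d)"
    by (intro S1_intros; intro S1_Dl definable)
  show "\<exists>d>0. \<forall>i\<le>0. 0 < i \<longrightarrow> i dvd (d::mnum)" by (intro exI[of _ 1]) auto
  fix n assume "\<exists>d>0. \<forall>i\<le>n. 0 < i \<longrightarrow> i dvd (d::mnum)"
  then obtain d where d: "0 < d" "\<And>i. i \<le> n \<Longrightarrow> 0 < i \<Longrightarrow> i dvd d" by blast
  have "i dvd d * (n + 1)" if "i \<le> n + 1" "0 < i" for i
    using that d(2)[of i] less_Suc_iff[of i n] by (cases "i = n + 1") auto
  moreover have "0 < d * (n + 1)" using d(1) by (simp add: pos_iff Suc_neq_zero_M)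
  ultimately show "\<exists>d>0. \<forall>i\<le>n + 1. 0 < i \<longrightarrow> i dvd d" by blast
qed

text \<open>
  The numbers \<open>1 + (x + 1) d\<close> and \<open>1 + (z + 1) d\<close> are coprime, because suitable multiples
  of them differ by \<open>\<bar>x - z\<bar>\<close>, which divides \<open>d\<close>.
\<close>

lemma coprime_moduli:
  fixes d :: mnum
  assumes xz: "x \<noteq> z" "x \<le> n" "z \<le> n" and d: "\<And>i. i \<le> n \<Longrightarrow> 0 < i \<Longrightarrow> i dvd d"
    and dvd: "1 + (x + 1) * d dvd c * (1 + (z + 1) * d)"
  shows "1 + (x + 1) * d dvd c"
proof -
  let ?a = "1 + (x + 1) * d" and ?b = "1 + (z + 1) * d"
  have "\<exists>i. 0 < i \<and> i \<le> n \<and> ?a dvd c * i"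
  proof (cases "x < z")
    case True
    then obtain i where i: "z = x + i" "0 < i" using le_obtain[OF less_imp_le[OF True]] True by (auto simp: pos_iff)
    have eq: "(z + 1) * ?a = (x + 1) * ?b + i" by (simp add: i(1) algebra_simps)
    have "c * ((z + 1) * ?a) = (x + 1) * (c * ?b) + c * i" unfolding eq by (simp add: algebra_simps)
    moreover have "?a dvd c * ((z + 1) * ?a)" by (simp add: dvd_mult)
    ultimately have "?a dvd c * i" using dvd dvd_add_right_iff[of ?a "(x + 1) * (c * ?b)" "c * i"] by (simp add: dvd_mult)
    moreover have "i \<le> n" using i(1) xz(3) le_add_self(2)[of i x] by (metis order_trans)
    ultimately show ?thesis using i(2) by blast
  next
    case False
    then obtain i where i: "x = z + i" "0 < i" using le_obtain[of z x] xz(1) by (auto simp: pos_iff not_less)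
    have eq: "(x + 1) * ?b = (z + 1) * ?a + i" by (simp add: i(1) algebra_simps)
    have "(x + 1) * (c * ?b) = c * ((x + 1) * ?b)" by (simp add: algebra_simps)
    also have "\<dots> = c * ((z + 1) * ?a) + c * i" unfolding eq by (simp add: algebra_simps)
    finally have "(x + 1) * (c * ?b) = c * ((z + 1) * ?a) + c * i" .
    moreover have "?a dvd c * ((z + 1) * ?a)" by (simp add: dvd_mult)
    moreover have "?a dvd (x + 1) * (c * ?b)" using dvd by (simp add: dvd_mult)
    ultimately have "?a dvd c * i" using dvd_add_right_iff[of ?a "c * ((z + 1) * ?a)" "c * i"] by simp
    moreover have "i \<le> n" using i(1) xz(2) le_add_self(2)[of i z] by (metis order_trans)
    ultimately show ?thesis using i(2) by blast
  qed
  then obtain i where i: "0 < i" "i \<le> n" "?a dvd c * i" by blast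
  \<comment> \<open>As \<open>i\<close> divides \<open>d\<close>, the number
    \<open>c * (x + 1) * d\<close> is a multiple of \<open>c * i\<close>, hence of
    \<open>?a\<close>; and \<open>c * ?a\<close> exceeds it by exactly \<open>c\<close>.\<close>
  then obtain j where j: "d = i * j" using d by (auto simp: dvd_def)
  have "c * ?a = (c * i) * (j * (x + 1)) + c" by (simp add: j algebra_simps)
  moreover have "?a dvd (c * i) * (j * (x + 1))" using i(3) by (rule dvd_mult2)
  moreover have "?a dvd c * ?a" by simp
  ultimately show ?thesis using dvd_add_right_iff[of ?a "(c * i) * (j * (x + 1))" c] by simp
qed

text \<open>The code \<open>c\<close> is the product of the moduli of the elements of
  \<open>A\<close>, collected in an induction on \<open>m\<close> while \<open>n\<close> and
  \<open>d\<close> stay fixed. By \<open>coprime_moduli\<close> a new factor brings in no element up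
  to \<open>n\<close> but its own. The empty product codes the empty set because \<open>d\<close> is
  positive.\<close>

lemma ex_code:
  assumes A: "A \<in> SS"
  shows "\<exists>c d. \<forall>x\<le>n. x \<in> coded c d \<longleftrightarrow> x \<in> A"
proof -
  obtain d where d: "0 < d" "\<And>i. i \<le> n \<Longrightarrow> 0 < i \<Longrightarrow> i dvd d" using ex_common_multiple[of n] by blast
  have "\<exists>c. \<forall>x\<le>n. x \<in> coded c d \<longleftrightarrow> x < m \<and> x \<in> A" for m
  proof (rule S1_induct[where x = m])
    show "S1 (\<lambda>e. \<exists>c. \<forall>x\<le>n. x \<in> coded c d \<longleftrightarrow> x < e 0 \<and> x \<in> A)"
      by (intro S1_ex; intro S1_Dl definable A)
    have "x \<notin> coded 1 d" for x
    proof
      assume "x \<in> coded 1 d"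
      then obtain k where k: "1 = (1 + (x + 1) * d) * k" by (auto simp: coded_def dvd_def)
      have "0 < (x + 1) * d" using d(1) by (simp add: pos_iff Suc_neq_zero_M)
      then have "1 < 1 + (x + 1) * d" by simp
      moreover have "0 < k" using k by (cases "k = 0") (auto simp: pos_iff)
      ultimately have "1 < (1 + (x + 1) * d) * k"
        using le_mult_self[of k "1 + (x + 1) * d"] by (metis less_le_trans mult.commute)
      then show False using k by simp
    qed
    then show "\<exists>c. \<forall>x\<le>n. x \<in> coded c d \<longleftrightarrow> x < 0 \<and> x \<in> A"
      by (intro exI[of _ 1]) (auto simp: leD)
    fix m assume "\<exists>c. \<forall>x\<le>n. x \<in> coded c d \<longleftrightarrow> x < m \<and> x \<in> A"
    then obtain c where c: "\<And>x. x \<le> n \<Longrightarrow> x \<in> coded c d \<longleftrightarrow> x < m \<and> x \<in> A" by blast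
    show "\<exists>c. \<forall>x\<le>n. x \<in> coded c d \<longleftrightarrow> x < m + 1 \<and> x \<in> A"
    proof (cases "m \<in> A \<and> m \<le> n")
      case True
      let ?c = "c * (1 + (m + 1) * d)"
      have "x \<in> coded ?c d \<longleftrightarrow> x < m + 1 \<and> x \<in> A" if x: "x \<le> n" for x
      proof (cases "x = m")
        case True
        then show ?thesis using \<open>m \<in> A \<and> m \<le> n\<close> by (simp add: coded_def less_Suc_M)
      next
        case False
        have "1 + (x + 1) * d dvd ?c \<Longrightarrow> 1 + (x + 1) * d dvd c"
          by (rule coprime_moduli[OF False x _ d(2)]) (use True in auto)
        then have "x \<in> coded ?c d \<longleftrightarrow> x \<in> coded c d"
          unfolding coded_def mem_Collect_eq using dvd_mult2 by blast
        then show ?thesis using c[OF x] False by (simp add: less_Suc_M)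
      qed
      then show ?thesis by blast
    next
      case False
      then have "x \<in> coded c d \<longleftrightarrow> x < m + 1 \<and> x \<in> A" if "x \<le> n" for x
        using c[OF that] that by (auto simp: less_Suc_M)
      then show ?thesis by blast
    qed
  qed
  from this[of "n + 1"] show ?thesis by (auto simp: less_Suc_iff)
qed

subsection \<open>Course-of-values recursion for sets\<close>

text \<open>\<open>good n c d\<close> says that the coded set solves the recursion below
  \<open>n\<close>. Good codes exist by Sigma01 induction, and any two agree wherever both apply. So
  \<open>z\<close> belongs to some code good up to \<open>z\<close> iff no such code omits it, which
  makes the solution Delta01.\<close>

theorem set_recursion:
  assumes local: "\<And>z D D'. (\<And>x. x < z \<Longrightarrow> x \<in> D \<longleftrightarrow> x \<in> D') \<Longrightarrow> \<Theta> z D \<Longrightarrow> \<Theta> z D'"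
    and def: "\<And>i j k. Dl (\<lambda>e. \<Theta> (e i) (coded (e j) (e k)))"
  shows "\<exists>D\<in>SS. \<forall>z. z \<in> D \<longleftrightarrow> \<Theta> z D"
proof -
  define good where "good n c d \<longleftrightarrow> (\<forall>z<n. z \<in> coded c d \<longleftrightarrow> \<Theta> z (coded c d))" for n c d
  have local_iff: "\<Theta> z D \<longleftrightarrow> \<Theta> z D'" if "\<And>x. x < z \<Longrightarrow> x \<in> D \<longleftrightarrow> x \<in> D'" for z D D'
    using local[of z D D'] local[of z D' D] that by blast
  have ex: "\<exists>c d. good n c d" for n
  proof (rule S1_induct[where x = n])
    show "S1 (\<lambda>e. \<exists>c d. good (e 0) c d)"
      unfolding good_def by (intro S1_intros; intro S1_Dl definable def)
    show "\<exists>c d. good 0 c d" unfolding good_def by (simp add: leD)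
    fix n assume "\<exists>c d. good n c d"
    then obtain c d where cd: "good n c d" by blast
    \<comment> \<open>The old approximation below \<open>n\<close> together with the decision at
      \<open>n\<close>. It has to be coded anew, since \<open>c\<close> and \<open>d\<close> may
      contain anything from \<open>n\<close> on.\<close>
    let ?A = "{x. x < n \<and> x \<in> coded c d \<or> x = n \<and> \<Theta> n (coded c d)}"
    have "?A \<in> SS" by (rule Dl_set) (intro definable)
    then obtain c' d' where cd': "\<And>x. x \<le> n \<Longrightarrow> x \<in> coded c' d' \<longleftrightarrow> x \<in> ?A"
      using ex_code[of ?A n] by blast
    have same: "x \<in> coded c d \<longleftrightarrow> x \<in> coded c' d'" if "x < n" for x
      using cd'[of x] that by auto
    have "z \<in> coded c' d' \<longleftrightarrow> \<Theta> z (coded c' d')" if "z < n + 1" for z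
    proof -
      have "\<Theta> z (coded c d) \<longleftrightarrow> \<Theta> z (coded c' d')"
        using that by (intro local_iff same) (auto simp: less_Suc_M)
      then show ?thesis using cd'[of z] cd that by (auto simp: good_def less_Suc_M less_imp_le)
    qed
    then show "\<exists>c d. good (n + 1) c d" unfolding good_def by blast
  qed
  have unique: "z \<in> coded c d \<longleftrightarrow> z \<in> coded c' d'"
    if "good n c d" "good n' c' d'" "z < n" "z < n'" for z n n' c d c' d'
  proof -
    have "z < n \<longrightarrow> z < n' \<longrightarrow> (z \<in> coded c d \<longleftrightarrow> z \<in> coded c' d')"
    proof (rule Dl_less_induct[where x = z], intro definable, intro impI)
      fix z assume IH: "\<And>y. y < z \<Longrightarrow> y < n \<longrightarrow> y < n' \<longrightarrow> (y \<in> coded c d \<longleftrightarrow> y \<in> coded c' d')"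
        and z: "z < n" "z < n'"
      have "\<Theta> z (coded c d) \<longleftrightarrow> \<Theta> z (coded c' d')"
        using IH z by (intro local_iff) (meson less_trans)
      then show "z \<in> coded c d \<longleftrightarrow> z \<in> coded c' d'" using that(1,2) z by (auto simp: good_def)
    qed
    then show ?thesis using that by blast
  qed
  let ?D = "{z. \<exists>c d. good (z + 1) c d \<and> z \<in> coded c d}"
  have D: "z \<in> ?D \<longleftrightarrow> z \<in> coded c d" if "good n c d" "z < n" for z n c d
    using that unique[of "z + 1" _ _ n c d z] ex[of "z + 1"] by (auto simp: less_Suc_M)
  have "?D \<in> SS"
  proof (rule S1_set)
    show "S1 (\<lambda>e. \<exists>c d. good (e 0 + 1) c d \<and> e 0 \<in> coded c d)"
      unfolding good_def by (intro S1_intros; intro S1_Dl definable def)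
    show "S1 (\<lambda>e. \<exists>c d. good (e 0 + 1) c d \<and> e 0 \<notin> coded c d)"
      unfolding good_def by (intro S1_intros; intro S1_Dl definable def)
    show "(\<exists>c d. good (z + 1) c d \<and> z \<notin> coded c d) \<longleftrightarrow> \<not> (\<exists>c d. good (z + 1) c d \<and> z \<in> coded c d)" for z
      using unique[of "z + 1" _ _ "z + 1" _ _ z] ex[of "z + 1"] by (metis less_Suc_M)
  qed
  moreover have "z \<in> ?D \<longleftrightarrow> \<Theta> z ?D" for z
  proof -
    obtain c d where cd: "good (z + 1) c d" using ex by blast
    have "\<Theta> z ?D \<longleftrightarrow> \<Theta> z (coded c d)"
      using D[OF cd] by (intro local_iff) (simp add: less_Suc_M)
    then show ?thesis using D[OF cd, of z] cd by (simp add: less_Suc_M good_def)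
  qed
  ultimately show ?thesis by blast
qed

subsection \<open>Pairs and powers of two\<close>

definition pr :: "mnum \<Rightarrow> mnum \<Rightarrow> mnum" where
  "pr x y = (x + y) * (x + y) + x"

lemma Tm_pr [definable]: "Tm s \<Longrightarrow> Tm t \<Longrightarrow> Tm (\<lambda>e. pr (s e) (t e))"
  unfolding pr_def by (intro definable)

text \<open>With \<open>s = x + y\<close> the code lies between \<open>s * s\<close> and
  \<open>s * s + s\<close>, below the next square, so codes are ordered first by the sum of the
  components.\<close>

lemma pr_less:
  assumes "x + y < x' + y'"
  shows "pr x y < pr x' y'"
proof -
  let ?s = "x + y" and ?s' = "x' + y'"
  have square: "s * s + s < (s + 1) * (s + 1)" for s :: mnum
    by (simp add: distrib_left distrib_right less_Suc_iff add.assoc[symmetric])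
  have "pr x y \<le> ?s * ?s + ?s" unfolding pr_def by simp
  also have "\<dots> < (?s + 1) * (?s + 1)" by (rule square)
  also have "\<dots> \<le> ?s' * ?s'" using assms by (intro mult_mono) (simp_all add: Suc_le_iff)
  also have "\<dots> \<le> pr x' y'" unfolding pr_def by simp
  finally show ?thesis .
qed

lemma pr_inject [simp]: "pr x y = pr x' y' \<longleftrightarrow> x = x' \<and> y = y'"
proof
  assume eq: "pr x y = pr x' y'"
  then have s: "x + y = x' + y'" using pr_less by (metis less_irrefl linorder_neqE)
  then have "x = x'" using eq by (simp add: pr_def)
  then show "x = x' \<and> y = y'" using s by simp
qed simp

lemma fst_le_pr: "x \<le> pr x y"
  unfolding pr_def by simp

lemma snd_le_pr: "y \<le> pr x y"
proof (cases "x + y = 0")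
  case True
  then have "y = 0" using le_add_self(2)[of y x] by (metis antisym zero_le_M)
  then show ?thesis by simp
next
  case False
  have "y \<le> x + y" by simp
  also have "\<dots> \<le> (x + y) * (x + y)" using False le_mult_self pos_iff by blast
  also have "\<dots> \<le> pr x y" unfolding pr_def by simp
  finally show ?thesis .
qed

text \<open>A recursion on codes of pairs: each step of the graph leads to a larger code, and the
  components of a pair are bounded by its code.\<close>

lemma ex_exp_graph:
  "\<exists>D\<in>SS. \<forall>z. z \<in> D \<longleftrightarrow> z = pr 0 1 \<or> (\<exists>n\<le>z. \<exists>y\<le>z. z = pr (n + 1) (2 * y) \<and> pr n y \<in> D)"
proof (rule set_recursion)
  fix z D D'
  assume same: "\<And>x. x < z \<Longrightarrow> x \<in> D \<longleftrightarrow> x \<in> D'"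
    and z: "z = pr 0 1 \<or> (\<exists>n\<le>z. \<exists>y\<le>z. z = pr (n + 1) (2 * y) \<and> pr n y \<in> D)"
  have "pr n y < pr (n + 1) (2 * y)" for n y
  proof (rule pr_less)
    have "n + y \<le> n + 2 * y" by (simp add: mult_2 add.assoc[symmetric])
    also have "\<dots> < n + 1 + 2 * y" by simp
    finally show "n + y < n + 1 + 2 * y" .
  qed
  then show "z = pr 0 1 \<or> (\<exists>n\<le>z. \<exists>y\<le>z. z = pr (n + 1) (2 * y) \<and> pr n y \<in> D')"
    using z same by metis
next
  show "Dl (\<lambda>e. e i = pr 0 1 \<or> (\<exists>n\<le>e i. \<exists>y\<le>e i. e i = pr (n + 1) (2 * y) \<and> pr n y \<in> coded (e j) (e k)))" for i j k
    by (intro definable)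
qed

definition exp_graph :: "mnum set" where
  "exp_graph = (SOME D. D \<in> SS \<and>
    (\<forall>z. z \<in> D \<longleftrightarrow> z = pr 0 1 \<or> (\<exists>n\<le>z. \<exists>y\<le>z. z = pr (n + 1) (2 * y) \<and> pr n y \<in> D)))"

lemma exp_graph_SS [definable]: "exp_graph \<in> SS"
  and exp_graph_iff: "z \<in> exp_graph \<longleftrightarrow>
    z = pr 0 1 \<or> (\<exists>n\<le>z. \<exists>y\<le>z. z = pr (n + 1) (2 * y) \<and> pr n y \<in> exp_graph)"
proof -
  have "\<exists>D. D \<in> SS \<and>
    (\<forall>z. z \<in> D \<longleftrightarrow> z = pr 0 1 \<or> (\<exists>n\<le>z. \<exists>y\<le>z. z = pr (n + 1) (2 * y) \<and> pr n y \<in> D))"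
    using ex_exp_graph by (simp add: Bex_def)
  from someI_ex[OF this, folded exp_graph_def]
  show "exp_graph \<in> SS" "z \<in> exp_graph \<longleftrightarrow>
    z = pr 0 1 \<or> (\<exists>n\<le>z. \<exists>y\<le>z. z = pr (n + 1) (2 * y) \<and> pr n y \<in> exp_graph)" by blast+
qed

lemma exp_graph_0: "pr 0 y \<in> exp_graph \<longleftrightarrow> y = 1"
  using exp_graph_iff[of "pr 0 y"] by (auto simp: Suc_neq_zero_M[symmetric])

lemma exp_graph_Suc: "pr (n + 1) y \<in> exp_graph \<longleftrightarrow> (\<exists>w. y = 2 * w \<and> pr n w \<in> exp_graph)"
proof
  assume "pr (n + 1) y \<in> exp_graph"
  then show "\<exists>w. y = 2 * w \<and> pr n w \<in> exp_graph"
    using exp_graph_iff[of "pr (n + 1) y"] by (auto simp: Suc_neq_zero_M)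
next
  assume "\<exists>w. y = 2 * w \<and> pr n w \<in> exp_graph"
  then obtain w where w: "y = 2 * w" "pr n w \<in> exp_graph" by blast
  have "n \<le> n + 1" "w \<le> 2 * w" by (simp_all add: mult_2)
  then have "n \<le> pr (n + 1) (2 * w)" "w \<le> pr (n + 1) (2 * w)"
    using fst_le_pr snd_le_pr order_trans by blast+
  then show "pr (n + 1) y \<in> exp_graph" using exp_graph_iff[of "pr (n + 1) y"] w by blast
qed

lemma exp_graph_total: "\<exists>y. pr n y \<in> exp_graph"
proof (rule S1_induct[where x = n])
  show "S1 (\<lambda>e. \<exists>y. pr (e 0) y \<in> exp_graph)" by (intro S1_ex; intro S1_Dl definable)
qed (auto simp: exp_graph_0 exp_graph_Suc)

lemma exp_graph_unique:
  assumes "pr n y \<in> exp_graph" "pr n y' \<in> exp_graph"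
  shows "y = y'"
proof -
  \<comment> \<open>Bounding both values makes the induction statement Sigma00. The bound survives
    the step because the values at \<open>n\<close> are half of those at
    \<open>n + 1\<close>.\<close>
  define b where "b = y + y'"
  have "\<forall>u\<le>b. \<forall>v\<le>b. pr n u \<in> exp_graph \<longrightarrow> pr n v \<in> exp_graph \<longrightarrow> u = v"
  proof (rule Dl_induct[where x = n])
    show "Dl (\<lambda>e. \<forall>u\<le>b. \<forall>v\<le>b. pr (e 0) u \<in> exp_graph \<longrightarrow> pr (e 0) v \<in> exp_graph \<longrightarrow> u = v)"
      by (intro definable)
    show "\<forall>u\<le>b. \<forall>v\<le>b. pr 0 u \<in> exp_graph \<longrightarrow> pr 0 v \<in> exp_graph \<longrightarrow> u = v" by (simp add: exp_graph_0)
    fix n assume IH: "\<forall>u\<le>b. \<forall>v\<le>b. pr n u \<in> exp_graph \<longrightarrow> pr n v \<in> exp_graph \<longrightarrow> u = v"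
    have "w \<le> b" if "2 * w \<le> b" for w
      using that le_add_self(1)[of w w] by (metis mult_2 order_trans)
    then show "\<forall>u\<le>b. \<forall>v\<le>b. pr (n + 1) u \<in> exp_graph \<longrightarrow> pr (n + 1) v \<in> exp_graph \<longrightarrow> u = v"
      using IH by (auto simp: exp_graph_Suc)
  qed
  moreover have "y \<le> b" "y' \<le> b" by (simp_all add: b_def)
  ultimately show ?thesis using assms by blast
qed

definition ex2 :: "mnum \<Rightarrow> mnum" where "ex2 n = (THE y. pr n y \<in> exp_graph)"

lemma exp_graph_ex2: "pr n y \<in> exp_graph \<longleftrightarrow> y = ex2 n"
  unfolding ex2_def using exp_graph_total[of n] exp_graph_unique by (metis theI)

lemma ex2_0 [simp]: "ex2 0 = 1"
  using exp_graph_0 exp_graph_ex2 by metis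

lemma ex2_Suc [simp]: "ex2 (n + 1) = 2 * ex2 n"
  using exp_graph_Suc exp_graph_ex2 by metis

text \<open>\<open>ex2\<close> is not a term of the language, so this and the following inductions
  are run on a Sigma01 statement about a value in \<open>exp_graph\<close>.\<close>

lemma ex2_pos: "0 < ex2 n"
proof -
  have "\<exists>y. pr n y \<in> exp_graph \<and> 0 < y"
  proof (rule S1_induct[where x = n])
    show "S1 (\<lambda>e. \<exists>y. pr (e 0) y \<in> exp_graph \<and> 0 < y)" by (intro S1_intros; intro S1_Dl definable)
  qed (auto simp: exp_graph_ex2)
  then show ?thesis by (simp add: exp_graph_ex2)
qed

lemma ex2_add: "ex2 (m + n) = ex2 m * ex2 n"
proof -
  have "\<exists>y w. pr (m + n) y \<in> exp_graph \<and> pr n w \<in> exp_graph \<and> y = ex2 m * w"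
  proof (rule S1_induct[where x = n])
    show "S1 (\<lambda>e. \<exists>y w. pr (m + e 0) y \<in> exp_graph \<and> pr (e 0) w \<in> exp_graph \<and> y = ex2 m * w)"
      by (intro S1_intros; intro S1_Dl definable)
  qed (auto simp: exp_graph_ex2 add.assoc[symmetric] mult.left_commute)
  then show ?thesis by (simp add: exp_graph_ex2)
qed

lemma ex2_less: "n < ex2 n"
proof -
  have "\<exists>y. pr n y \<in> exp_graph \<and> n + 1 \<le> y"
  proof (rule S1_induct[where x = n])
    show "S1 (\<lambda>e. \<exists>y. pr (e 0) y \<in> exp_graph \<and> e 0 + 1 \<le> y)" by (intro S1_intros; intro S1_Dl definable)
    show "\<exists>y. pr 0 y \<in> exp_graph \<and> 0 + 1 \<le> y" by (simp add: exp_graph_ex2)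
    fix n assume "\<exists>y. pr n y \<in> exp_graph \<and> n + 1 \<le> y"
    then have "n + 1 \<le> ex2 n" by (simp add: exp_graph_ex2)
    moreover have "1 \<le> ex2 n" using ex2_pos[of n] Suc_le_iff[of 0] by simp
    ultimately have "n + 1 + 1 \<le> ex2 n + ex2 n" by (rule add_mono)
    then show "\<exists>y. pr (n + 1) y \<in> exp_graph \<and> n + 1 + 1 \<le> y" by (simp add: exp_graph_ex2 mult_2)
  qed
  then show ?thesis by (simp add: exp_graph_ex2 Suc_le_iff)
qed

lemma ex2_dvd: "m \<le> n \<Longrightarrow> ex2 m dvd ex2 n"
  using le_obtain ex2_add by (metis dvd_triv_left)

lemma ex2_mono: "m \<le> n \<Longrightarrow> ex2 m \<le> ex2 n"
  using le_obtain[of m n] ex2_add le_mult_self ex2_pos by (metis mult.commute)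

lemma ex2_strict_mono: "m < n \<Longrightarrow> ex2 m < ex2 n"
proof -
  assume "m < n"
  then have "ex2 (m + 1) \<le> ex2 n" by (intro ex2_mono) (simp add: Suc_le_iff)
  moreover have "ex2 m < ex2 (m + 1)" using ex2_pos[of m] by (simp add: mult_2)
  ultimately show ?thesis by simp
qed

lemma ex2_less_iff [simp]: "ex2 m < ex2 n \<longleftrightarrow> m < n"
  using ex2_strict_mono ex2_mono by (meson leD not_le_imp_less)

subsection \<open>Binary expansions\<close>

definition bit2 :: "mnum \<Rightarrow> mnum \<Rightarrow> bool" where
  "bit2 d m \<longleftrightarrow> (\<exists>q r. r < ex2 d \<and> m = q * (2 * ex2 d) + ex2 d + r)"

definition lam2 :: "mnum \<Rightarrow> mnum \<Rightarrow> bool" where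
  "lam2 m a \<longleftrightarrow> bit2 a m \<and> (\<forall>d. bit2 d m \<longrightarrow> a \<le> d)"

definition mu2 :: "mnum \<Rightarrow> mnum \<Rightarrow> bool" where
  "mu2 m a \<longleftrightarrow> bit2 a m \<and> (\<forall>d. bit2 d m \<longrightarrow> d \<le> a)"

lemma bit2_imp_le: "bit2 d m \<Longrightarrow> ex2 d \<le> m"
  unfolding bit2_def by (metis add.commute le_add_self(1) add.assoc)

lemma bit2_imp_less: "bit2 d m \<Longrightarrow> d < m"
  using bit2_imp_le ex2_less less_le_trans by blast

text \<open>Substitution of terms is simulated by variables that are bounded by the terms and
  required to equal them; only renaming of indices is then needed.\<close>

lemma Dl_subst2:
  assumes R: "Dl (\<lambda>e. R (e 0) (e 1))" and "Tm s" "Tm t"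
  shows "Dl (\<lambda>e. R (s e) (t e))"
proof -
  have "Dl (\<lambda>e. R (e (Suc 0)) (e 0))" using Dl_rename[OF R, of "case_nat 1 (\<lambda>_. 0)"] by simp
  then have "Dl (\<lambda>e. \<exists>a\<le>s e. \<exists>b\<le>t e. a = s e \<and> b = t e \<and> R a b)"
    by (intro definable assms(2) Tm_rename[OF assms(3), of Suc] Tm_rename[OF assms(2), of "\<lambda>i. Suc (Suc i)"]
        Tm_rename[OF assms(3), of "\<lambda>i. Suc (Suc i)"])
  then show ?thesis by simp
qed

text \<open>The power, the quotient and the remainder are all at most \<open>m\<close>, so all three
  can be quantified below it.\<close>

lemma Dl_bit2 [definable]: "Tm s \<Longrightarrow> Tm t \<Longrightarrow> Dl (\<lambda>e. bit2 (s e) (t e))"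
proof (rule Dl_subst2)
  have "bit2 d m \<longleftrightarrow> (\<exists>p\<le>m. \<exists>q\<le>m. \<exists>r\<le>m. pr d p \<in> exp_graph \<and> r < p \<and> m = q * (2 * p) + p + r)" for d m
  proof
    assume b: "bit2 d m"
    then obtain q r where qr: "r < ex2 d" "m = q * (2 * ex2 d) + ex2 d + r" by (auto simp: bit2_def)
    have "q \<le> q * (2 * ex2 d)" using le_mult_self[of "2 * ex2 d" q] ex2_pos by (simp add: mult.commute)
    also have "\<dots> \<le> m" using qr(2) by (simp add: add.assoc)
    finally have "q \<le> m" .
    moreover have "r \<le> m" using qr(2) by simp
    ultimately show "\<exists>p\<le>m. \<exists>q\<le>m. \<exists>r\<le>m. pr d p \<in> exp_graph \<and> r < p \<and> m = q * (2 * p) + p + r"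
      using qr bit2_imp_le[OF b] exp_graph_ex2 by blast
  qed (auto simp: bit2_def exp_graph_ex2)
  then show "Dl (\<lambda>e. bit2 (e 0) (e 1))" by (simp only:) (intro definable)
qed

lemma Dl_lam2 [definable]: "Tm s \<Longrightarrow> Tm t \<Longrightarrow> Dl (\<lambda>e. lam2 (s e) (t e))"
proof (rule Dl_subst2)
  have "lam2 m a \<longleftrightarrow> bit2 a m \<and> (\<forall>d\<le>m. bit2 d m \<longrightarrow> a \<le> d)" for m a
    using bit2_imp_less less_imp_le unfolding lam2_def by blast
  then show "Dl (\<lambda>e. lam2 (e 0) (e 1))" by (simp only:) (intro definable)
qed

lemma Dl_mu2 [definable]: "Tm s \<Longrightarrow> Tm t \<Longrightarrow> Dl (\<lambda>e. mu2 (s e) (t e))"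
proof (rule Dl_subst2)
  have "mu2 m a \<longleftrightarrow> bit2 a m \<and> (\<forall>d\<le>m. bit2 d m \<longrightarrow> d \<le> a)" for m a
    using bit2_imp_less less_imp_le unfolding mu2_def by blast
  then show "Dl (\<lambda>e. mu2 (e 0) (e 1))" by (simp only:) (intro definable)
qed

lemma lam2_unique: "lam2 m a \<Longrightarrow> lam2 m b \<Longrightarrow> a = b"
  unfolding lam2_def by (metis antisym)

lemma mu2_unique: "mu2 m a \<Longrightarrow> mu2 m b \<Longrightarrow> a = b"
  unfolding mu2_def by (metis antisym)

lemma mu2I: "ex2 a \<le> m \<Longrightarrow> m < ex2 (a + 1) \<Longrightarrow> mu2 m a"
proof -
  assume m: "ex2 a \<le> m" "m < ex2 (a + 1)"
  obtain r where r: "m = ex2 a + r" using m(1) le_obtain by blast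
  then have "r < ex2 a" using m(2) by (simp add: mult_2)
  then have "bit2 a m" unfolding bit2_def using r by (intro exI[of _ 0] exI[of _ r]) simp
  moreover have "d \<le> a" if "bit2 d m" for d
    using le_less_trans[OF bit2_imp_le[OF that] m(2)] by (simp only: ex2_less_iff less_Suc_iff)
  ultimately show ?thesis by (simp add: mu2_def)
qed

text \<open>The exponent is the predecessor of the least number whose power exceeds
  \<open>m\<close>. That number is not 0, since \<open>ex2 0 \<le> m\<close>.\<close>

lemma mu2_ex: "0 < m \<Longrightarrow> \<exists>a. ex2 a \<le> m \<and> m < ex2 (a + 1)"
proof -
  assume m: "0 < m"
  have le: "ex2 a \<le> m \<longleftrightarrow> (\<exists>p\<le>m. pr a p \<in> exp_graph)" for a by (auto simp: exp_graph_ex2)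
  have "Dl (\<lambda>e. \<not> ex2 (e 0) \<le> m)" unfolding le by (intro definable)
  moreover have "\<not> ex2 m \<le> m" using ex2_less[of m] by simp
  ultimately obtain a where a: "\<not> ex2 a \<le> m" "\<forall>b<a. ex2 b \<le> m"
    using Dl_least[of "\<lambda>a. \<not> ex2 a \<le> m" m] by blast
  have "a \<noteq> 0" using a(1) m Suc_le_iff[of 0 m] by auto
  then obtain w where "a = w + 1" using zero_or_Suc_M by blast
  then show ?thesis using a by (intro exI[of _ w]) (auto simp: less_Suc_M)
qed

lemma mu2_iff: "mu2 m a \<longleftrightarrow> ex2 a \<le> m \<and> m < ex2 (a + 1)"
proof
  assume a: "mu2 m a"
  then have "ex2 a \<le> m" using bit2_imp_le by (auto simp: mu2_def)
  then have "0 < m" using ex2_pos[of a] by (metis less_le_trans)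
  then show "ex2 a \<le> m \<and> m < ex2 (a + 1)" using mu2_ex mu2I mu2_unique a by blast
qed (auto intro: mu2I)

lemma mu2_total: "0 < m \<Longrightarrow> \<exists>a. mu2 m a"
  using mu2_ex mu2I by blast

lemma lam2_total: "0 < m \<Longrightarrow> \<exists>a. lam2 m a"
proof -
  assume "0 < m"
  then obtain u where u: "bit2 u m" using mu2_total by (auto simp: mu2_def)
  have "Dl (\<lambda>e. bit2 (e 0) m)" by (intro definable)
  from Dl_least[OF this u] show ?thesis unfolding lam2_def by (meson not_le_imp_less)
qed

lemma even_or_odd: "\<exists>q. k = 2 * q \<or> k = 2 * q + (1::mnum)"
proof (rule S1_induct[where x = k])
  show "S1 (\<lambda>e. \<exists>q. e 0 = 2 * q \<or> e 0 = 2 * q + 1)" by (intro S1_intros; intro S1_Dl definable)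
  show "\<exists>q. 0 = 2 * q \<or> 0 = 2 * q + (1::mnum)" by (intro exI[of _ 0]) simp
  fix x assume "\<exists>q. x = 2 * q \<or> x = 2 * q + (1::mnum)"
  then obtain q where "x = 2 * q \<or> x = 2 * q + 1" by blast
  then have "x + 1 = 2 * q + 1 \<or> x + 1 = 2 * (q + 1)" by (auto simp: distrib_left add.assoc)
  then show "\<exists>q. x + 1 = 2 * q \<or> x + 1 = 2 * q + (1::mnum)" by blast
qed

text \<open>Induction on \<open>b\<close> up to \<open>a\<close>: if the quotient of
  \<open>m\<close> by \<open>ex2 b\<close> were odd for some \<open>b < a\<close>, then
  \<open>b\<close> would be an exponent of \<open>m\<close> smaller than the least one.\<close>

lemma lam2_dvd: "lam2 m a \<Longrightarrow> ex2 a dvd m"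
proof -
  assume a: "lam2 m a"
  have "\<exists>p. pr b p \<in> exp_graph \<and> (b \<le> a \<longrightarrow> p dvd m)" for b
  proof (rule S1_induct[where x = b])
    show "S1 (\<lambda>e. \<exists>p. pr (e 0) p \<in> exp_graph \<and> (e 0 \<le> a \<longrightarrow> p dvd m))"
      by (intro S1_intros; intro S1_Dl definable)
    fix b assume "\<exists>p. pr b p \<in> exp_graph \<and> (b \<le> a \<longrightarrow> p dvd m)"
    then have IH: "b \<le> a \<longrightarrow> ex2 b dvd m" by (simp add: exp_graph_ex2)
    have "2 * ex2 b dvd m" if less: "b < a"
    proof -
      obtain k where k: "m = ex2 b * k" using IH less_imp_le[OF less] by (auto simp: dvd_def)
      obtain q where "k = 2 * q \<or> k = 2 * q + 1" using even_or_odd by blast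
      then show ?thesis
      proof
        assume "k = 2 * q + 1"
        then have "m = q * (2 * ex2 b) + ex2 b + 0" using k by (simp add: algebra_simps)
        then have "bit2 b m" unfolding bit2_def using ex2_pos by blast
        then show ?thesis using a that by (auto simp: lam2_def)
      qed (use k in \<open>simp add: algebra_simps\<close>)
    qed
    then show "\<exists>p. pr (b + 1) p \<in> exp_graph \<and> (b + 1 \<le> a \<longrightarrow> p dvd m)"
      by (simp add: exp_graph_ex2 Suc_le_iff)
  qed (simp add: exp_graph_ex2)
  from this[of a] show ?thesis by (simp add: exp_graph_ex2)
qed

text \<open>Adding a multiple of \<open>ex2 (d + 1)\<close> changes only the quotient
  \<open>q\<close> in \<open>bit2\<close>.\<close>

lemma bit2_add:
  assumes "ex2 (d + 1) dvd y"
  shows "bit2 d (x + y) \<longleftrightarrow> bit2 d x"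
proof -
  obtain k where k: "y = k * (2 * ex2 d)" using assms[unfolded ex2_Suc] by (auto simp: dvd_def mult.commute)
  show ?thesis
  proof
    assume "bit2 d x"
    then obtain q r where "r < ex2 d" "x = q * (2 * ex2 d) + ex2 d + r" by (auto simp: bit2_def)
    then show "bit2 d (x + y)"
      unfolding bit2_def k by (intro exI[of _ "q + k"] exI[of _ r]) (simp add: algebra_simps)
  next
    assume "bit2 d (x + y)"
    then obtain q r where qr: "r < ex2 d" "x + y = q * (2 * ex2 d) + ex2 d + r" by (auto simp: bit2_def)
    \<comment> \<open>Otherwise \<open>y\<close> alone would reach
      \<open>(q + 1) * (2 * ex2 d)\<close>, which is larger than \<open>x + y\<close>.\<close>
    have "k \<le> q"
    proof (rule ccontr)
      assume "\<not> k \<le> q"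
      then have "q + 1 \<le> k" by (simp add: Suc_le_iff)
      then have "(q + 1) * (2 * ex2 d) \<le> y" unfolding k by (rule mult_right_mono) simp
      also have "\<dots> \<le> x + y" by simp
      also have "\<dots> < (q + 1) * (2 * ex2 d)" using qr by (simp add: distrib_right mult_2 add.assoc)
      finally show False by simp
    qed
    then obtain j where "q = k + j" using le_obtain by blast
    then have "x = j * (2 * ex2 d) + ex2 d + r" using qr(2) unfolding k
      by (simp add: distrib_right add.assoc add.left_commute[of _ "k * (2 * ex2 d)"] add.commute[of x])
    then show "bit2 d x" unfolding bit2_def using qr(1) by blast
  qed
qed

lemma lam2_ex2: "lam2 (ex2 x) x"
  unfolding lam2_def
proof (intro conjI allI impI)
  show "bit2 x (ex2 x)" using mu2I[of x "ex2 x"] ex2_less_iff[of x "x + 1"] less_Suc_M by (simp add: mu2_def)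
  fix d assume d: "bit2 d (ex2 x)"
  show "x \<le> d"
  proof (rule ccontr)
    assume "\<not> x \<le> d"
    then have "ex2 (d + 1) dvd ex2 x" by (intro ex2_dvd) (simp add: Suc_le_iff)
    then have "bit2 d 0" using bit2_add[of d "ex2 x" 0] d by simp
    then show False using bit2_imp_less zero_le_M by (meson leD)
  qed
qed

lemma mu2_ex2: "mu2 (ex2 x) x"
  by (rule mu2I) (use ex2_less_iff[of x "x + 1"] less_Suc_M in auto)

text \<open>Below \<open>b\<close> the exponents of \<open>x + y\<close> are those of
  \<open>x\<close>, because \<open>ex2 b\<close> divides \<open>y\<close>; and \<open>a\<close> lies
  below \<open>b\<close>.\<close>

lemma lam2_add:
  assumes "lam2 x a" "mu2 x u" "lam2 y b" "u < b"
  shows "lam2 (x + y) a"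
proof -
  have "a \<le> u" using assms(1,2) by (auto simp: lam2_def mu2_def)
  have bits: "bit2 d (x + y) \<longleftrightarrow> bit2 d x" if "d < b" for d
    using that lam2_dvd[OF assms(3)] ex2_dvd[of "d + 1" b]
    by (intro bit2_add) (metis Suc_le_iff dvd_trans)
  show ?thesis
    unfolding lam2_def
  proof (intro conjI allI impI)
    show "bit2 a (x + y)" using bits[of a] assms(1,4) \<open>a \<le> u\<close> by (auto simp: lam2_def)
    fix d assume d: "bit2 d (x + y)"
    show "a \<le> d"
    proof (cases "d < b")
      case True
      then show ?thesis using bits d assms(1) by (auto simp: lam2_def)
    next
      case False
      then show ?thesis using \<open>a \<le> u\<close> assms(4) by simp
    qed
  qed
qed

text \<open>Both \<open>y\<close> and \<open>ex2 (v + 1)\<close> are multiples of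
  \<open>ex2 b\<close>, and \<open>x\<close> is smaller than \<open>ex2 b\<close>, so adding it to
  \<open>y\<close> cannot reach \<open>ex2 (v + 1)\<close>.\<close>

lemma mu2_add:
  assumes "mu2 x u" "lam2 y b" "u < b" "mu2 y v"
  shows "mu2 (x + y) v"
proof (rule mu2I)
  have y: "ex2 v \<le> y" "y < ex2 (v + 1)" using assms(4) by (auto simp: mu2_iff)
  show "ex2 v \<le> x + y" using y(1) le_add_self(2)[of y x] by (rule order_trans)
  have "b \<le> v" using assms(2,4) by (auto simp: lam2_def mu2_def)
  then obtain j where j: "ex2 (v + 1) = ex2 b * j" using ex2_dvd[of b "v + 1"] by (auto simp: dvd_def less_imp_le less_Suc_iff)
  obtain k where k: "y = ex2 b * k" using lam2_dvd[OF assms(2)] by (auto simp: dvd_def)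
  have "k < j" using y(2) unfolding j k by (metis mult_left_mono not_less zero_le_M)
  have "x < ex2 (u + 1)" using assms(1) by (auto simp: mu2_iff)
  also have "\<dots> \<le> ex2 b" using assms(3) by (intro ex2_mono) (simp add: Suc_le_iff)
  finally have "x + y < ex2 b + ex2 b * k" unfolding k by simp
  also have "\<dots> = ex2 b * (k + 1)" by (simp add: algebra_simps)
  also have "\<dots> \<le> ex2 b * j" using \<open>k < j\<close> by (intro mult_left_mono) (simp_all add: Suc_le_iff)
  finally show "x + y < ex2 (v + 1)" by (simp only: j)
qed

subsection \<open>Unbounded sets\<close>

definition unbounded :: "mnum set \<Rightarrow> bool" where
  "unbounded H \<longleftrightarrow> (\<forall>n. \<exists>x>n. x \<in> H)"

lemma next_element:
  assumes "H \<in> SS" "unbounded H"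
  shows "\<exists>x>n. x \<in> H \<and> (\<forall>y. n < y \<longrightarrow> y < x \<longrightarrow> y \<notin> H)"
proof -
  obtain x where "n < x \<and> x \<in> H" using assms(2) by (auto simp: unbounded_def)
  moreover have "Dl (\<lambda>e. n < e 0 \<and> e 0 \<in> H)" by (intro definable assms(1))
  ultimately show ?thesis using Dl_least[of "\<lambda>x. n < x \<and> x \<in> H" x] by blast
qed

lemma split_unbounded:
  assumes H: "H \<in> SS" "unbounded H"
  shows "\<exists>D\<in>SS. D \<subseteq> H \<and> unbounded D \<and> unbounded (H - D)"
proof -
  have "\<exists>D\<in>SS. \<forall>z. z \<in> D \<longleftrightarrow> z \<in> H \<and> \<not> (\<exists>u<z. u \<in> D \<and> (\<forall>v<z. u < v \<longrightarrow> v \<notin> H))"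
    by (rule set_recursion) (blast, intro definable H(1))
  then obtain D where D: "D \<in> SS"
    and mem: "\<And>z. z \<in> D \<longleftrightarrow> z \<in> H \<and> \<not> (\<exists>u<z. u \<in> D \<and> (\<forall>v<z. u < v \<longrightarrow> v \<notin> H))" by blast
  have "(\<exists>x>n. x \<in> D) \<and> (\<exists>x>n. x \<in> H - D)" for n
  proof -
    obtain x where x: "n < x" "x \<in> H" using H(2) by (auto simp: unbounded_def)
    obtain y where y: "x < y" "y \<in> H" "\<And>v. x < v \<Longrightarrow> v < y \<Longrightarrow> v \<notin> H" using next_element[OF H] by blast
    have "n < y" using x(1) y(1) by simp
    have "y \<in> D \<longleftrightarrow> x \<notin> D"
    proof
      assume "y \<in> D"
      then show "x \<notin> D" using mem[of y] y by blast
    next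
      assume "x \<notin> D"
      have False if "u < y" "u \<in> D" "\<forall>v<y. u < v \<longrightarrow> v \<notin> H" for u
      proof -
        have "u \<in> H" using that(2) mem by blast
        then show False using that \<open>x \<notin> D\<close> x(2) y by (metis linorder_neqE)
      qed
      then show "y \<in> D" using mem[of y] y(2) by blast
    qed
    then show ?thesis using x y \<open>n < y\<close> by blast
  qed
  then show ?thesis using D mem unfolding unbounded_def by blast
qed

lemma disjoint_refinement:
  assumes H: "H1 \<in> SS" "unbounded H1" "H2 \<in> SS" "unbounded H2"
  shows "\<exists>A\<in>SS. \<exists>B\<in>SS. A \<subseteq> H1 \<and> B \<subseteq> H2 \<and> A \<inter> B = {} \<and> unbounded A \<and> unbounded B"
proof -
  have diff: "X - Y \<in> SS" if "X \<in> SS" "Y \<in> SS" for X Y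
    using Dl_set[of "\<lambda>x. x \<in> X \<and> x \<notin> Y"] that by (simp add: set_diff_eq Dl_and Dl_mem Dl_not Tm_var)
  show ?thesis
  proof (cases "unbounded (H1 - H2) \<or> unbounded (H2 - H1)")
    case True
    then show ?thesis
    proof
      assume "unbounded (H1 - H2)"
      then show ?thesis using H diff[of H1 H2] by (intro bexI[of _ "H1 - H2"] bexI[of _ H2]) auto
    next
      assume "unbounded (H2 - H1)"
      then show ?thesis using H diff[of H2 H1] by (intro bexI[of _ H1] bexI[of _ "H2 - H1"]) auto
    qed
  next
    case False
    then obtain n where n: "\<And>x. n < x \<Longrightarrow> x \<notin> H1 - H2" by (auto simp: unbounded_def)
    \<comment> \<open>This is the intersection, written with differences so that \<open>diff\<close>
      applies. It is unbounded because \<open>H1 - H2\<close> is bounded.\<close>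
    have inter: "H1 - (H1 - H2) \<in> SS" using H diff by blast
    have "unbounded (H1 - (H1 - H2))"
      unfolding unbounded_def
    proof
      fix k
      obtain x where x: "k + n < x" "x \<in> H1" using H(2) by (auto simp: unbounded_def)
      then have "k < x" "n < x" using le_add_self order.strict_trans1 by blast+
      then show "\<exists>x>k. x \<in> H1 - (H1 - H2)" using n x(2) by blast
    qed
    then obtain D where "D \<in> SS" "D \<subseteq> H1 - (H1 - H2)" "unbounded D" "unbounded (H1 - (H1 - H2) - D)"
      using split_unbounded[OF inter] by blast
    then show ?thesis using diff[OF inter]
      by (intro bexI[of _ D] bexI[of _ "H1 - (H1 - H2) - D"]) auto
  qed
qed

section \<open>The two principles in the model\<close>

lemma eval_pair [simp]: "eval_tm mpar e (pair s t) = pr (eval_tm mpar e s) (eval_tm mpar e t)"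
  by (simp add: pair_def pr_def)

definition is_fun_M :: "mnum set \<Rightarrow> bool" where
  "is_fun_M G \<longleftrightarrow> (\<forall>z\<in>G. \<exists>n y. z = pr n y) \<and> (\<forall>n. \<exists>y. pr n y \<in> G \<and> (\<forall>y'. pr n y' \<in> G \<longrightarrow> y' = y))"

lemma sat_is_function: "satM (is_function (SV X)) e E \<longleftrightarrow> is_fun_M (E X)"
  unfolding is_function_def is_fun_M_def Let_def sat.simps eval_tm.simps eval_pair eval_st.simps
  by (simp add: Ball_def)

text \<open>Shows that the existential set quantifier in \<open>exp2_eq\<close> has the intended
  meaning: every witness contains the true powers by Sigma01 induction with \<open>G\<close> as a
  parameter, and, being a function, nothing else.\<close>

lemma exp_graph_characterization:
  assumes G: "G \<in> SS" "is_fun_M G" "pr 0 1 \<in> G" "\<And>n y. pr n y \<in> G \<Longrightarrow> pr (n + 1) (2 * y) \<in> G"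
  shows "pr n y \<in> G \<longleftrightarrow> y = ex2 n"
proof -
  have "\<exists>y. pr n y \<in> exp_graph \<and> pr n y \<in> G"
  proof (rule S1_induct[where x = n])
    show "S1 (\<lambda>e. \<exists>y. pr (e 0) y \<in> exp_graph \<and> pr (e 0) y \<in> G)"
      by (intro S1_intros; intro S1_Dl definable G(1))
  qed (use G(3,4) in \<open>auto simp: exp_graph_ex2\<close>)
  then have "pr n (ex2 n) \<in> G" by (auto simp: exp_graph_ex2)
  then show ?thesis using G(2) unfolding is_fun_M_def by metis
qed

lemma is_fun_exp_graph: "is_fun_M exp_graph"
  unfolding is_fun_M_def using exp_graph_iff exp_graph_ex2 by metis

lemma sat_exp2_eq: "satM (exp2_eq s t) e E \<longleftrightarrow> eval_tm mpar e t = ex2 (eval_tm mpar e s)"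
proof -
  have "satM (exp2_eq s t) e E \<longleftrightarrow> (\<exists>G\<in>SS. is_fun_M G \<and> pr 0 1 \<in> G \<and>
    (\<forall>n y. pr n y \<in> G \<longrightarrow> pr (n + 1) (2 * y) \<in> G) \<and> pr (eval_tm mpar e s) (eval_tm mpar e t) \<in> G)"
    unfolding exp2_eq_def Let_def by (simp add: sat_is_function conj_commute conj_left_commute)
  also have "\<dots> \<longleftrightarrow> eval_tm mpar e t = ex2 (eval_tm mpar e s)"
  proof
    assume "eval_tm mpar e t = ex2 (eval_tm mpar e s)"
    then show "\<exists>G\<in>SS. is_fun_M G \<and> pr 0 1 \<in> G \<and> (\<forall>n y. pr n y \<in> G \<longrightarrow> pr (n + 1) (2 * y) \<in> G) \<and>
      pr (eval_tm mpar e s) (eval_tm mpar e t) \<in> G"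
      by (intro bexI[of _ exp_graph] exp_graph_SS) (simp add: is_fun_exp_graph exp_graph_ex2)
  qed (metis exp_graph_characterization)
  finally show ?thesis .
qed

lemma sat_is_exponent:
  assumes "s \<notin> {''p'', ''q'', ''r''}" "m \<notin> {''p'', ''q'', ''r''}"
  shows "satM (is_exponent (V s) (V m)) e E \<longleftrightarrow> bit2 (e s) (e m)"
  using assms unfolding is_exponent_def bit2_def Let_def by (auto simp: sat_exp2_eq)

lemma sat_lambda_eq:
  assumes "a \<notin> {''p'', ''q'', ''r'', ''d''}" "m \<notin> {''p'', ''q'', ''r'', ''d''}"
  shows "satM (lambda_eq (V m) (V a)) e E \<longleftrightarrow> lam2 (e m) (e a)"
  using assms unfolding lambda_eq_def lam2_def Let_def less_eq_mnum_def by (auto simp: sat_is_exponent)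

lemma sat_mu_eq:
  assumes "a \<notin> {''p'', ''q'', ''r'', ''d''}" "m \<notin> {''p'', ''q'', ''r'', ''d''}"
  shows "satM (mu_eq (V m) (V a)) e E \<longleftrightarrow> mu2 (e m) (e a)"
  using assms unfolding mu_eq_def mu2_def Let_def less_eq_mnum_def by (auto simp: sat_is_exponent)

definition apart_M :: "mnum set \<Rightarrow> bool" where
  "apart_M U \<longleftrightarrow> (\<forall>x\<in>U. \<forall>x'\<in>U. x < x' \<longrightarrow> (\<exists>a b. mu2 x a \<and> lam2 x' b \<and> a < b))"

lemma sat_is_apart: "satM (is_apart (SV X)) e E \<longleftrightarrow> apart_M (E X)"
  unfolding is_apart_def apart_M_def Let_def by (auto simp: sat_mu_eq sat_lambda_eq)

definition colouring_M :: "mnum set \<Rightarrow> bool" where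
  "colouring_M F \<longleftrightarrow> (\<forall>z\<in>F. \<exists>n k. 0 < n \<and> k < 2 \<and> z = pr n k) \<and>
    (\<forall>n>0. \<exists>k<2. pr n k \<in> F \<and> (\<forall>j. pr n j \<in> F \<longrightarrow> j = k))"

lemma sat_is_colouring: "satM (is_colouring (SV X)) e E \<longleftrightarrow> colouring_M (E X)"
  unfolding is_colouring_def colouring_M_def Let_def sat.simps eval_tm.simps eval_pair eval_st.simps
  by (simp add: Ball_def)

definition pair_colouring_M :: "mnum set \<Rightarrow> bool" where
  "pair_colouring_M C \<longleftrightarrow> (\<forall>z\<in>C. \<exists>x y k. x < y \<and> k < 2 \<and> z = pr (pr x y) k) \<and>
    (\<forall>x y. x < y \<longrightarrow> (\<exists>k<2. pr (pr x y) k \<in> C \<and> (\<forall>j. pr (pr x y) j \<in> C \<longrightarrow> j = k)))"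

lemma sat_is_pair_colouring: "satM (is_pair_colouring (SV X)) e E \<longleftrightarrow> pair_colouring_M (E X)"
  unfolding is_pair_colouring_def pair_colouring_M_def Let_def sat.simps eval_tm.simps eval_pair eval_st.simps
  by (simp add: Ball_def)

lemma sat_is_infinite: "satM (is_infinite (SV X)) e E \<longleftrightarrow> unbounded (E X)"
  unfolding is_infinite_def unbounded_def by auto

lemma sat_is_positive: "satM (is_positive (SV X)) e E \<longleftrightarrow> 0 \<notin> E X"
  unfolding is_positive_def by (auto simp: pos_iff)

lemma sat_is_union: "satM (is_union (SV X) (SV Y) (SV Z)) e E \<longleftrightarrow> E X = E Y \<union> E Z"
  unfolding is_union_def by auto

definition IPT_M :: bool where
  "IPT_M \<longleftrightarrow> (\<forall>C\<in>SS. pair_colouring_M C \<longrightarrow> (\<exists>H1\<in>SS. \<exists>H2\<in>SS. 0 \<notin> H1 \<and> unbounded H1 \<and> 0 \<notin> H2 \<and> unbounded H2 \<and>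
    (\<exists>k<2. \<forall>x1 x2. x2 \<in> H2 \<longrightarrow> x1 \<in> H1 \<longrightarrow> x1 < x2 \<longrightarrow> pr (pr x1 x2) k \<in> C)))"

definition IPHT_apart_M :: bool where
  "IPHT_apart_M \<longleftrightarrow> (\<forall>F\<in>SS. colouring_M F \<longrightarrow> (\<exists>H1\<in>SS. \<exists>H2\<in>SS. 0 \<notin> H1 \<and> unbounded H1 \<and> 0 \<notin> H2 \<and> unbounded H2 \<and>
    H1 \<union> H2 \<in> SS \<and> apart_M (H1 \<union> H2) \<and>
    (\<exists>k<2. \<forall>x1 x2. x2 \<in> H2 \<longrightarrow> x1 \<in> H1 \<longrightarrow> x1 < x2 \<longrightarrow> pr (x1 + x2) k \<in> F)))"

lemmas sat_principles = sat_is_apart sat_is_colouring sat_is_pair_colouring sat_is_infinite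
  sat_is_positive sat_is_union

lemma sat_IPT: "satM IPT e E \<longleftrightarrow> IPT_M"
  unfolding IPT_def IPT_M_def Let_def by (simp add: sat_principles Bex_def conj_commute conj_left_commute)

lemma sat_IPHT_apart: "satM IPHT_apart e E \<longleftrightarrow> IPHT_apart_M"
  unfolding IPHT_apart_def IPHT_apart_M_def Let_def
  by (simp add: sat_principles Bex_def conj_commute conj_left_commute)

lemma Un_SS: "A \<in> SS \<Longrightarrow> B \<in> SS \<Longrightarrow> A \<union> B \<in> SS"
  unfolding Un_def by (intro Dl_set definable)

section \<open>The equivalence inside the model\<close>

lemma IPT_M_imp_IPHT_apart_M:
  assumes IPT_M
  shows IPHT_apart_M
  unfolding IPHT_apart_M_def
proof (intro ballI impI)
  fix F assume F: "F \<in> SS" "colouring_M F"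
  \<comment> \<open>The powers \<open>p\<close> and \<open>q\<close> are not bounded by
    \<open>z\<close>, so \<open>?R\<close> is only Sigma01. As they are determined by
    \<open>x\<close> and \<open>y\<close>, the complement can be written in Sigma01 form too; this
    is \<open>?R'\<close>.\<close>
  let ?R = "\<lambda>z. \<exists>x y k p q. x < y \<and> k < 2 \<and> z = pr (pr x y) k \<and> pr x p \<in> exp_graph \<and> pr y q \<in> exp_graph \<and>
    pr (p + q) k \<in> F"
  let ?R' = "\<lambda>z. \<not> (\<exists>x\<le>z. \<exists>y\<le>z. \<exists>k\<le>z. x < y \<and> k < 2 \<and> z = pr (pr x y) k) \<or>
    (\<exists>x y k p q. x < y \<and> k < 2 \<and> z = pr (pr x y) k \<and> pr x p \<in> exp_graph \<and> pr y q \<in> exp_graph \<and>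
      pr (p + q) k \<notin> F)"
  define C where "C = {z. ?R z}"
  have C: "pr (pr x y) k \<in> C \<longleftrightarrow> x < y \<and> k < 2 \<and> pr (ex2 x + ex2 y) k \<in> F" for x y k
    unfolding C_def by (auto simp: exp_graph_ex2)
  have "C \<in> SS"
    unfolding C_def
  proof (rule S1_set)
    show "S1 (\<lambda>e. ?R (e 0))" by (intro S1_intros; intro S1_Dl definable F(1))
    show "S1 (\<lambda>e. ?R' (e 0))" by (intro S1_intros; intro S1_Dl definable F(1))
    have "x \<le> pr (pr x y) k" "y \<le> pr (pr x y) k" "k \<le> pr (pr x y) k" for x y k
      using fst_le_pr snd_le_pr order_trans by blast+
    note bounds = this
    show "?R' z \<longleftrightarrow> \<not> ?R z" for z
    proof (cases "\<exists>x y k. x < y \<and> k < 2 \<and> z = pr (pr x y) k")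
      case True
      then obtain x y k where z: "x < y" "k < 2" "z = pr (pr x y) k" by blast
      have "\<exists>x\<le>z. \<exists>y\<le>z. \<exists>k\<le>z. x < y \<and> k < 2 \<and> z = pr (pr x y) k"
        using z bounds by blast
      moreover have "?R z \<longleftrightarrow> pr (ex2 x + ex2 y) k \<in> F" using z by (auto simp: exp_graph_ex2)
      moreover have "(\<exists>x y k p q. x < y \<and> k < 2 \<and> z = pr (pr x y) k \<and> pr x p \<in> exp_graph \<and>
        pr y q \<in> exp_graph \<and> pr (p + q) k \<notin> F) \<longleftrightarrow> pr (ex2 x + ex2 y) k \<notin> F"
        using z by (auto simp: exp_graph_ex2)
      ultimately show ?thesis by simp
    qed blast
  qed
  moreover have "pair_colouring_M C"
    unfolding pair_colouring_M_def
  proof (intro conjI ballI allI impI)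
    show "\<exists>x y k. x < y \<and> k < 2 \<and> z = pr (pr x y) k" if "z \<in> C" for z
      using that unfolding C_def by blast
    fix x y :: mnum assume xy: "x < y"
    have "0 < ex2 x + ex2 y" using ex2_pos by (simp add: add_pos_pos)
    then obtain k where "k < 2" "pr (ex2 x + ex2 y) k \<in> F" "\<forall>j. pr (ex2 x + ex2 y) j \<in> F \<longrightarrow> j = k"
      using F(2) unfolding colouring_M_def by blast
    then show "\<exists>k<2. pr (pr x y) k \<in> C \<and> (\<forall>j. pr (pr x y) j \<in> C \<longrightarrow> j = k)"
      using xy unfolding C by blast
  qed
  ultimately obtain H1 H2 k where H: "H1 \<in> SS" "unbounded H1" "H2 \<in> SS" "unbounded H2" "k < 2"
    and mono: "\<And>x1 x2. x1 \<in> H1 \<Longrightarrow> x2 \<in> H2 \<Longrightarrow> x1 < x2 \<Longrightarrow> pr (pr x1 x2) k \<in> C"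
    using assms unfolding IPT_M_def by blast
  have SS: "ex2 ` H \<in> SS" if "H \<in> SS" for H
  proof -
    \<comment> \<open>Since \<open>x < ex2 x\<close>, a preimage need only be sought below
      \<open>z\<close>.\<close>
    have "ex2 ` H = {z. \<exists>x\<le>z. x \<in> H \<and> pr x z \<in> exp_graph}"
      using ex2_less less_imp_le by (auto simp: exp_graph_ex2)
    then show ?thesis using that by (simp only:) (intro Dl_set definable)
  qed
  have unb: "unbounded (ex2 ` H)" if "unbounded H" for H
    using that ex2_less unfolding unbounded_def by (meson imageI less_trans)
  have zero: "0 \<notin> ex2 ` H" for H using ex2_pos by (metis imageE less_irrefl)
  have "apart_M (ex2 ` H1 \<union> ex2 ` H2)"
    unfolding apart_M_def using mu2_ex2 lam2_ex2 by (auto; blast)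
  moreover have "pr (y1 + y2) k \<in> F" if "y1 \<in> ex2 ` H1" "y2 \<in> ex2 ` H2" "y1 < y2" for y1 y2
    using that mono C by auto
  ultimately show "\<exists>H1\<in>SS. \<exists>H2\<in>SS. 0 \<notin> H1 \<and> unbounded H1 \<and> 0 \<notin> H2 \<and> unbounded H2 \<and>
    H1 \<union> H2 \<in> SS \<and> apart_M (H1 \<union> H2) \<and> (\<exists>k<2. \<forall>x1 x2. x2 \<in> H2 \<longrightarrow> x1 \<in> H1 \<longrightarrow> x1 < x2 \<longrightarrow> pr (x1 + x2) k \<in> F)"
    by (rule_tac bexI[of _ "ex2 ` H1"], rule_tac bexI[of _ "ex2 ` H2"])
      (intro conjI exI[of _ k] SS unb zero Un_SS H; blast)+
qed

text \<open>An element \<open>x\<close> of \<open>A\<close> whose value exceeds \<open>l\<close>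
  settles whether \<open>l\<close> is a value: a preimage of \<open>l\<close> in \<open>A\<close>
  would have to lie below \<open>x\<close>. Such an \<open>x\<close> exists by cofinality, so the
  complement is Sigma01 as well. The value 0 is dropped because solutions consist of positive
  numbers.\<close>

lemma image_SS:
  assumes A: "A \<in> SS" and L: "\<And>s t. Tm s \<Longrightarrow> Tm t \<Longrightarrow> Dl (\<lambda>e. L (s e) (t e))"
    and le: "\<And>x l. L x l \<Longrightarrow> l \<le> x"
    and fn: "\<And>x l l'. L x l \<Longrightarrow> L x l' \<Longrightarrow> l = l'"
    and incr: "\<And>x x' l l'. x \<in> A \<Longrightarrow> x' \<in> A \<Longrightarrow> x < x' \<Longrightarrow> L x l \<Longrightarrow> L x' l' \<Longrightarrow> l < l'"
    and cofinal: "\<And>n. \<exists>x\<in>A. \<exists>l. L x l \<and> n < l"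
  shows "{l. 0 < l \<and> (\<exists>x\<in>A. L x l)} \<in> SS" (is "?B \<in> SS") and "unbounded {l. 0 < l \<and> (\<exists>x\<in>A. L x l)}"
proof -
  show "unbounded ?B"
    unfolding unbounded_def using cofinal le_less_trans[OF zero_le_M] by blast
  let ?R = "\<lambda>l. 0 < l \<and> (\<exists>x. x \<in> A \<and> L x l)"
  let ?R' = "\<lambda>l. l = 0 \<or> (\<exists>x. x \<in> A \<and> (\<exists>m\<le>x. L x m \<and> l < m) \<and> \<not> (\<exists>x'<x. x' \<in> A \<and> L x' l))"
  have "{l. ?R l} \<in> SS"
  proof (rule S1_set)
    show "S1 (\<lambda>e. ?R (e 0))" by (intro S1_intros; intro S1_Dl definable A L)
    show "S1 (\<lambda>e. ?R' (e 0))" by (intro S1_intros; intro S1_Dl definable A L)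
    show "?R' l \<longleftrightarrow> \<not> ?R l" for l
    proof (cases "l = 0")
      case False
      show ?thesis
      proof
        assume "?R' l"
        then obtain x m where x: "x \<in> A" "L x m" "l < m" "\<not> (\<exists>x'<x. x' \<in> A \<and> L x' l)" using False by blast
        have False if "x' \<in> A" "L x' l" for x'
          using that x incr[of x x' m l] fn[of x m l] by (metis less_asym linorder_neqE less_irrefl)
        then show "\<not> ?R l" by blast
      next
        assume "\<not> ?R l"
        moreover obtain x m where "x \<in> A" "L x m" "l < m" using cofinal by blast
        moreover have "m \<le> x" using le \<open>L x m\<close> .
        ultimately show "?R' l" using False pos_iff[of l] by blast
      qed
    qed simp
  qed
  then show "?B \<in> SS" by (simp add: Bex_def)
qed

lemma IPHT_apart_M_imp_IPT_M:
  assumes IPHT_apart_M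
  shows IPT_M
  unfolding IPT_M_def
proof (intro ballI impI)
  fix C assume C: "C \<in> SS" "pair_colouring_M C"
  \<comment> \<open>For a power of two the least and greatest exponents coincide and
    \<open>C\<close> has no colour for them; the default colour is 0. All witnesses are bounded, so
    this set is Sigma00.\<close>
  define F where "F = {z. \<exists>m\<le>z. \<exists>k\<le>z. \<exists>a\<le>m. \<exists>b\<le>m. 0 < m \<and> k < 2 \<and> z = pr m k \<and> lam2 m a \<and> mu2 m b \<and>
    (a < b \<and> pr (pr a b) k \<in> C \<or> \<not> a < b \<and> k = 0)}"
  have "lam2 m a \<Longrightarrow> a \<le> m" "mu2 m a \<Longrightarrow> a \<le> m" for m a
    using bit2_imp_less by (auto simp: lam2_def mu2_def intro: less_imp_le)
  note le = this
  have mem: "pr m k \<in> F \<longleftrightarrow> 0 < m \<and> k < 2 \<and> (\<exists>a b. lam2 m a \<and> mu2 m b \<and>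
    (a < b \<and> pr (pr a b) k \<in> C \<or> \<not> a < b \<and> k = 0))"
    (is "_ \<longleftrightarrow> ?Q") for m k
  proof
    show "pr m k \<in> F \<Longrightarrow> ?Q" unfolding F_def by auto
    show "?Q \<Longrightarrow> pr m k \<in> F"
      using fst_le_pr[of m k] snd_le_pr[of k m] le unfolding F_def mem_Collect_eq by blast
  qed
  have "F \<in> SS"
    unfolding F_def by (intro Dl_set definable C(1))
  moreover have "colouring_M F"
    unfolding colouring_M_def
  proof (intro conjI ballI allI impI)
    show "\<exists>n k. 0 < n \<and> k < 2 \<and> z = pr n k" if "z \<in> F" for z using that unfolding F_def by blast
    fix n :: mnum assume n: "0 < n"
    then obtain a b where ab: "lam2 n a" "mu2 n b" using lam2_total mu2_total by blast
    have "lam2 n a' \<longleftrightarrow> a' = a" "mu2 n b' \<longleftrightarrow> b' = b" for a' b'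
      using ab lam2_unique[of n] mu2_unique[of n] by blast+
    then have memn: "pr n k \<in> F \<longleftrightarrow> k < 2 \<and> (a < b \<and> pr (pr a b) k \<in> C \<or> \<not> a < b \<and> k = 0)" for k
      using n by (simp add: mem)
    show "\<exists>k<2. pr n k \<in> F \<and> (\<forall>j. pr n j \<in> F \<longrightarrow> j = k)"
    proof (cases "a < b")
      case True
      then obtain k where "k < 2" "pr (pr a b) k \<in> C" "\<forall>j. pr (pr a b) j \<in> C \<longrightarrow> j = k"
        using C(2) unfolding pair_colouring_M_def by blast
      then show ?thesis using True unfolding memn by blast
    next
      case False
      then show ?thesis using memn by (intro exI[of _ 0]) simp
    qed
  qed
  ultimately obtain H1 H2 k where H: "H1 \<in> SS" "unbounded H1" "H2 \<in> SS" "unbounded H2" "0 \<notin> H1" "0 \<notin> H2"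
    and ap: "apart_M (H1 \<union> H2)" and k: "k < 2"
    and homog: "\<And>x1 x2. x1 \<in> H1 \<Longrightarrow> x2 \<in> H2 \<Longrightarrow> x1 < x2 \<Longrightarrow> pr (x1 + x2) k \<in> F"
    using assms unfolding IPHT_apart_M_def by blast
  obtain A B where AB: "A \<in> SS" "B \<in> SS" "A \<subseteq> H1" "B \<subseteq> H2" "A \<inter> B = {}" "unbounded A" "unbounded B"
    using disjoint_refinement[OF H(1-4)] by blast
  have ap: "a < b" if "x \<in> H1 \<union> H2" "x' \<in> H1 \<union> H2" "x < x'" "mu2 x a" "lam2 x' b" for x x' a b
    using ap that lam2_unique mu2_unique unfolding apart_M_def by metis
  have lam_le_mu: "a \<le> b" if "lam2 x a" "mu2 x b" for x a b
    using that by (auto simp: lam2_def mu2_def)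
  have lamB: "{l. 0 < l \<and> (\<exists>x\<in>X. lam2 x l)} \<in> SS" "unbounded {l. 0 < l \<and> (\<exists>x\<in>X. lam2 x l)}"
    and muB: "{l. 0 < l \<and> (\<exists>x\<in>X. mu2 x l)} \<in> SS" "unbounded {l. 0 < l \<and> (\<exists>x\<in>X. mu2 x l)}"
    if X: "X \<in> SS" "unbounded X" "X \<subseteq> H1 \<union> H2" for X
  proof -
    have pos: "0 < x" if "x \<in> X" for x using that X(3) H(5,6) by (auto simp: pos_iff)
    have lam_incr: "l < l'" if "x \<in> X" "x' \<in> X" "x < x'" "lam2 x l" "lam2 x' l'" for x x' l l'
      using ap[of x x' _ l'] lam_le_mu[of x l] mu2_total[OF pos] that X(3) by (meson le_less_trans subsetD)
    have mu_incr: "l < l'" if "x \<in> X" "x' \<in> X" "x < x'" "mu2 x l" "mu2 x' l'" for x x' l l'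
      using ap[of x x' l] lam_le_mu[of x' _ l'] lam2_total[OF pos] that X(3) by (meson less_le_trans subsetD)
    \<comment> \<open>Take an element \<open>y\<close> above \<open>ex2 n\<close>, so that its
      greatest exponent is at least \<open>n\<close>. By apartness the least exponent of any later
      element is larger still.\<close>
    have lam_cof: "\<exists>x\<in>X. \<exists>l. lam2 x l \<and> n < l" for n
    proof -
      obtain y where y: "ex2 n < y" "y \<in> X" using X(2) by (auto simp: unbounded_def)
      obtain x where x: "y < x" "x \<in> X" using X(2) by (auto simp: unbounded_def)
      obtain u l where ul: "mu2 y u" "lam2 x l" using mu2_total lam2_total pos x y by blast
      have "ex2 n < ex2 (u + 1)" using ul(1) y(1) mu2_iff less_trans by blast
      then have "n \<le> u" by (simp only: ex2_less_iff less_Suc_iff)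
      also have "u < l" using ap[of y x u l] x y ul X(3) by blast
      finally show ?thesis using x(2) ul(2) by blast
    qed
    then have mu_cof: "\<exists>x\<in>X. \<exists>l. mu2 x l \<and> n < l" for n
      using lam_le_mu mu2_total[OF pos] by (meson less_le_trans)
    show "{l. 0 < l \<and> (\<exists>x\<in>X. lam2 x l)} \<in> SS" "unbounded {l. 0 < l \<and> (\<exists>x\<in>X. lam2 x l)}"
      by (rule image_SS; (rule X(1) | rule Dl_lam2, assumption+ | rule le(1), assumption |
          rule lam2_unique, assumption+ | rule lam_incr, assumption+ | rule lam_cof))+
    show "{l. 0 < l \<and> (\<exists>x\<in>X. mu2 x l)} \<in> SS" "unbounded {l. 0 < l \<and> (\<exists>x\<in>X. mu2 x l)}"
      by (rule image_SS; (rule X(1) | rule Dl_mu2, assumption+ | rule le(2), assumption |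
          rule mu2_unique, assumption+ | rule mu_incr, assumption+ | rule mu_cof))+
  qed
  let ?H1 = "{l. 0 < l \<and> (\<exists>x\<in>A. lam2 x l)}" and ?H2 = "{l. 0 < l \<and> (\<exists>x\<in>B. mu2 x l)}"
  have "pr (pr l m) k \<in> C" if lm: "l \<in> ?H1" "m \<in> ?H2" "l < m" for l m
  proof -
    obtain x y where x: "x \<in> A" "lam2 x l" and y: "y \<in> B" "mu2 y m" using lm(1,2) by blast
    then have xy: "x \<in> H1" "y \<in> H2" "x \<noteq> y" using AB by blast+
    \<comment> \<open>Disjointness of \<open>A\<close> and \<open>B\<close> excludes equality, and
      \<open>y < x\<close> would give \<open>m < l\<close> by apartness.\<close>
    have "x < y"
    proof (rule ccontr)
      assume "\<not> x < y"
      then have "y < x" using xy(3) by simp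
      then show False using ap[of y x m l] x y xy \<open>l < m\<close> by simp
    qed
    have "0 < x" "0 < y" using xy H(5,6) by (metis pos_iff)+
    then obtain u b where u: "mu2 x u" "lam2 y b" using mu2_total lam2_total by blast
    have "u < b" using ap[of x y u b] xy \<open>x < y\<close> u by blast
    have "lam2 (x + y) l" using lam2_add[OF x(2) u \<open>u < b\<close>] .
    moreover have "mu2 (x + y) m" using mu2_add[OF u \<open>u < b\<close> y(2)] .
    ultimately show ?thesis
      using homog[OF xy(1,2) \<open>x < y\<close>] \<open>l < m\<close> lam2_unique[of "x + y"] mu2_unique[of "x + y"]
      unfolding mem by blast
  qed
  then have homog': "\<forall>l m. m \<in> ?H2 \<longrightarrow> l \<in> ?H1 \<longrightarrow> l < m \<longrightarrow> pr (pr l m) k \<in> C" by blast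
  have H1: "?H1 \<in> SS" "unbounded ?H1" using lamB[OF AB(1,6)] AB(3) by blast+
  have H2: "?H2 \<in> SS" "unbounded ?H2" using muB[OF AB(2,7)] AB(4) by blast+
  show "\<exists>H1\<in>SS. \<exists>H2\<in>SS. 0 \<notin> H1 \<and> unbounded H1 \<and> 0 \<notin> H2 \<and> unbounded H2 \<and>
    (\<exists>k<2. \<forall>x1 x2. x2 \<in> H2 \<longrightarrow> x1 \<in> H1 \<longrightarrow> x1 < x2 \<longrightarrow> pr (pr x1 x2) k \<in> C)"
    by (rule bexI[OF _ H1(1)], rule bexI[OF _ H2(1)], intro conjI exI[of _ k] H1(2) H2(2) k homog') simp_all
qed

theorem RCA0_equivalence: "RCA0 \<turnstile> (IPT \<^bold>\<longleftrightarrow> IPHT_apart)"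
proof -
  have "satM equivalence_fm e E" for e E
    using IPT_M_imp_IPHT_apart_M IPHT_apart_M_imp_IPT_M
    by (auto simp: equivalence_fm_def sat_IPT sat_IPHT_apart)
  then show ?thesis using derivable_if_sat unfolding equivalence_fm_def by blast
qed

section \<open>Closure properties of relative recursiveness\<close>

text \<open>\<open>recursive_in\<close> speaks about one particular function on all lists. Asking
  only for agreement on lists of length \<open>n\<close> permits rewriting under that
  assumption.\<close>

definition recursive_fun :: "nat set \<Rightarrow> nat \<Rightarrow> (nat list \<Rightarrow> nat) \<Rightarrow> bool" where
  "recursive_fun A n f \<longleftrightarrow> (\<exists>g. recursive_in A n g \<and> (\<forall>xs. length xs = n \<longrightarrow> f xs = g xs))"

definition recursive_pred :: "nat set \<Rightarrow> nat \<Rightarrow> (nat list \<Rightarrow> bool) \<Rightarrow> bool" where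
  "recursive_pred A n Q \<longleftrightarrow> recursive_fun A n (\<lambda>xs. of_bool (Q xs))"

lemma recursive_fun_cong: "recursive_fun A n f \<Longrightarrow> (\<And>xs. length xs = n \<Longrightarrow> f' xs = f xs) \<Longrightarrow> recursive_fun A n f'"
  unfolding recursive_fun_def by metis

lemma recursive_fun_comp:
  assumes f: "recursive_fun A (length gs) f" and gs: "\<And>g. g \<in> set gs \<Longrightarrow> recursive_fun A n g"
  shows "recursive_fun A n (\<lambda>xs. f (map (\<lambda>g. g xs) gs))"
proof -
  obtain f' where f': "recursive_in A (length gs) f'" "\<And>xs. length xs = length gs \<Longrightarrow> f xs = f' xs"
    using f unfolding recursive_fun_def by blast
  obtain c where c: "\<And>g. g \<in> set gs \<Longrightarrow> recursive_in A n (c g) \<and> (\<forall>xs. length xs = n \<longrightarrow> g xs = c g xs)"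
    using gs unfolding recursive_fun_def by metis
  have "recursive_in A n (\<lambda>xs. f' (map (\<lambda>g. g xs) (map c gs)))"
    using f'(1) c by (intro recursive_in.comp) auto
  moreover have "f (map (\<lambda>g. g xs) gs) = f' (map (\<lambda>g. g xs) (map c gs))" if "length xs = n" for xs
  proof -
    have "map (\<lambda>g. g xs) gs = map (\<lambda>g. g xs) (map c gs)" using c that by auto
    then show ?thesis using f'(2) by (metis length_map)
  qed
  ultimately show ?thesis unfolding recursive_fun_def by blast
qed

lemma recursive_fun_comp1: "recursive_fun A 1 (\<lambda>ys. h (ys ! 0)) \<Longrightarrow> recursive_fun A n f \<Longrightarrow> recursive_fun A n (\<lambda>xs. h (f xs))"
  using recursive_fun_comp[of A "[f]" "\<lambda>ys. h (ys ! 0)" n] by simp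

lemma recursive_fun_comp2:
  "recursive_fun A 2 (\<lambda>ys. h (ys ! 0) (ys ! 1)) \<Longrightarrow> recursive_fun A n f \<Longrightarrow> recursive_fun A n g \<Longrightarrow>
    recursive_fun A n (\<lambda>xs. h (f xs) (g xs))"
  using recursive_fun_comp[of A "[f, g]" "\<lambda>ys. h (ys ! 0) (ys ! 1)" n] by (auto simp: numeral_2_eq_2)

lemma recursive_pred_comp1: "recursive_pred A 1 (\<lambda>ys. Q (ys ! 0)) \<Longrightarrow> recursive_fun A n f \<Longrightarrow> recursive_pred A n (\<lambda>xs. Q (f xs))"
  unfolding recursive_pred_def by (rule recursive_fun_comp1)

lemma recursive_pred_comp2:
  "recursive_pred A 2 (\<lambda>ys. Q (ys ! 0) (ys ! 1)) \<Longrightarrow> recursive_fun A n f \<Longrightarrow> recursive_fun A n g \<Longrightarrow>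
    recursive_pred A n (\<lambda>xs. Q (f xs) (g xs))"
  unfolding recursive_pred_def by (rule recursive_fun_comp2)

named_theorems computable

lemma recursive_fun_proj [computable]: "i < n \<Longrightarrow> recursive_fun A n (\<lambda>xs. xs ! i)"
  unfolding recursive_fun_def using recursive_in.proj by blast

lemma recursive_fun_Suc [computable]: "recursive_fun A n f \<Longrightarrow> recursive_fun A n (\<lambda>xs. Suc (f xs))"
  by (rule recursive_fun_comp1[of A Suc]) (auto simp: recursive_fun_def intro: recursive_in.suc[simplified])

lemma recursive_fun_const [computable]: "recursive_fun A n (\<lambda>xs. c)"
proof (induction c)
  case 0
  then show ?case unfolding recursive_fun_def using recursive_in.zero by blast
qed (rule recursive_fun_Suc)

lemma recursive_pred_oracle: "recursive_fun A n f \<Longrightarrow> recursive_pred A n (\<lambda>xs. f xs \<in> A)"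
proof -
  have "recursive_pred A 1 (\<lambda>ys. ys ! 0 \<in> A)"
    unfolding recursive_pred_def recursive_fun_def using recursive_in.oracle_query by blast
  then show "recursive_fun A n f \<Longrightarrow> recursive_pred A n (\<lambda>xs. f xs \<in> A)" by (rule recursive_pred_comp1)
qed

lemma recursive_fun_prim1:
  assumes "recursive_fun A 2 (\<lambda>ys. g (ys ! 0) (ys ! 1))"
  shows "recursive_fun A 1 (\<lambda>ys. rec_nat c g (ys ! 0))"
proof -
  obtain f' where f': "recursive_in A 0 f'" "c = f' []"
    using recursive_fun_const[of A 0 c] unfolding recursive_fun_def by auto
  obtain g' where g': "recursive_in A (Suc (Suc 0)) g'" "\<And>k v. g k v = g' [k, v]"
    using assms unfolding recursive_fun_def
    by (metis (no_types, lifting) One_nat_def length_Cons list.size(3) nth_Cons_0 nth_Cons_Suc numeral_2_eq_2)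
  have "rec_nat c g (xs ! 0) = rec_nat (f' (tl xs)) (\<lambda>k v. g' (k # v # tl xs)) (hd xs)" if len: "length xs = 1" for xs
  proof -
    obtain x where "xs = [x]" using len by (cases xs) auto
    moreover have "rec_nat c g x = rec_nat (f' []) (\<lambda>k v. g' [k, v]) x" by (simp add: f'(2) g'(2)[symmetric])
    ultimately show ?thesis by simp
  qed
  then show ?thesis unfolding recursive_fun_def using recursive_in.prim_rec[OF f'(1) g'(1)] by auto
qed

lemma recursive_fun_prim2:
  assumes "recursive_fun A 1 (\<lambda>ys. f (ys ! 0))" "recursive_fun A 3 (\<lambda>ys. g (ys ! 0) (ys ! 1) (ys ! 2))"
  shows "recursive_fun A 2 (\<lambda>ys. rec_nat (f (ys ! 1)) (\<lambda>k v. g k v (ys ! 1)) (ys ! 0))"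
proof -
  obtain f' where f': "recursive_in A 1 f'" "\<And>y. f y = f' [y]"
    using assms(1) unfolding recursive_fun_def by (metis (no_types, lifting) One_nat_def length_Cons list.size(3) nth_Cons_0)
  obtain g' where g': "recursive_in A (Suc (Suc 1)) g'" "\<And>k v y. g k v y = g' [k, v, y]"
  proof -
    obtain g' where g': "recursive_in A 3 g'"
      "\<And>xs. length xs = 3 \<Longrightarrow> g (xs ! 0) (xs ! 1) (xs ! 2) = g' xs"
      using assms(2) unfolding recursive_fun_def by blast
    have "g k v y = g' [k, v, y]" for k v y using g'(2)[of "[k, v, y]"] by simp
    then show thesis using that[of g'] g'(1) by (simp add: numeral_3_eq_3)
  qed
  have "rec_nat (f (xs ! 1)) (\<lambda>k v. g k v (xs ! 1)) (xs ! 0) =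
    rec_nat (f' (tl xs)) (\<lambda>k v. g' (k # v # tl xs)) (hd xs)" if len: "length xs = 2" for xs
  proof -
    obtain x y where "xs = [x, y]" using len by (auto simp: numeral_2_eq_2 length_Suc_conv)
    then show ?thesis by (simp add: f'(2) g'(2))
  qed
  then show ?thesis unfolding recursive_fun_def
    using recursive_in.prim_rec[OF f'(1) g'(1)] by (auto simp: numeral_2_eq_2)
qed

lemma recursive_fun_add [computable]: "recursive_fun A n f \<Longrightarrow> recursive_fun A n g \<Longrightarrow> recursive_fun A n (\<lambda>xs. f xs + g xs)"
proof (rule recursive_fun_comp2[where h = "\<lambda>x y. x + y"])
  have "rec_nat y (\<lambda>k v. Suc v) x = x + y" for x y by (induction x) auto
  moreover have "recursive_fun A 2 (\<lambda>ys. rec_nat (ys ! 1) (\<lambda>k v. Suc v) (ys ! 0))"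
    by (rule recursive_fun_prim2) (intro computable; simp)+
  ultimately show "recursive_fun A 2 (\<lambda>ys. ys ! 0 + ys ! 1)" by simp
qed

lemma recursive_fun_mult [computable]: "recursive_fun A n f \<Longrightarrow> recursive_fun A n g \<Longrightarrow> recursive_fun A n (\<lambda>xs. f xs * g xs)"
proof (rule recursive_fun_comp2[where h = "\<lambda>x y. x * y"])
  have "rec_nat 0 (\<lambda>k v. v + y) x = x * y" for x y :: nat by (induction x) auto
  moreover have "recursive_fun A 2 (\<lambda>ys. rec_nat 0 (\<lambda>k v. v + ys ! 1) (ys ! 0))"
    by (rule recursive_fun_prim2) (intro computable; simp)+
  ultimately show "recursive_fun A 2 (\<lambda>ys. ys ! 0 * ys ! 1)" by simp
qed

lemma recursive_fun_diff [computable]: "recursive_fun A n f \<Longrightarrow> recursive_fun A n g \<Longrightarrow> recursive_fun A n (\<lambda>xs. f xs - g xs)"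
proof -
  have "rec_nat 0 (\<lambda>k v. k) x = x - 1" for x :: nat by (cases x) auto
  moreover have "recursive_fun A 1 (\<lambda>ys. rec_nat 0 (\<lambda>k v. k) (ys ! 0))"
    by (rule recursive_fun_prim1) (intro computable; simp)
  ultimately have pred: "recursive_fun A 1 (\<lambda>ys. ys ! 0 - 1)" by simp
  have "rec_nat y (\<lambda>k v. v - 1) x = y - x" for x y :: nat by (induction x) auto
  moreover have "recursive_fun A 2 (\<lambda>ys. rec_nat (ys ! 1) (\<lambda>k v. v - 1) (ys ! 0))"
    by (rule recursive_fun_prim2) (intro recursive_fun_comp1[OF pred] computable; simp)+
  ultimately have "recursive_fun A 2 (\<lambda>ys. ys ! 1 - ys ! 0)" by simp
  then show "recursive_fun A n f \<Longrightarrow> recursive_fun A n g \<Longrightarrow> recursive_fun A n (\<lambda>xs. f xs - g xs)"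
    using recursive_fun_comp2[of A "\<lambda>x y. y - x" n g f] by simp
qed

lemma recursive_pred_not [computable]: "recursive_pred A n Q \<Longrightarrow> recursive_pred A n (\<lambda>xs. \<not> Q xs)"
  unfolding recursive_pred_def
  by (rule recursive_fun_cong[OF recursive_fun_diff[OF recursive_fun_const[of A n 1]]]) auto

lemma recursive_pred_and [computable]: "recursive_pred A n Q \<Longrightarrow> recursive_pred A n R \<Longrightarrow> recursive_pred A n (\<lambda>xs. Q xs \<and> R xs)"
  unfolding recursive_pred_def
  by (rule recursive_fun_cong[OF recursive_fun_mult[of A n "\<lambda>xs. of_bool (Q xs)" "\<lambda>xs. of_bool (R xs)"]]) auto

lemma recursive_pred_or [computable]: "recursive_pred A n Q \<Longrightarrow> recursive_pred A n R \<Longrightarrow> recursive_pred A n (\<lambda>xs. Q xs \<or> R xs)"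
  using recursive_pred_not[OF recursive_pred_and[OF recursive_pred_not recursive_pred_not]] by simp

lemma recursive_fun_if [computable]:
  "recursive_pred A n Q \<Longrightarrow> recursive_fun A n f \<Longrightarrow> recursive_fun A n g \<Longrightarrow> recursive_fun A n (\<lambda>xs. if Q xs then f xs else g xs)"
  by (rule recursive_fun_cong[OF recursive_fun_add[OF recursive_fun_mult[of A n "\<lambda>xs. of_bool (Q xs)" f]
        recursive_fun_mult[of A n "\<lambda>xs. of_bool (\<not> Q xs)" g]]])
    (simp_all flip: recursive_pred_def add: recursive_pred_not)

lemma recursive_fun_of_bool [computable]: "recursive_pred A n Q \<Longrightarrow> recursive_fun A n (\<lambda>xs. of_bool (Q xs))"
  unfolding recursive_pred_def .

lemma recursive_pred_le [computable]: "recursive_fun A n f \<Longrightarrow> recursive_fun A n g \<Longrightarrow> recursive_pred A n (\<lambda>xs. f xs \<le> g xs)"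
  unfolding recursive_pred_def
  by (rule recursive_fun_cong[of A n "\<lambda>xs. 1 - (f xs - g xs)"]) (auto intro!: computable)

lemma recursive_pred_less [computable]: "recursive_fun A n f \<Longrightarrow> recursive_fun A n g \<Longrightarrow> recursive_pred A n (\<lambda>xs. f xs < g xs)"
  using recursive_pred_le[of A n "\<lambda>xs. Suc (f xs)" g] recursive_fun_Suc[of A n f] by (simp add: Suc_le_eq)

lemma recursive_pred_eq [computable]: "recursive_fun A n f \<Longrightarrow> recursive_fun A n g \<Longrightarrow> recursive_pred A n (\<lambda>xs. f xs = g xs)"
  using recursive_pred_and[OF recursive_pred_le[of A n f g] recursive_pred_le[of A n g f]] by (simp add: eq_iff)

lemma recursive_pred_ex:
  assumes "recursive_pred A 2 (\<lambda>ys. Q (ys ! 0) (ys ! 1))"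
  shows "recursive_pred A 2 (\<lambda>ys. \<exists>i<ys ! 0. Q i (ys ! 1))"
proof -
  have "rec_nat 0 (\<lambda>k v. if Q k y then 1 else v) x = (of_bool (\<exists>i<x. Q i y) :: nat)" for x y
    by (induction x) (auto simp: less_Suc_eq)
  moreover have "recursive_fun A 2 (\<lambda>ys. rec_nat 0 (\<lambda>k v. if Q k (ys ! 1) then 1 else v) (ys ! 0))"
    by (rule recursive_fun_prim2) (intro recursive_pred_comp2[OF assms] computable; simp)+
  ultimately show ?thesis unfolding recursive_pred_def by (simp only:)
qed

text \<open>Minimization looks for a zero, so it is applied to the characteristic function of the
  negation.\<close>

lemma recursive_fun_Least:
  assumes Q: "recursive_pred A 2 (\<lambda>ys. Q (ys ! 0) (ys ! 1))" and ex: "\<And>y. \<exists>k. Q k y"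
  shows "recursive_fun A 1 (\<lambda>ys. LEAST k. Q k (ys ! 0))"
proof -
  obtain g where g: "recursive_in A 2 g"
    "\<And>xs. length xs = 2 \<Longrightarrow> of_bool (\<not> Q (xs ! 0) (xs ! 1)) = g xs"
    using recursive_pred_not[OF Q] unfolding recursive_pred_def recursive_fun_def by blast
  have g0: "g [k, y] = 0 \<longleftrightarrow> Q k y" for k y using g(2)[of "[k, y]", symmetric] by simp
  have xs: "\<exists>y. xs = [y]" if "length xs = 1" for xs :: "nat list" using that by (cases xs) auto
  have "recursive_in A 1 (\<lambda>xs. LEAST k. g (k # xs) = 0)"
  proof (rule recursive_in.minim)
    show "recursive_in A (Suc 1) g" using g(1) by (simp add: numeral_2_eq_2)
    show "\<exists>k. g (k # xs) = 0" if "length xs = 1" for xs using xs[OF that] ex g0 by auto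
  qed
  moreover have "(LEAST k. Q k (xs ! 0)) = (LEAST k. g (k # xs) = 0)" if "length xs = 1" for xs
    using xs[OF that] g0 by auto
  ultimately show ?thesis unfolding recursive_fun_def by blast
qed

lemma recursive_fun_mod2 [computable]: "recursive_fun A n f \<Longrightarrow> recursive_fun A n (\<lambda>xs. f xs mod 2)"
proof (rule recursive_fun_comp1[where h = "\<lambda>x. x mod 2"])
  have "rec_nat 0 (\<lambda>k v. 1 - v) x = x mod 2" for x :: nat by (induction x) (auto simp: mod_Suc)
  moreover have "recursive_fun A 1 (\<lambda>ys. rec_nat 0 (\<lambda>k v. 1 - v) (ys ! 0))"
    by (rule recursive_fun_prim1) (intro computable; simp)
  ultimately show "recursive_fun A 1 (\<lambda>ys. ys ! 0 mod 2)" by simp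
qed

lemma recursive_fun_div2 [computable]: "recursive_fun A n f \<Longrightarrow> recursive_fun A n (\<lambda>xs. f xs div 2)"
proof (rule recursive_fun_comp1[where h = "\<lambda>x. x div 2"])
  have "rec_nat 0 (\<lambda>k v. v + k mod 2) x = x div 2" for x :: nat by (induction x) (simp, simp, presburger)
  moreover have "recursive_fun A 1 (\<lambda>ys. rec_nat 0 (\<lambda>k v. v + k mod 2) (ys ! 0))"
    by (rule recursive_fun_prim1) (intro computable; simp)
  ultimately show "recursive_fun A 1 (\<lambda>ys. ys ! 0 div 2)" by simp
qed

lemma recursive_fun_div_exp [computable]:
  "recursive_fun A n f \<Longrightarrow> recursive_fun A n g \<Longrightarrow> recursive_fun A n (\<lambda>xs. g xs div 2 ^ f xs)"
proof (rule recursive_fun_comp2[where h = "\<lambda>k x. x div 2 ^ k"])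
  have "rec_nat x (\<lambda>k v. v div 2) k = x div 2 ^ k" for x k :: nat
    by (induction k) (auto simp: div_mult2_eq[symmetric] mult.commute)
  moreover have "recursive_fun A 2 (\<lambda>ys. rec_nat (ys ! 1) (\<lambda>k v. v div 2) (ys ! 0))"
    by (rule recursive_fun_prim2) (intro computable; simp)+
  ultimately show "recursive_fun A 2 (\<lambda>ys. ys ! 1 div 2 ^ ys ! 0)" by simp
qed

lemma recursive_fun_prod_encode [computable]:
  "recursive_fun A n f \<Longrightarrow> recursive_fun A n g \<Longrightarrow> recursive_fun A n (\<lambda>xs. prod_encode (f xs, g xs))"
proof -
  have "rec_nat 0 (\<lambda>k v. v + Suc k) x = triangle x" for x by (induction x) auto
  moreover have "recursive_fun A 1 (\<lambda>ys. rec_nat 0 (\<lambda>k v. v + Suc k) (ys ! 0))"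
    by (rule recursive_fun_prim1) (intro computable; simp)
  ultimately have triangle: "recursive_fun A 1 (\<lambda>ys. triangle (ys ! 0))" by simp
  show "recursive_fun A n f \<Longrightarrow> recursive_fun A n g \<Longrightarrow> recursive_fun A n (\<lambda>xs. prod_encode (f xs, g xs))"
    unfolding prod_encode_def split_conv by (intro recursive_fun_comp1[OF triangle] recursive_fun_add)
qed

lemma computable_fromI: "recursive_pred A 1 (\<lambda>xs. xs ! 0 \<in> B) \<Longrightarrow> computable_from B A"
proof -
  assume "recursive_pred A 1 (\<lambda>xs. xs ! 0 \<in> B)"
  then obtain g where g: "recursive_in A 1 g" "\<And>xs. length xs = 1 \<Longrightarrow> of_bool (xs ! 0 \<in> B) = g xs"
    unfolding recursive_pred_def recursive_fun_def by blast
  have "g [x] = of_bool (x \<in> B)" for x using g(2)[of "[x]"] by simp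
  then show ?thesis unfolding computable_from_def using g(1) by blast
qed

section \<open>Least and greatest exponents\<close>

lemma set_decode_nonempty: "0 < m \<Longrightarrow> set_decode m \<noteq> {}"
  by (metis less_irrefl set_decode_inverse set_encode_empty)

lemma lam_mem: "0 < m \<Longrightarrow> lam m \<in> set_decode m"
  unfolding lam_def by (rule Min_in) (auto simp: set_decode_nonempty)

lemma mu_mem: "0 < m \<Longrightarrow> mu m \<in> set_decode m"
  unfolding mu_def by (rule Max_in) (auto simp: set_decode_nonempty)

lemma lam_le_mu: "0 < m \<Longrightarrow> lam m \<le> mu m"
  unfolding mu_def by (rule Max_ge) (auto simp: lam_mem)

lemma lam_Least: "0 < m \<Longrightarrow> lam m = (LEAST k. k \<in> set_decode m)"
  by (rule Least_equality[symmetric]) (auto simp: lam_mem, simp add: lam_def)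

text \<open>Turns the maximum into a search, so that \<open>mu\<close> becomes computable by
  minimization. A sum of distinct powers with exponents up to \<open>mu m\<close> is smaller than
  the next power.\<close>

lemma mu_Least: "0 < m \<Longrightarrow> mu m = (LEAST k. m div 2 ^ Suc k = 0)"
proof (rule Least_equality[symmetric])
  assume m: "0 < m"
  have "m < 2 ^ Suc (mu m)"
  proof -
    have "m = sum ((^) 2) (set_decode m)" using set_decode_inverse[of m] by (simp add: set_encode_def)
    also have "\<dots> \<le> sum ((^) 2) {..<Suc (mu m)}"
      by (rule sum_mono2) (auto simp: mu_def less_Suc_eq_le)
    also have "sum ((^) 2) {..<k} < (2::nat) ^ k" for k by (induction k) auto
    finally show ?thesis .
  qed
  then show "m div 2 ^ Suc (mu m) = 0" by simp
  fix k assume k: "m div 2 ^ Suc k = 0"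
  show "mu m \<le> k"
  proof (rule ccontr)
    assume "\<not> mu m \<le> k"
    then obtain j where j: "mu m = Suc k + j" using less_iff_Suc_add[of k "mu m"] by auto
    have "m div 2 ^ mu m = (m div 2 ^ Suc k) div 2 ^ j"
      unfolding j power_add by (rule div_mult2_eq)
    then have "m div 2 ^ mu m = 0" using k by simp
    then show False using mu_mem[OF m] by (simp add: set_decode_def)
  qed
qed

text \<open>The number 0 has no exponents and \<open>lam 0\<close> is a minimum of the empty set;
  the default value 0 makes the search end there, as regular minimization demands.\<close>

lemma recursive_fun_lam [computable]:
  assumes "recursive_fun A n f"
  shows "recursive_fun A n (\<lambda>xs. if f xs = 0 then 0 else lam (f xs))"
proof -
  have "recursive_fun A 1 (\<lambda>ys. LEAST k. ys ! 0 = 0 \<or> (ys ! 0 div 2 ^ k) mod 2 = 1)"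
  proof (rule recursive_fun_Least)
    show "recursive_pred A 2 (\<lambda>ys. ys ! 1 = 0 \<or> (ys ! 1 div 2 ^ ys ! 0) mod 2 = 1)"
      by (intro computable; simp)
    show "\<exists>k. y = 0 \<or> (y div 2 ^ k) mod 2 = 1" for y :: nat
      using lam_mem[of y] by (auto simp: set_decode_def odd_iff_mod_2_eq_one)
  qed
  moreover have "(LEAST k. y = 0 \<or> (y div 2 ^ k) mod 2 = 1) = (if y = 0 then 0 else lam y)" for y :: nat
    by (auto simp: lam_Least set_decode_def odd_iff_mod_2_eq_one)
  ultimately have "recursive_fun A 1 (\<lambda>ys. if ys ! 0 = 0 then 0 else lam (ys ! 0))" by simp
  then show ?thesis using assms by (rule recursive_fun_comp1)
qed

lemma recursive_fun_mu [computable]: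
  assumes "recursive_fun A n f"
  shows "recursive_fun A n (\<lambda>xs. if f xs = 0 then 0 else mu (f xs))"
proof -
  have "recursive_fun A 1 (\<lambda>ys. LEAST k. ys ! 0 div 2 ^ Suc k = 0)"
  proof (rule recursive_fun_Least)
    show "recursive_pred A 2 (\<lambda>ys. ys ! 1 div 2 ^ Suc (ys ! 0) = 0)"
      by (intro computable; simp)
    show "\<exists>k. y div 2 ^ Suc k = 0" for y :: nat
      by (intro exI[of _ y] div_less) (use less_trans[OF lessI less_exp[of "Suc y"]] in simp)
  qed
  moreover have "(LEAST k. y div 2 ^ Suc k = 0) = (if y = 0 then 0 else mu y)" for y :: nat
    using mu_Least[of y] by (simp add: Least_eq_0)
  ultimately have "recursive_fun A 1 (\<lambda>ys. if ys ! 0 = 0 then 0 else mu (ys ! 0))" by simp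
  then show ?thesis using assms by (rule recursive_fun_comp1)
qed

text \<open>All exponents of \<open>x\<close> lie below those of \<open>y\<close>, so the two sets
  are disjoint; on disjoint finite sets \<open>set_encode\<close> is additive, as no carry
  occurs.\<close>

lemma set_decode_add:
  assumes "0 < x" "0 < y" "mu x < lam y"
  shows "set_decode (x + y) = set_decode x \<union> set_decode y"
proof -
  have "i < j" if "i \<in> set_decode x" "j \<in> set_decode y" for i j
  proof -
    have "i \<le> mu x" using that by (simp add: mu_def)
    also have "\<dots> < lam y" by fact
    also have "lam y \<le> j" using that by (simp add: lam_def)
    finally show ?thesis .
  qed
  then have "set_decode x \<inter> set_decode y = {}" by blast
  then have "set_encode (set_decode x \<union> set_decode y) = set_encode (set_decode x) + set_encode (set_decode y)"
    unfolding set_encode_def by (intro sum.union_disjoint) auto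
  then have "set_encode (set_decode x \<union> set_decode y) = x + y" by simp
  then show ?thesis using set_encode_inverse[of "set_decode x \<union> set_decode y"] by simp
qed

lemma lam_add: "0 < x \<Longrightarrow> 0 < y \<Longrightarrow> mu x < lam y \<Longrightarrow> lam (x + y) = lam x"
  using lam_le_mu[of x] by (simp add: lam_def[of "x + y"] set_decode_add Min_Un set_decode_nonempty flip: lam_def)

lemma mu_add: "0 < x \<Longrightarrow> 0 < y \<Longrightarrow> mu x < lam y \<Longrightarrow> mu (x + y) = mu y"
  using lam_le_mu[of y] by (simp add: mu_def[of "x + y"] set_decode_add Max_Un set_decode_nonempty flip: mu_def)

section \<open>Strong computable reducibility\<close>

text \<open>\<open>st k\<close> is the parity of the number of elements of \<open>H\<close> below
  \<open>k\<close>, so the two parts consist of the elements of even and of odd rank.\<close>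

lemma split_infinite:
  assumes H: "recursive_pred S 1 (\<lambda>ys. ys ! 0 \<in> H)" "infinite H"
  shows "\<exists>A B. recursive_pred S 1 (\<lambda>ys. ys ! 0 \<in> A) \<and> recursive_pred S 1 (\<lambda>ys. ys ! 0 \<in> B) \<and>
    A \<subseteq> H \<and> B \<subseteq> H \<and> A \<inter> B = {} \<and> infinite A \<and> infinite B"
proof -
  define st :: "nat \<Rightarrow> nat" where "st = rec_nat 0 (\<lambda>k v. if k \<in> H then 1 - v else v)"
  have st: "st 0 = 0" "\<And>k. st (Suc k) = (if k \<in> H then 1 - st k else st k)" by (simp_all add: st_def)
  have le: "st k \<le> 1" for k by (induction k) (auto simp: st)
  have rec: "recursive_fun S 1 (\<lambda>ys. st (ys ! 0))"
    unfolding st_def by (rule recursive_fun_prim1) (intro recursive_pred_comp1[OF H(1)] computable; simp)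
  let ?A = "\<lambda>v. {x \<in> H. st x = v}"
  have inf: "infinite (?A v)" if v: "v \<le> 1" for v
  proof
    assume "finite (?A v)"
    then obtain N where "\<forall>x\<in>?A v. x < N" using finite_nat_set_iff_bounded by blast
    then have N: "\<And>x. x \<in> H \<Longrightarrow> st x = v \<Longrightarrow> x < N" by blast
    obtain h where h: "h \<in> H" "N \<le> h" using H(2) infinite_nat_iff_unbounded_le by blast
    obtain h'' where h'': "h'' \<in> H" "h < h''" using H(2) infinite_nat_iff_unbounded by blast
    \<comment> \<open>The successor of \<open>h\<close> in \<open>H\<close>: the two have opposite
      parities, so one of them belongs to the part that was supposed to lie below
      \<open>N\<close>.\<close>
    define h' where "h' = (LEAST x. x \<in> H \<and> h < x)"
    have h': "h' \<in> H" "h < h'" unfolding h'_def using LeastI[of "\<lambda>x. x \<in> H \<and> h < x" h''] h'' by auto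
    have no: "x \<notin> H" if "h < x" "x < h'" for x
      using that not_less_Least[of x "\<lambda>x. x \<in> H \<and> h < x"] unfolding h'_def by blast
    have "st x = st (Suc h)" if "Suc h \<le> x" "x \<le> h'" for x
      using that by (induction x rule: dec_induct) (auto simp: st no)
    then have "st h' = 1 - st h" using h' h(1) by (simp add: st)
    moreover have "st h \<noteq> v" "st h' \<noteq> v" using N h h' by fastforce+
    ultimately show False using le[of h] v by linarith
  qed
  have "recursive_pred S 1 (\<lambda>ys. ys ! 0 \<in> ?A v)" for v
    unfolding mem_Collect_eq by (intro rec recursive_pred_comp1[OF H(1)] computable; simp)
  then show ?thesis using inf[of 0] inf[of 1] by (intro exI[of _ "?A 0"] exI[of _ "?A 1"]) auto
qed

text \<open>It is not decided effectively which case applies; a separate algorithm for each case is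
  enough, since the reducibility is not uniform.\<close>

lemma disjoint_infinite_refinement:
  assumes H1: "recursive_pred S 1 (\<lambda>ys. ys ! 0 \<in> H1)" "infinite H1"
    and H2: "recursive_pred S 1 (\<lambda>ys. ys ! 0 \<in> H2)" "infinite H2"
  shows "\<exists>A B. recursive_pred S 1 (\<lambda>ys. ys ! 0 \<in> A) \<and> recursive_pred S 1 (\<lambda>ys. ys ! 0 \<in> B) \<and>
    A \<subseteq> H1 \<and> B \<subseteq> H2 \<and> A \<inter> B = {} \<and> infinite A \<and> infinite B"
proof -
  have rec: "recursive_pred S 1 (\<lambda>ys. ys ! 0 \<in> H1 - H2)" "recursive_pred S 1 (\<lambda>ys. ys ! 0 \<in> H2 - H1)"
    "recursive_pred S 1 (\<lambda>ys. ys ! 0 \<in> H1 \<inter> H2)"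
    unfolding Diff_iff Int_iff by (intro computable H1 H2)+
  consider "infinite (H1 - H2)" | "infinite (H2 - H1)" | "infinite (H1 \<inter> H2)"
    using H1(2) by (metis Int_Diff_Un finite_UnI)
  then show ?thesis
  proof cases
    case 1
    then show ?thesis using rec(1) H2 by (intro exI[of _ "H1 - H2"] exI[of _ H2]) auto
  next
    case 2
    then show ?thesis using rec(2) H1 by (intro exI[of _ H1] exI[of _ "H2 - H1"]) auto
  next
    case 3
    then show ?thesis using split_infinite[OF rec(3)] by blast
  qed
qed

text \<open>The values of \<open>L\<close> on \<open>A\<close> are unbounded, so the search for an
  element with a value above \<open>y\<close> ends, and by monotonicity every preimage of
  \<open>y\<close> in \<open>A\<close> lies below the element found.\<close>

lemma recursive_pred_image:
  assumes A: "recursive_pred S 1 (\<lambda>ys. ys ! 0 \<in> A)" "infinite A"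
    and L: "recursive_fun S 1 (\<lambda>ys. L (ys ! 0))" "strict_mono_on A L"
  shows "recursive_pred S 1 (\<lambda>ys. ys ! 0 \<in> L ` A - {0})" and "infinite (L ` A - {0})"
proof -
  have inf: "infinite (L ` A)" using A(2) L(2) strict_mono_on_imp_inj_on finite_imageD by blast
  then show "infinite (L ` A - {0})" by simp
  define N where "N y = (LEAST h. h \<in> A \<and> y < L h)" for y
  have ex: "\<exists>h. h \<in> A \<and> y < L h" for y
    using inf infinite_nat_iff_unbounded[of "L ` A"] by (metis imageE)
  have N: "N y \<in> A" "y < L (N y)" for y unfolding N_def using LeastI_ex[OF ex[of y]] by auto
  have recN: "recursive_fun S 1 (\<lambda>ys. N (ys ! 0))"
    unfolding N_def
    by (rule recursive_fun_Least[OF _ ex]) (intro recursive_pred_comp1[OF A(1)] recursive_fun_comp1[OF L(1)] computable; simp)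
  have "y \<in> L ` A - {0} \<longleftrightarrow> 0 < y \<and> (\<exists>h<N y. h \<in> A \<and> L h = y)" for y
  proof -
    have "h < N y" if "h \<in> A" "L h = y" for h
      using that N[of y] L(2) by (metis linorder_neqE_nat less_asym less_irrefl strict_mono_onD)
    then show ?thesis by auto
  qed
  moreover have "recursive_pred S 2 (\<lambda>ys. \<exists>h<ys ! 0. h \<in> A \<and> L h = ys ! 1)"
    by (rule recursive_pred_ex) (intro recursive_pred_comp1[OF A(1)] recursive_fun_comp1[OF L(1)] computable; simp)
  then have "recursive_pred S 1 (\<lambda>ys. \<exists>h<N (ys ! 0). h \<in> A \<and> L h = ys ! 0)"
    by (rule recursive_pred_comp2[where Q = "\<lambda>b y. \<exists>h<b. h \<in> A \<and> L h = y"]) (intro recN computable; simp)+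
  then have "recursive_pred S 1 (\<lambda>ys. 0 < ys ! 0 \<and> (\<exists>h<N (ys ! 0). h \<in> A \<and> L h = ys ! 0))"
    by (intro computable) simp_all
  ultimately show "recursive_pred S 1 (\<lambda>ys. ys ! 0 \<in> L ` A - {0})" by simp
qed

text \<open>The reduction is strong because thinning the sets and taking their exponents depends on
  \<open>H1\<close> and \<open>H2\<close> alone: the oracle for the new solution is
  \<open>S\<close>, and the colouring is not consulted again.\<close>

theorem IPT_reducible: "strongly_computably_reducible IPT_problem IPHT_apart_problem"
  unfolding strongly_computably_reducible_def
proof
  fix I assume "I \<in> instances IPT_problem"
  then obtain c where I: "I = pair_colouring_graph c" and c: "\<And>x y. x < y \<Longrightarrow> c {x, y} < 2"
    by (auto simp: IPT_problem_def)
  \<comment> \<open>One oracle query gives the colour. If the two exponents coincide, the code is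
    not in the graph and the colour is 0 by default.\<close>
  define f :: "nat \<Rightarrow> nat" where "f m = of_bool (prod_encode (prod_encode (lam m, mu m), 1) \<in> I)" for m
  have f: "f m = c {lam m, mu m}" if "lam m < mu m" for m
  proof -
    have "prod_encode (prod_encode (lam m, mu m), 1) \<in> I \<longleftrightarrow> c {lam m, mu m} = 1"
      using that unfolding I pair_colouring_graph_def by auto
    then show ?thesis using c[OF that] unfolding f_def by (cases "c {lam m, mu m}") auto
  qed
  let ?J = "colouring_graph f"
  have "?J \<in> instances IPHT_apart_problem"
    by (auto simp: IPHT_apart_problem_def f_def)
  moreover have "computable_from ?J I"
  proof (rule computable_fromI)
    let ?l = "\<lambda>n. if n = 0 then 0 else lam n" and ?u = "\<lambda>n. if n = 0 then 0 else mu n"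
    let ?Q = "\<lambda>n x. 0 < n \<and> x = prod_encode (n, of_bool (prod_encode (prod_encode (?l n, ?u n), 1) \<in> I))"
    \<comment> \<open>The argument of a graph element is at most its code, so a bounded search
      suffices.\<close>
    have "x \<in> ?J \<longleftrightarrow> (\<exists>n<Suc x. ?Q n x)" for x
      using le_prod_encode_1 by (auto simp: colouring_graph_def f_def less_Suc_eq_le)
    moreover have "recursive_pred I 2 (\<lambda>ys. \<exists>n<ys ! 0. ?Q n (ys ! 1))"
      by (rule recursive_pred_ex) (intro recursive_pred_oracle computable; simp)
    then have "recursive_pred I 1 (\<lambda>ys. \<exists>n<Suc (ys ! 0). ?Q n (ys ! 0))"
      by (rule recursive_pred_comp2[where Q = "\<lambda>b x. \<exists>n<b. ?Q n x"]) (intro computable; simp)+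
    ultimately show "recursive_pred I 1 (\<lambda>xs. xs ! 0 \<in> ?J)" by simp
  qed
  moreover have "\<exists>T\<in>solutions IPT_problem I. computable_from T S" if S: "S \<in> solutions IPHT_apart_problem ?J" for S
  proof -
    obtain H1 H2 f' k where S: "S = join H1 H2" and H: "infinite H1" "infinite H2" "0 \<notin> H1" "0 \<notin> H2"
      and ap: "apart (H1 \<union> H2)" and f': "?J = colouring_graph f'" and k: "k < 2"
      and homog: "\<And>x1 x2. x1 \<in> H1 \<Longrightarrow> x2 \<in> H2 \<Longrightarrow> x1 < x2 \<Longrightarrow> f' (x1 + x2) = k"
      using S by (auto simp: IPHT_apart_problem_def)
    \<comment> \<open>The solution comes with some colouring whose graph is \<open>?J\<close>; the
      graph determines it on positive numbers only.\<close>
    have ff': "f' m = f m" if "0 < m" for m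
    proof -
      have "prod_encode (m, f m) \<in> ?J" using that by (auto simp: colouring_graph_def)
      then have "prod_encode (m, f m) \<in> colouring_graph f'" by (simp only: f')
      then show ?thesis by (auto simp: colouring_graph_def)
    qed
    have "x \<in> H1 \<longleftrightarrow> 2 * x \<in> S" "x \<in> H2 \<longleftrightarrow> Suc (2 * x) \<in> S" for x
      unfolding S join_def by (auto; presburger)+
    then have rec: "recursive_pred S 1 (\<lambda>ys. ys ! 0 \<in> H1)" "recursive_pred S 1 (\<lambda>ys. ys ! 0 \<in> H2)"
      by (simp, intro recursive_pred_oracle computable; simp)+
    obtain A B where AB: "recursive_pred S 1 (\<lambda>ys. ys ! 0 \<in> A)" "recursive_pred S 1 (\<lambda>ys. ys ! 0 \<in> B)"
      "A \<subseteq> H1" "B \<subseteq> H2" "A \<inter> B = {}" "infinite A" "infinite B"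
      using disjoint_infinite_refinement[OF rec(1) H(1) rec(2) H(2)] by blast
    have pos: "0 < x" if "x \<in> H1 \<union> H2" for x using that H(3,4) by (cases x) auto
    have ap: "mu x < lam y" if "x \<in> H1 \<union> H2" "y \<in> H1 \<union> H2" "x < y" for x y
      using ap that unfolding apart_def by blast
    let ?l = "\<lambda>n. if n = 0 then 0 else lam n" and ?u = "\<lambda>n. if n = 0 then 0 else mu n"
    have incr: "lam x < lam y" "mu x < mu y" if "x \<in> H1 \<union> H2" "y \<in> H1 \<union> H2" "x < y" for x y
      using ap[OF that] lam_le_mu[OF pos[OF that(1)]] lam_le_mu[OF pos[OF that(2)]] by simp_all
    have nz: "x \<noteq> 0" if "x \<in> A \<or> x \<in> B" for x using pos[of x] AB(3,4) that by blast
    have "strict_mono_on A ?l"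
      using AB(3) by (intro strict_mono_onI) (auto simp: nz intro!: incr)
    moreover have "recursive_fun S 1 (\<lambda>ys. ?l (ys ! 0))" by (intro computable) simp
    ultimately have l: "recursive_pred S 1 (\<lambda>ys. ys ! 0 \<in> ?l ` A - {0})" "infinite (?l ` A - {0})"
      using recursive_pred_image[OF AB(1,6), of ?l] by blast+
    have "strict_mono_on B ?u"
      using AB(4) by (intro strict_mono_onI) (auto simp: nz intro!: incr)
    moreover have "recursive_fun S 1 (\<lambda>ys. ?u (ys ! 0))" by (intro computable) simp
    ultimately have u: "recursive_pred S 1 (\<lambda>ys. ys ! 0 \<in> ?u ` B - {0})" "infinite (?u ` B - {0})"
      using recursive_pred_image[OF AB(2,7), of ?u] by blast+
    let ?T = "join (?l ` A - {0}) (?u ` B - {0})"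
    have "c {x, y} = k" if xy: "x \<in> ?l ` A - {0}" "y \<in> ?u ` B - {0}" "x < y" for x y
    proof -
      obtain a b where a: "a \<in> A" "x = lam a" and b: "b \<in> B" "y = mu b"
        using xy(1,2) by (auto split: if_splits)
      have ab: "a \<in> H1" "b \<in> H2" "a \<noteq> b" using a b AB by auto
      have p: "0 < a" "0 < b" using pos ab by auto
      \<comment> \<open>The elements differ because \<open>A\<close> and \<open>B\<close> are
        disjoint, and \<open>b < a\<close> would put \<open>y\<close> below \<open>x\<close> by
        apartness.\<close>
      have "a < b"
      proof (rule ccontr)
        assume "\<not> a < b"
        then have "mu b < lam a" using ap[of b a] ab by auto
        then show False using a b \<open>x < y\<close> by simp
      qed
      then have m: "mu a < lam b" using ap ab by blast
      have "lam (a + b) = x" "mu (a + b) = y" using lam_add[OF p m] mu_add[OF p m] a b by auto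
      then show ?thesis using homog[OF ab(1,2) \<open>a < b\<close>] ff'[of "a + b"] f[of "a + b"] p \<open>x < y\<close> by simp
    qed
    moreover have "join X Y \<in> solutions IPT_problem I"
      if "infinite X" "infinite Y" "0 \<notin> X" "0 \<notin> Y" "\<And>x y. x \<in> X \<Longrightarrow> y \<in> Y \<Longrightarrow> x < y \<Longrightarrow> c {x, y} = k" for X Y
      using that k I unfolding IPT_problem_def problem.sel mem_Collect_eq by blast
    ultimately have "?T \<in> solutions IPT_problem I" using l(2) u(2) by blast
    moreover have "computable_from ?T S"
    proof (rule computable_fromI)
      have "y \<in> join X Y \<longleftrightarrow> (y mod 2 = 0 \<and> y div 2 \<in> X) \<or> (y mod 2 = 1 \<and> y div 2 \<in> Y)" for X Y y
      proof -
        obtain n where "y = 2 * n \<or> y = 2 * n + 1" by (metis evenE oddE)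
        then show ?thesis unfolding join_def by (auto; presburger)
      qed
      moreover have "recursive_pred S 1 (\<lambda>ys. (ys ! 0 mod 2 = 0 \<and> ys ! 0 div 2 \<in> ?l ` A - {0}) \<or>
        (ys ! 0 mod 2 = 1 \<and> ys ! 0 div 2 \<in> ?u ` B - {0}))"
        by (intro recursive_pred_or recursive_pred_and recursive_pred_comp1[OF l(1)] recursive_pred_comp1[OF u(1)] computable; simp)
      ultimately show "recursive_pred S 1 (\<lambda>ys. ys ! 0 \<in> ?T)" by simp
    qed
    ultimately show ?thesis by blast
  qed
  ultimately show "\<exists>J\<in>instances IPHT_apart_problem. computable_from J I \<and>
    (\<forall>S\<in>solutions IPHT_apart_problem J. \<exists>T\<in>solutions IPT_problem I. computable_from T S)" by blast
qed

theorem theorem6: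
  "(RCA0 \<turnstile> (IPT \<^bold>\<longleftrightarrow> IPHT_apart)) \<and>
   strongly_computably_reducible IPT_problem IPHT_apart_problem"
  using RCA0_equivalence IPT_reducible by blast

end
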